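(* Let $A=\mathbb{F}_q[T]$, let $f\in A[x]$ be irreducible, $K$ the fraction field of $A[x]/f(x)$, $R$ an $A$-order in $K$, and $\mathfrak p\subset A$ a nonzero prime ideal. Then $$\mathrm{ICM}(R_{\mathfrak p})=\bigsqcup_{\tilde S}W_{\tilde S}(R_{\mathfrak p}),$$ where the union is taken over all $A_{\mathfrak p}$-overorders $\tilde S$ of $R_{\mathfrak p}$ (the ideal class $\{I\}$ being identified with the weak equivalence class $[I]$).
   Context: $F=\mathbb{F}_q(T)$; $A_{\mathfrak p},F_{\mathfrak p}$ are completions, $R_{\mathfrak p}=R\otimes_AA_{\mathfrak p}$, $K_{\mathfrak p}=K\otimes_FF_{\mathfrak p}$. An $A_{\mathfrak p}$-overorder of $R_{\mathfrak p}$ is an $A_{\mathfrak p}$-order in $K_{\mathfrak p}$ containing $R_{\mathfrak p}$. A fractional $R_{\mathfrak p}$-ideal is a finitely generated $R_{\mathfrak p}$-submodule of $K_{\mathfrak p}$ containing an invertible element of $K_{\mathfrak p}$. $(I:J)=\{x\in K_{\mathfrak p}\mid xJ\subseteq I\}$. $\mathrm{ICM}(R_{\mathfrak p})$ is the set of fractional $R_{\mathfrak p}$-ideals modulo principal ideals (i.e. modulo $I\sim xI$, $x\in K_{\mathfrak p}^\times$), and $\{I\}$ is the class of $I$. Fractional ideals $I,J$ are weakly equivalent if $1\in(I:J)(J:I)$; $[I]$ is the weak equivalence class, and $W_{\tilde S}(R_{\mathfrak p})$ is the set of weak equivalence classes $[I]$ of fractional $R_{\mathfrak p}$-ideals with $(I:I)=\tilde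 S$. *)

theory Defs
  imports
    "HOL-Algebra.Ideal_Product"
    "HOL-Algebra.QuotRing"
    "HOL-Algebra.Embedded_Algebras"
    "HOL-Algebra.Algebraic_Closure_Type"
    "HOL-Library.Poly_Mapping"
    "HOL-Library.Disjoint_Sets"
    "HOL-Computational_Algebra.Fraction_Field"
    "HOL-Computational_Algebra.Polynomial"
begin

text \<open>
  The polynomial ring $A = F_q[T]$ is the type \<open>'q poly\<close> with \<open>'q :: {field, finite}\<close>, its
  fraction field $F$ is \<open>'q poly fract\<close>, and $A[x]$ is \<open>'q poly poly\<close>.  Rings that depend on
  $f$, $R$ or the prime are \<open>HOL-Algebra\<close> records; \<^const>\<open>ring_of_type_algebra\<close> turns a
  type-class ring into such a record.
\<close>

section \<open>Fraction fields\<close>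

definition is_fraction_field ::
    "('d, 'm) ring_scheme \<Rightarrow> ('k, 'n) ring_scheme \<Rightarrow> ('d \<Rightarrow> 'k) \<Rightarrow> bool" where
  "is_fraction_field D K \<iota> \<longleftrightarrow>
     field K \<and> \<iota> \<in> ring_hom D K \<and> inj_on \<iota> (carrier D) \<and>
     carrier K = {\<iota> a \<otimes>\<^bsub>K\<^esub> inv\<^bsub>K\<^esub> (\<iota> b) | a b.
                    a \<in> carrier D \<and> b \<in> carrier D \<and> b \<noteq> \<zero>\<^bsub>D\<^esub>}"

text \<open>
  The extension of an injective ring homomorphism \<open>\<alpha>\<close> from an integral domain into the field
  \<open>K\<close> to the fraction field; for such \<open>\<alpha>\<close> the set below is a singleton.
\<close>

definition fract_map :: "('k, 'm) ring_scheme \<Rightarrow> ('a::idom \<Rightarrow> 'k) \<Rightarrow> 'a fract \<Rightarrow> 'k" where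
  "fract_map K \<alpha> z =
     the_elem {\<alpha> a \<otimes>\<^bsub>K\<^esub> inv\<^bsub>K\<^esub> (\<alpha> b) | a b. b \<noteq> 0 \<and> z = Fract a b}"


section \<open>Completions\<close>

text \<open>
  The completion of a ring in the topology for which the additive subgroups
  \<open>G 0 \<supseteq> G 1 \<supseteq> \<dots>\<close> are a neighbourhood basis of 0: Cauchy sequences modulo null sequences.
\<close>

definition cauchy_seqs :: "(nat \<Rightarrow> 'a::comm_ring_1 set) \<Rightarrow> (nat \<Rightarrow> 'a) set" where
  "cauchy_seqs G = {s. \<forall>n. \<exists>N. \<forall>i\<ge>N. \<forall>j\<ge>N. s i - s j \<in> G n}"

definition null_seqs :: "(nat \<Rightarrow> 'a::comm_ring_1 set) \<Rightarrow> (nat \<Rightarrow> 'a) set" where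
  "null_seqs G = {s. \<forall>n. \<exists>N. \<forall>i\<ge>N. s i \<in> G n}"

definition cauchy_ring :: "(nat \<Rightarrow> 'a::comm_ring_1 set) \<Rightarrow> (nat \<Rightarrow> 'a) ring" where
  "cauchy_ring G =
     \<lparr>carrier = cauchy_seqs G, monoid.mult = (\<lambda>s t i. s i * t i), one = (\<lambda>_. 1),
      ring.zero = (\<lambda>_. 0), add = (\<lambda>s t i. s i + t i)\<rparr>"

definition completion :: "(nat \<Rightarrow> 'a::comm_ring_1 set) \<Rightarrow> (nat \<Rightarrow> 'a) set ring" where
  "completion G = cauchy_ring G Quot null_seqs G"

definition to_completion :: "(nat \<Rightarrow> 'a::comm_ring_1 set) \<Rightarrow> 'a \<Rightarrow> (nat \<Rightarrow> 'a) set" where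
  "to_completion G a = null_seqs G +>\<^bsub>cauchy_ring G\<^esub> (\<lambda>_. a)"

text \<open>
  The map of completions induced by a continuous ring homomorphism \<open>h\<close> into a ring completed
  along \<open>H\<close>; all members of a class \<open>Y\<close> yield the same coset.
\<close>

definition completion_map ::
    "(nat \<Rightarrow> 'b::comm_ring_1 set) \<Rightarrow> ('a::comm_ring_1 \<Rightarrow> 'b) \<Rightarrow> (nat \<Rightarrow> 'a) set \<Rightarrow> (nat \<Rightarrow> 'b) set" where
  "completion_map H h Y = the_elem ((\<lambda>s. null_seqs H +>\<^bsub>cauchy_ring H\<^esub> (\<lambda>i. h (s i))) ` Y)"

definition adic :: "'a::comm_ring_1 set \<Rightarrow> nat \<Rightarrow> 'a set" where
  "adic p n = p [^]\<^bsub>ideals_set ring_of_type_algebra\<^esub> n"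

text \<open>
  The neighbourhoods $p^n A_{(p)}$ of 0 in the fraction field, where $A_{(p)}$ is the localisation
  at the prime $p$; they are the sets where the $p$-adic valuation is at least $n$.
\<close>

definition fract_adic :: "'a::idom set \<Rightarrow> nat \<Rightarrow> 'a fract set" where
  "fract_adic p n = {Fract a b | a b. a \<in> adic p n \<and> b \<notin> p}"

definition A_at :: "'q::field poly set \<Rightarrow> (nat \<Rightarrow> 'q poly) set ring" where
  "A_at p = completion (adic p)"

definition F_at :: "'q::field poly set \<Rightarrow> (nat \<Rightarrow> 'q poly fract) set ring" where
  "F_at p = completion (fract_adic p)"

definition A_at_to_F_at ::
    "'q::field poly set \<Rightarrow> (nat \<Rightarrow> 'q poly) set \<Rightarrow> (nat \<Rightarrow> 'q poly fract) set" where
  "A_at_to_F_at p = completion_map (fract_adic p) (\<lambda>a. Fract a 1)"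


section \<open>Tensor products of commutative algebras\<close>

text \<open>
  The ring with additive group free on \<open>carrier B \<times> carrier C\<close>, multiplied componentwise on
  generators.
\<close>

definition pair_ring ::
    "('b, 'm) ring_scheme \<Rightarrow> ('c, 'n) ring_scheme \<Rightarrow> ('b \<times> 'c \<Rightarrow>\<^sub>0 int) ring" where
  "pair_ring B C =
     \<lparr>carrier = {u. Poly_Mapping.keys u \<subseteq> carrier B \<times> carrier C},
      monoid.mult = (\<lambda>u v. frag_extend (\<lambda>(b, c).
                frag_extend (\<lambda>(b', c'). frag_of (b \<otimes>\<^bsub>B\<^esub> b', c \<otimes>\<^bsub>C\<^esub> c')) v) u),
      one = frag_of (\<one>\<^bsub>B\<^esub>, \<one>\<^bsub>C\<^esub>), ring.zero = 0, add = (+)\<rparr>"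

text \<open>
  The base ring is the type \<open>'a\<close>, acting on \<open>B\<close> and \<open>C\<close> through \<open>\<phi>\<close> and \<open>\<psi>\<close>.  The set of
  relations is stable under multiplication by generators, so the ideal it generates is also the
  additive subgroup it generates, and the quotient is the usual tensor product of modules.
\<close>

definition tensor_relations ::
    "('a \<Rightarrow> 'b) \<Rightarrow> ('b, 'm) ring_scheme \<Rightarrow> ('a \<Rightarrow> 'c) \<Rightarrow> ('c, 'n) ring_scheme \<Rightarrow> ('b \<times> 'c \<Rightarrow>\<^sub>0 int) set" where
  "tensor_relations \<phi> B \<psi> C =
     {frag_of (b \<oplus>\<^bsub>B\<^esub> b', c) - frag_of (b, c) - frag_of (b', c) | b b' c.
        b \<in> carrier B \<and> b' \<in> carrier B \<and> c \<in> carrier C} \<union>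
     {frag_of (b, c \<oplus>\<^bsub>C\<^esub> c') - frag_of (b, c) - frag_of (b, c') | b c c'.
        b \<in> carrier B \<and> c \<in> carrier C \<and> c' \<in> carrier C} \<union>
     {frag_of (\<phi> a \<otimes>\<^bsub>B\<^esub> b, c) - frag_of (b, \<psi> a \<otimes>\<^bsub>C\<^esub> c) | a b c.
        b \<in> carrier B \<and> c \<in> carrier C}"

definition tensor_ideal ::
    "('a \<Rightarrow> 'b) \<Rightarrow> ('b, 'm) ring_scheme \<Rightarrow> ('a \<Rightarrow> 'c) \<Rightarrow> ('c, 'n) ring_scheme \<Rightarrow> ('b \<times> 'c \<Rightarrow>\<^sub>0 int) set" where
  "tensor_ideal \<phi> B \<psi> C = Idl\<^bsub>pair_ring B C\<^esub> (tensor_relations \<phi> B \<psi> C)"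

definition tensor ::
    "('a \<Rightarrow> 'b) \<Rightarrow> ('b, 'm) ring_scheme \<Rightarrow> ('a \<Rightarrow> 'c) \<Rightarrow> ('c, 'n) ring_scheme \<Rightarrow> ('b \<times> 'c \<Rightarrow>\<^sub>0 int) set ring" where
  "tensor \<phi> B \<psi> C = pair_ring B C Quot tensor_ideal \<phi> B \<psi> C"

definition tensor_elem ::
    "('a \<Rightarrow> 'b) \<Rightarrow> ('b, 'm) ring_scheme \<Rightarrow> ('a \<Rightarrow> 'c) \<Rightarrow> ('c, 'n) ring_scheme \<Rightarrow> 'b \<Rightarrow> 'c \<Rightarrow> ('b \<times> 'c \<Rightarrow>\<^sub>0 int) set" where
  "tensor_elem \<phi> B \<psi> C b c = tensor_ideal \<phi> B \<psi> C +>\<^bsub>pair_ring B C\<^esub> frag_of (b, c)"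

text \<open>
  The map \<open>g \<otimes> h\<close> into the tensor product of \<open>B\<close> and \<open>C\<close> over the base acting through \<open>\<phi>\<close> and
  \<open>\<psi>\<close>.
\<close>

definition tensor_map ::
    "('a \<Rightarrow> 'b) \<Rightarrow> ('b, 'm) ring_scheme \<Rightarrow> ('a \<Rightarrow> 'c) \<Rightarrow> ('c, 'n) ring_scheme \<Rightarrow>
     ('b0 \<Rightarrow> 'b) \<Rightarrow> ('c0 \<Rightarrow> 'c) \<Rightarrow> ('b0 \<times> 'c0 \<Rightarrow>\<^sub>0 int) set \<Rightarrow> ('b \<times> 'c \<Rightarrow>\<^sub>0 int) set" where
  "tensor_map \<phi> B \<psi> C g h Y =
     the_elem ((\<lambda>u. tensor_ideal \<phi> B \<psi> C +>\<^bsub>pair_ring B C\<^esub>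
                      frag_extend (\<lambda>(b, c). frag_of (g b, h c)) u) ` Y)"


section \<open>Orders and fractional ideals\<close>

definition fg_submodule :: "('e, 'm) ring_scheme \<Rightarrow> 'e set \<Rightarrow> 'e set \<Rightarrow> bool" where
  "fg_submodule E B I \<longleftrightarrow> (\<exists>us. set us \<subseteq> carrier E \<and> I = ring.Span E B us)"

text \<open>
  \<open>S\<close> is an \<open>A\<close>-order in the \<open>F\<close>-algebra \<open>E\<close>, where \<open>A\<close> and \<open>F\<close> are given by their images in
  \<open>E\<close>: a subring that is a finitely generated \<open>A\<close>-module and spans \<open>E\<close> over \<open>F\<close>.
\<close>

definition is_order :: "('e, 'm) ring_scheme \<Rightarrow> 'e set \<Rightarrow> 'e set \<Rightarrow> 'e set \<Rightarrow> bool" where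
  "is_order E A F S \<longleftrightarrow>
     subring S E \<and> fg_submodule E A S \<and>
     (\<exists>us. set us \<subseteq> S \<and> ring.Span E F us = carrier E)"

definition fractional_ideal :: "('e, 'm) ring_scheme \<Rightarrow> 'e set \<Rightarrow> 'e set \<Rightarrow> bool" where
  "fractional_ideal E B I \<longleftrightarrow> fg_submodule E B I \<and> (\<exists>u\<in>I. u \<in> Units E)"

definition colon :: "('e, 'm) ring_scheme \<Rightarrow> 'e set \<Rightarrow> 'e set \<Rightarrow> 'e set" where
  "colon E I J = {x \<in> carrier E. \<forall>y\<in>J. x \<otimes>\<^bsub>E\<^esub> y \<in> I}"

definition ideal_class_rel :: "('e, 'm) ring_scheme \<Rightarrow> 'e set \<Rightarrow> ('e set \<times> 'e set) set" where
  "ideal_class_rel E B =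
     {(I, J). fractional_ideal E B I \<and> fractional_ideal E B J \<and>
              (\<exists>x\<in>Units E. J = x <#\<^bsub>E\<^esub> I)}"

definition ICM :: "('e, 'm) ring_scheme \<Rightarrow> 'e set \<Rightarrow> 'e set set set" where
  "ICM E B = {I. fractional_ideal E B I} // ideal_class_rel E B"

definition weak_rel :: "('e, 'm) ring_scheme \<Rightarrow> 'e set \<Rightarrow> ('e set \<times> 'e set) set" where
  "weak_rel E B =
     {(I, J). fractional_ideal E B I \<and> fractional_ideal E B J \<and>
              \<one>\<^bsub>E\<^esub> \<in> colon E I J \<cdot>\<^bsub>E\<^esub> colon E J I}"

definition weak_classes :: "('e, 'm) ring_scheme \<Rightarrow> 'e set \<Rightarrow> 'e set \<Rightarrow> 'e set set set" where
  "weak_classes E B S =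
     {weak_rel E B `` {I} | I. fractional_ideal E B I \<and> colon E I I = S}"


section \<open>The field $K$ and its completion at a prime\<close>

definition quotient_by :: "'q::field poly poly \<Rightarrow> 'q poly poly set ring" where
  "quotient_by f = ring_of_type_algebra Quot (PIdl\<^bsub>ring_of_type_algebra\<^esub> f)"

definition A_to_K :: "'q::field poly poly \<Rightarrow> ('q poly poly set \<Rightarrow> 'k) \<Rightarrow> 'q poly \<Rightarrow> 'k" where
  "A_to_K f \<iota> a =
     \<iota> (PIdl\<^bsub>ring_of_type_algebra\<^esub> f +>\<^bsub>ring_of_type_algebra\<^esub> [:a:])"

definition F_to_K ::
    "'q::field poly poly \<Rightarrow> ('k, 'm) ring_scheme \<Rightarrow> ('q poly poly set \<Rightarrow> 'k) \<Rightarrow> 'q poly fract \<Rightarrow> 'k" where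
  "F_to_K f K \<iota> = fract_map K (A_to_K f \<iota>)"

definition K_at ::
    "'q::field poly poly \<Rightarrow> ('k, 'm) ring_scheme \<Rightarrow> ('q poly poly set \<Rightarrow> 'k) \<Rightarrow> 'q poly set \<Rightarrow>
     ('k \<times> (nat \<Rightarrow> 'q poly fract) set \<Rightarrow>\<^sub>0 int) set ring" where
  "K_at f K \<iota> p = tensor (F_to_K f K \<iota>) K (to_completion (fract_adic p)) (F_at p)"

definition R_at ::
    "'q::field poly poly \<Rightarrow> ('k, 'm) ring_scheme \<Rightarrow> ('q poly poly set \<Rightarrow> 'k) \<Rightarrow> 'k set \<Rightarrow> 'q poly set \<Rightarrow>
     ('k \<times> (nat \<Rightarrow> 'q poly) set \<Rightarrow>\<^sub>0 int) set ring" where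
  "R_at f K \<iota> R p =
     tensor (A_to_K f \<iota>) (K\<lparr>carrier := R\<rparr>) (to_completion (adic p)) (A_at p)"

text \<open>
  The completed rings are regarded as subrings of \<^const>\<open>K_at\<close> through the canonical maps, which
  are injective.
\<close>

definition R_at_in_K_at ::
    "'q::field poly poly \<Rightarrow> ('k, 'm) ring_scheme \<Rightarrow> ('q poly poly set \<Rightarrow> 'k) \<Rightarrow> 'k set \<Rightarrow> 'q poly set \<Rightarrow>
     ('k \<times> (nat \<Rightarrow> 'q poly fract) set \<Rightarrow>\<^sub>0 int) set set" where
  "R_at_in_K_at f K \<iota> R p =
     tensor_map (F_to_K f K \<iota>) K (to_completion (fract_adic p)) (F_at p) id (A_at_to_F_at p)
       ` carrier (R_at f K \<iota> R p)"

definition F_at_in_K_at ::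
    "'q::field poly poly \<Rightarrow> ('k, 'm) ring_scheme \<Rightarrow> ('q poly poly set \<Rightarrow> 'k) \<Rightarrow> 'q poly set \<Rightarrow>
     ('k \<times> (nat \<Rightarrow> 'q poly fract) set \<Rightarrow>\<^sub>0 int) set set" where
  "F_at_in_K_at f K \<iota> p =
     tensor_elem (F_to_K f K \<iota>) K (to_completion (fract_adic p)) (F_at p) \<one>\<^bsub>K\<^esub>
       ` carrier (F_at p)"

definition A_at_in_K_at ::
    "'q::field poly poly \<Rightarrow> ('k, 'm) ring_scheme \<Rightarrow> ('q poly poly set \<Rightarrow> 'k) \<Rightarrow> 'q poly set \<Rightarrow>
     ('k \<times> (nat \<Rightarrow> 'q poly fract) set \<Rightarrow>\<^sub>0 int) set set" where
  "A_at_in_K_at f K \<iota> p =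
     (\<lambda>c. tensor_elem (F_to_K f K \<iota>) K (to_completion (fract_adic p)) (F_at p) \<one>\<^bsub>K\<^esub>
            (A_at_to_F_at p c)) ` carrier (A_at p)"

definition overorders_at ::
    "'q::field poly poly \<Rightarrow> ('k, 'm) ring_scheme \<Rightarrow> ('q poly poly set \<Rightarrow> 'k) \<Rightarrow> 'k set \<Rightarrow> 'q poly set \<Rightarrow>
     ('k \<times> (nat \<Rightarrow> 'q poly fract) set \<Rightarrow>\<^sub>0 int) set set set" where
  "overorders_at f K \<iota> R p =
     {S. is_order (K_at f K \<iota> p) (A_at_in_K_at f K \<iota> p) (F_at_in_K_at f K \<iota> p) S \<and>
         R_at_in_K_at f K \<iota> R p \<subseteq> S}"

end

(*
  Everything rests on S = (I:I) being semilocal with the uniformizer pi in its Jacobson radical.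
  If u is a unit in I then R_p <= S <= pi^-n R_p for some n, and the quotients are finite, so S is
  a finitely generated A_p-module; hence S is an order, and 1 - pi s is a unit of S by Nakayama.
  Suppose 1 lies in (I:J)(J:I).  In the finite ring S / pi S every element has an idempotent power,
  and the idempotents of the form x y with x in (I:J), y in (J:I) are closed under joins.  As 1 is
  a sum of such products, some x y is 1 modulo pi S, hence a unit of S; then I and J differ by a
  unit of K_p.  Conversely x I is weakly equivalent to I and has the same multiplicator ring, which
  makes the union disjoint.
*)

theory Submission
  imports Defs "HOL-Algebra.Subrings"
begin

section \<open>Submodules and spans\<close>

text \<open>The obstacle is that \<open>S\<close> is only semilocal. When a sum of products equals
  1, no summand need be invertible, and the product to be preferred changes from one maximal ideal
  to the next. Idempotents of the finite quotient glue these choices without naming the maximal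
  ideals or splitting any ring into local factors. Of completeness the ideal theory retains only
  that \<open>1 - \<pi> a\<close> is invertible for \<open>a\<close> in the base; of the finite
  coefficient field, only that there are finitely many residues modulo \<pi>. With the invertibility
  of \<pi> in the algebra and the fact that every element of the completed fraction field becomes
  integral after multiplication by a power of \<pi>, these are the properties of the base used
  there. The argument can therefore run in a commutative ring with distinguished subsets, zero
  divisors allowed, and is kept apart from the concrete completions and tensor products, whose
  elements are cosets of sequences and of formal sums.\<close>

definition (in ring) submod :: "'a set \<Rightarrow> 'a set \<Rightarrow> bool" where
  "submod K N \<longleftrightarrow> N \<subseteq> carrier R \<and> \<zero> \<in> N \<and> (\<forall>x\<in>N. \<forall>y\<in>N. x \<oplus> y \<in> N) \<and> (\<forall>k\<in>K. \<forall>x\<in>N. k \<otimes> x \<in> N)"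

context ring
begin

lemma submodD:
  assumes "submod K N"
  shows "N \<subseteq> carrier R" "\<zero> \<in> N" "\<And>x y. x \<in> N \<Longrightarrow> y \<in> N \<Longrightarrow> x \<oplus> y \<in> N"
    "\<And>k x. k \<in> K \<Longrightarrow> x \<in> N \<Longrightarrow> k \<otimes> x \<in> N"
  using assms unfolding submod_def by auto

text \<open>Negation is multiplication by -1, which lies in the subring of scalars; this is why
  \<open>submod\<close> lists no closure under negation.\<close>

lemma submod_neg:
  assumes "submod K N" "subring K R" "x \<in> N"
  shows "\<ominus> x \<in> N"
proof -
  have "\<ominus> \<one> \<in> K" using assms(2) by (simp add: subringE)
  then have "\<ominus> \<one> \<otimes> x \<in> N" using submodD(4)[OF assms(1)] assms(3) by blast
  moreover have "x \<in> carrier R" using assms submodD(1) by blast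
  ultimately show ?thesis by (simp add: l_minus)
qed

lemma Span_Cons_iff: "v \<in> Span K (u # us) \<longleftrightarrow> (\<exists>k\<in>K. \<exists>w\<in>Span K us. v = k \<otimes> u \<oplus> w)"
  by (simp add: line_extension_mem_iff)

text \<open>Serves as an induction principle for spans: the elements having a desired property are
  shown to form a submodule that contains the generators.\<close>

lemma Span_least:
  assumes "submod K N" "set us \<subseteq> N"
  shows "Span K us \<subseteq> N"
  using assms(2)
proof (induction us)
  case Nil
  then show ?case using submodD(2)[OF assms(1)] by simp
next
  case (Cons u us)
  show ?case
  proof
    fix v assume "v \<in> Span K (u # us)"
    then obtain k w where "k \<in> K" "w \<in> Span K us" "v = k \<otimes> u \<oplus> w"
      unfolding Span_Cons_iff by blast
    then show "v \<in> N" using Cons submodD(3,4)[OF assms(1)] by auto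
  qed
qed

end

context cring
begin

lemma Span_submod:
  assumes "subring K R" "set us \<subseteq> carrier R"
  shows "submod K (Span K us)"
  using assms(2)
proof (induction us)
  case Nil
  have "K \<subseteq> carrier R" using assms(1) subringE(1) by blast
  then show ?case by (auto simp: submod_def)
next
  case (Cons u us)
  note K = subringE[OF assms(1)]
  have N: "submod K (Span K us)" and u: "u \<in> carrier R" using Cons by auto
  note N' = submodD[OF N]
  have Kc: "k \<in> carrier R" if "k \<in> K" for k using that K(1) by (rule rev_subsetD)
  have Nc: "w \<in> carrier R" if "w \<in> Span K us" for w using that N'(1) by (rule rev_subsetD)
  have mem: "k \<otimes> u \<oplus> w \<in> Span K (u # us)" if "k \<in> K" "w \<in> Span K us" for k w
    unfolding Span_Cons_iff using that by auto
  have elim: "\<exists>k w. k \<in> K \<and> w \<in> Span K us \<and> v = k \<otimes> u \<oplus> w" if "v \<in> Span K (u # us)" for v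
    using that unfolding Span_Cons_iff by auto
  show ?case
    unfolding submod_def
  proof (intro conjI ballI subsetI)
    fix v assume "v \<in> Span K (u # us)"
    then obtain k w where "k \<in> K" "w \<in> Span K us" "v = k \<otimes> u \<oplus> w"
      using elim by metis
    then show "v \<in> carrier R" using u Kc Nc by simp
  next
    have "\<zero> \<otimes> u \<oplus> \<zero> \<in> Span K (u # us)" by (rule mem[OF K(2) N'(2)])
    then show "\<zero> \<in> Span K (u # us)" using u by simp
  next
    fix x y assume "x \<in> Span K (u # us)" "y \<in> Span K (u # us)"
    then obtain k w k' w' where k: "k \<in> K" "w \<in> Span K us" "x = k \<otimes> u \<oplus> w"
      "k' \<in> K" "w' \<in> Span K us" "y = k' \<otimes> u \<oplus> w'"
      using elim by metis
    note c = Kc[OF k(1)] Kc[OF k(4)] Nc[OF k(2)] Nc[OF k(5)]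
    have "x \<oplus> y = (k \<oplus> k') \<otimes> u \<oplus> (w \<oplus> w')"
      unfolding k(3,6) using c u by (simp add: l_distr a_ac)
    then show "x \<oplus> y \<in> Span K (u # us)"
      using mem[OF K(7)[OF k(1,4)] N'(3)[OF k(2,5)]] by simp
  next
    fix a x assume a: "a \<in> K" and "x \<in> Span K (u # us)"
    then obtain k w where k: "k \<in> K" "w \<in> Span K us" "x = k \<otimes> u \<oplus> w"
      using elim by metis
    note c = Kc[OF k(1)] Kc[OF a] Nc[OF k(2)]
    have "a \<otimes> x = (a \<otimes> k) \<otimes> u \<oplus> a \<otimes> w"
      unfolding k(3) using c u by (simp add: r_distr m_ac)
    then show "a \<otimes> x \<in> Span K (u # us)"
      using mem[OF K(6)[OF a k(1)] N'(4)[OF a k(2)]] by simp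
  qed
qed

lemma Span_mem:
  assumes "subring K R" "set us \<subseteq> carrier R" "u \<in> set us"
  shows "u \<in> Span K us"
  using assms(2,3)
proof (induction us)
  case (Cons w us)
  note K = subringE[OF assms(1)]
  have N: "submod K (Span K us)" using Span_submod[OF assms(1)] Cons by auto
  note N' = submodD[OF N]
  have w: "w \<in> carrier R" using Cons by auto
  show ?case
  proof (cases "u = w")
    case True
    show ?thesis unfolding Span_Cons_iff True
      by (rule bexI[of _ "\<one>"], rule bexI[of _ "\<zero>"]) (use N' K w in auto)
  next
    case False
    then have "u \<in> Span K us" using Cons by auto
    moreover from this have "u \<in> carrier R" using N' by blast
    ultimately show ?thesis unfolding Span_Cons_iff
      by (intro bexI[of _ "\<zero>"] bexI[of _ u]) (use K w in auto)
  qed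
qed auto

lemma submod_subring:
  assumes "subring S R" "K \<subseteq> S"
  shows "submod K S"
  using subringE[OF assms(1)] assms(2) unfolding submod_def by auto

section \<open>Idempotents and nilpotents of finite commutative rings\<close>

text \<open>Takes the place of the binomial expansion. Multiplying out one factor
  \<open>a \<oplus> b\<close> raises \<open>j\<close> or \<open>k\<close> by one, so
  \<open>j + k + i\<close> is preserved; once no factor is left, one of the two exponents has
  reached its nilpotency bound.\<close>

lemma nilpotent_binomial:
  assumes "a \<in> carrier R" "b \<in> carrier R" "a [^] (n::nat) = \<zero>" "b [^] (m::nat) = \<zero>"
  shows "j + k + i \<ge> n + m \<Longrightarrow> (a \<oplus> b) [^] (i::nat) \<otimes> (a [^] (j::nat) \<otimes> b [^] (k::nat)) = \<zero>"
proof (induction i arbitrary: j k)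
  case 0
  have pow0: "x [^] r = \<zero>" if "x \<in> carrier R" "x [^] s = \<zero>" "s \<le> r" for x and r s :: nat
  proof -
    have "x [^] r = x [^] s \<otimes> x [^] (r - s)" using that(1,3) by (simp add: nat_pow_mult)
    also have "\<dots> = \<zero>" using that(1) unfolding that(2) by simp
    finally show ?thesis .
  qed
  from 0 consider "j \<ge> n" | "k \<ge> m" by linarith
  then show ?case
    by cases (use assms pow0[of a n j] pow0[of b m k] in auto)
next
  case (Suc i)
  let ?x = "(a \<oplus> b) [^] i"
  have distr: "x \<otimes> (a \<oplus> b) \<otimes> (p \<otimes> q) = x \<otimes> (p \<otimes> a \<otimes> q) \<oplus> x \<otimes> (p \<otimes> (q \<otimes> b))"
    if "x \<in> carrier R" "p \<in> carrier R" "q \<in> carrier R" for x p q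
    using assms(1,2) that by (simp add: l_distr r_distr m_ac)
  have "(a \<oplus> b) [^] Suc i \<otimes> (a [^] j \<otimes> b [^] k) = ?x \<otimes> (a [^] j \<otimes> a \<otimes> b [^] k) \<oplus> ?x \<otimes> (a [^] j \<otimes> (b [^] k \<otimes> b))"
    unfolding nat_pow_Suc by (rule distr) (use assms in auto)
  also have "\<dots> = ?x \<otimes> (a [^] Suc j \<otimes> b [^] k) \<oplus> ?x \<otimes> (a [^] j \<otimes> b [^] Suc k)"
    by simp
  also have "\<dots> = \<zero>" using Suc.IH[of "Suc j" k] Suc.IH[of j "Suc k"] Suc.prems by simp
  finally show ?case .
qed

lemma nilpotent_add:
  assumes "a \<in> carrier R" "b \<in> carrier R" "a [^] (n::nat) = \<zero>" "b [^] (m::nat) = \<zero>"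
  shows "(a \<oplus> b) [^] (n + m) = \<zero>"
  using nilpotent_binomial[OF assms, of 0 0 "n + m"] assms by simp

lemma idem_pow:
  assumes "e \<in> carrier R" "e \<otimes> e = e" "n > 0"
  shows "e [^] (n::nat) = e"
  using assms(3)
proof (induction n)
  case (Suc n)
  then show ?case using assms by (cases "n = 0") auto
qed auto

text \<open>By the pigeonhole principle the powers of \<open>a\<close> are periodic from some
  exponent \<open>i\<close> on. If \<open>n\<close> is a multiple of the period and at least
  \<open>i\<close>, passing from exponent \<open>n\<close> to \<open>2 n\<close> shifts by whole
  periods and changes nothing.\<close>

lemma finite_idempotent_power:
  assumes "finite (carrier R)" "a \<in> carrier R"
  shows "\<exists>n>0. a [^] (n::nat) \<otimes> a [^] n = a [^] n"
proof -
  have "\<not> inj (\<lambda>n::nat. a [^] n)"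
  proof
    assume "inj (\<lambda>n::nat. a [^] n)"
    then have "infinite (range (\<lambda>n::nat. a [^] n))" by (rule range_inj_infinite)
    moreover have "range (\<lambda>n::nat. a [^] n) \<subseteq> carrier R" using assms by auto
    ultimately show False using assms(1) finite_subset by blast
  qed
  then obtain i j :: nat where ij: "i < j" "a [^] i = a [^] j"
    unfolding inj_def by (metis linorder_neqE_nat)
  define d where "d = j - i"
  have step: "a [^] (m + d) = a [^] m" if "m \<ge> i" for m
  proof -
    have "a [^] (m + d) = a [^] (m - i) \<otimes> a [^] j"
      using assms(2) that ij by (simp add: nat_pow_mult d_def)
    also have "\<dots> = a [^] (m - i) \<otimes> a [^] i" using ij by simp
    also have "\<dots> = a [^] m" using assms(2) that by (simp add: nat_pow_mult)
    finally show ?thesis .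
  qed
  have steps: "a [^] (m + k * d) = a [^] m" if "m \<ge> i" for m k
  proof (induction k)
    case (Suc k)
    have "a [^] (m + Suc k * d) = a [^] ((m + k * d) + d)" by (simp add: algebra_simps)
    also have "\<dots> = a [^] m" using step[of "m + k * d"] Suc that by simp
    finally show ?case .
  qed simp
  \<comment> \<open>The factor \<open>Suc i\<close>, rather than \<open>i\<close>, keeps
    \<open>n\<close> positive when the periodicity starts at exponent 0.\<close>
  define n where "n = Suc i * d"
  have d: "d > 0" using ij by (simp add: d_def)
  then have "n > 0" "n \<ge> i" unfolding n_def by (simp, metis Suc_leD le_trans mult.commute mult_le_mono1 nat_mult_1 Suc_leI One_nat_def)
  moreover have "a [^] n \<otimes> a [^] n = a [^] (n + Suc i * d)"
    using assms(2) by (simp add: nat_pow_mult n_def)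
  ultimately show ?thesis using steps[of n "Suc i"] by auto
qed

end

context cring
begin

lemma idempotent_complement:
  assumes "e \<in> carrier R" "e \<otimes> e = e"
  shows "(\<one> \<ominus> e) \<otimes> e = \<zero>" "e \<otimes> (\<one> \<ominus> e) = \<zero>" "(\<one> \<ominus> e) \<otimes> (\<one> \<ominus> e) = \<one> \<ominus> e"
proof -
  show 1: "(\<one> \<ominus> e) \<otimes> e = \<zero>"
    using assms by (simp add: minus_eq l_distr l_minus r_neg)
  then show 2: "e \<otimes> (\<one> \<ominus> e) = \<zero>"
    using assms(1) by (simp add: m_comm)
  show "(\<one> \<ominus> e) \<otimes> (\<one> \<ominus> e) = \<one> \<ominus> e"
  proof -
    have "(\<one> \<ominus> e) \<otimes> (\<one> \<ominus> e) = (\<one> \<ominus> e) \<ominus> e \<otimes> (\<one> \<ominus> e)"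
      using assms(1) by (simp add: minus_eq l_distr l_minus)
    then show ?thesis using 2 assms(1) by (simp add: minus_eq)
  qed
qed

text \<open>\<open>j\<close> is the union of \<open>e\<close> and \<open>d\<close> in the Boolean
  algebra of idempotents, and the second equation is de Morgan's law. In that form it is used to
  treat sums of products.\<close>

lemma idempotent_join:
  assumes "e \<in> carrier R" "e \<otimes> e = e" "d \<in> carrier R" "d \<otimes> d = d"
  defines "j \<equiv> e \<oplus> (\<one> \<ominus> e) \<otimes> d"
  shows "j \<otimes> j = j" "\<one> \<ominus> j = (\<one> \<ominus> e) \<otimes> (\<one> \<ominus> d)"
proof -
  define c where "c = \<one> \<ominus> e"
  have c: "c \<in> carrier R" "c \<otimes> e = \<zero>" "e \<otimes> c = \<zero>" "c \<otimes> c = c"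
    using idempotent_complement[OF assms(1,2)] assms(1) by (auto simp: c_def)
  have "j \<otimes> j = e \<otimes> e \<oplus> (e \<otimes> c) \<otimes> d \<oplus> (c \<otimes> e) \<otimes> d \<oplus> (c \<otimes> c) \<otimes> (d \<otimes> d)"
    unfolding j_def c_def[symmetric] using assms(1,3) c(1)
    by (simp add: l_distr r_distr m_ac a_ac)
  also have "\<dots> = j" unfolding c assms(2,4) j_def c_def[symmetric] using assms(1,3) c(1) by simp
  finally show "j \<otimes> j = j" .
  show "\<one> \<ominus> j = (\<one> \<ominus> e) \<otimes> (\<one> \<ominus> d)"
    unfolding j_def using assms(1,3)
    by (simp add: minus_eq l_distr r_distr l_minus r_minus minus_add a_ac)
qed

lemma nilpotent_mult:
  assumes "a \<in> carrier R" "b \<in> carrier R" "b [^] (n::nat) = \<zero>"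
  shows "(a \<otimes> b) [^] n = \<zero>"
  using assms by (simp add: nat_pow_distrib)

end

section \<open>Invertible products over a ring with a finite quotient\<close>

text \<open>Meant for \<open>S\<close> = (I:I), \<open>L\<close> = (I:J), \<open>M\<close> = (J:I)
  and \<open>Q\<close> the quotient of \<open>S\<close> by \<pi>. The map \<open>h\<close> is a
  homomorphism on \<open>S\<close> only: it can be applied to products \<open>x \<otimes> y\<close>,
  while \<open>x\<close> and \<open>y\<close> themselves may have denominators.\<close>

locale finite_quotient_pair = cring R + Q: cring Q for R :: "('a, 'm) ring_scheme" (structure) and Q :: "('b, 'n) ring_scheme" (structure) +
  fixes S L M :: "'a set" and h :: "'a \<Rightarrow> 'b"
  assumes S: "subring S R"
    and fin: "finite (carrier Q)"
    and h: "h \<in> ring_hom (R\<lparr>carrier := S\<rparr>) Q"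
    and L: "submod S L" and M: "submod S M"
    and LM: "\<And>x y. x \<in> L \<Longrightarrow> y \<in> M \<Longrightarrow> x \<otimes> y \<in> S"
begin

lemma h_carr: "s \<in> S \<Longrightarrow> h s \<in> carrier Q"
  and h_mult: "s \<in> S \<Longrightarrow> t \<in> S \<Longrightarrow> h (s \<otimes> t) = h s \<otimes>\<^bsub>Q\<^esub> h t"
  and h_add: "s \<in> S \<Longrightarrow> t \<in> S \<Longrightarrow> h (s \<oplus> t) = h s \<oplus>\<^bsub>Q\<^esub> h t"
  and h_one: "h \<one> = \<one>\<^bsub>Q\<^esub>"
  using ring_hom_memE[OF h] by auto

lemma S_carr: "s \<in> S \<Longrightarrow> s \<in> carrier R"
  and S_mult: "s \<in> S \<Longrightarrow> t \<in> S \<Longrightarrow> s \<otimes> t \<in> S"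
  and S_add: "s \<in> S \<Longrightarrow> t \<in> S \<Longrightarrow> s \<oplus> t \<in> S"
  and S_one: "\<one> \<in> S"
  and S_neg: "s \<in> S \<Longrightarrow> \<ominus> s \<in> S"
  using subringE[OF S] by auto

lemma S_minus: "s \<in> S \<Longrightarrow> t \<in> S \<Longrightarrow> s \<ominus> t \<in> S"
  using S_add S_neg by (simp add: minus_eq)

lemma S_pow: "s \<in> S \<Longrightarrow> s [^] (n::nat) \<in> S"
  by (induction n) (use S_mult S_one in auto)

lemma h_pow: "s \<in> S \<Longrightarrow> h (s [^] (n::nat)) = h s [^]\<^bsub>Q\<^esub> n"
  by (induction n) (use h_one h_mult S_pow in auto)

lemma L_carr: "x \<in> L \<Longrightarrow> x \<in> carrier R" and M_carr: "x \<in> M \<Longrightarrow> x \<in> carrier R"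
  using submodD(1)[OF L] submodD(1)[OF M] by auto

lemma h_complement:
  assumes "s \<in> S"
  shows "h (\<one> \<ominus> s) = \<one>\<^bsub>Q\<^esub> \<ominus>\<^bsub>Q\<^esub> h s"
proof -
  have "(\<one> \<ominus> s) \<oplus> s = \<one>" using S_carr[OF assms] by (simp add: minus_eq a_assoc l_neg)
  then have "h (\<one> \<ominus> s) \<oplus>\<^bsub>Q\<^esub> h s = \<one>\<^bsub>Q\<^esub>"
    using h_add[OF S_minus[OF S_one assms] assms] h_one by simp
  moreover have "h (\<one> \<ominus> s) \<in> carrier Q" "h s \<in> carrier Q"
    using h_carr S_minus[OF S_one assms] assms by auto
  ultimately show ?thesis
    by (metis Q.add.inv_solve_right Q.minus_eq Q.one_closed)
qed

lemma prod_in_S: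
  assumes "z \<in> L \<cdot> M"
  shows "z \<in> S"
  using assms by (induction rule: ideal_prod.induct) (auto simp: LM S_add)

text \<open>A form of the claim that survives addition. In the picture of \<open>Q\<close> as a
  product of local rings, the idempotent covers every factor in which \<open>h z\<close> is a unit,
  and on the remaining factors \<open>h z\<close> is nilpotent. Nilpotent rather than zero is what a
  power of a single product can give, and it is preserved under sums.\<close>

lemma exists_idempotent_product:
  assumes "z \<in> L \<cdot> M"
  shows "\<exists>x\<in>L. \<exists>y\<in>M. \<exists>n::nat. h (x \<otimes> y) \<otimes>\<^bsub>Q\<^esub> h (x \<otimes> y) = h (x \<otimes> y) \<and>
           ((\<one>\<^bsub>Q\<^esub> \<ominus>\<^bsub>Q\<^esub> h (x \<otimes> y)) \<otimes>\<^bsub>Q\<^esub> h z) [^]\<^bsub>Q\<^esub> n = \<zero>\<^bsub>Q\<^esub>"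
  using assms
proof (induction rule: ideal_prod.induct)
  case (prod x y)
  define z where "z = x \<otimes> y"
  have z: "z \<in> S" "h z \<in> carrier Q" using LM prod h_carr by (auto simp: z_def)
  obtain n where n: "n > 0" "h z [^]\<^bsub>Q\<^esub> (n::nat) \<otimes>\<^bsub>Q\<^esub> h z [^]\<^bsub>Q\<^esub> n = h z [^]\<^bsub>Q\<^esub> n"
    using Q.finite_idempotent_power[OF fin z(2)] by blast
  \<comment> \<open>Since \<open>M\<close> is an \<open>S\<close>-module, the surplus powers of
    \<open>z\<close> can be absorbed into \<open>y\<close>; the product with \<open>x\<close> is
    then the idempotent power \<open>z [^] n\<close> modulo the kernel, still in the form of a
    single product.\<close>
  define y' where "y' = z [^] (n - 1) \<otimes> y"
  have y': "y' \<in> M" unfolding y'_def by (rule submodD(4)[OF M S_pow[OF z(1)] prod(2)])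
  have "x \<otimes> y' = z [^] (n - 1) \<otimes> z"
    unfolding y'_def using L_carr[OF prod(1)] M_carr[OF prod(2)] S_carr[OF S_pow[OF z(1), of "n - 1"]]
    by (simp add: z_def m_ac del: nat_pow_distrib)
  also have "\<dots> = z [^] n" using n(1) by (metis Suc_pred' nat_pow_Suc)
  finally have xy': "x \<otimes> y' = z [^] n" .
  define e where "e = h (x \<otimes> y')"
  have e: "e = h z [^]\<^bsub>Q\<^esub> n" "e \<in> carrier Q" "e \<otimes>\<^bsub>Q\<^esub> e = e"
    using h_pow[OF z(1)] n z(2) by (auto simp: e_def xy')
  define c where "c = \<one>\<^bsub>Q\<^esub> \<ominus>\<^bsub>Q\<^esub> e"
  have c: "c \<in> carrier Q" "c \<otimes>\<^bsub>Q\<^esub> c = c" "c \<otimes>\<^bsub>Q\<^esub> e = \<zero>\<^bsub>Q\<^esub>"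
    using Q.idempotent_complement[OF e(2,3)] e(2) by (auto simp: c_def)
  have "(c \<otimes>\<^bsub>Q\<^esub> h z) [^]\<^bsub>Q\<^esub> n = c [^]\<^bsub>Q\<^esub> n \<otimes>\<^bsub>Q\<^esub> e"
    using c z(2) by (simp add: Q.nat_pow_distrib e(1))
  also have "\<dots> = \<zero>\<^bsub>Q\<^esub>" using Q.idem_pow[OF c(1,2) n(1)] c(3) by simp
  finally have "(c \<otimes>\<^bsub>Q\<^esub> h z) [^]\<^bsub>Q\<^esub> n = \<zero>\<^bsub>Q\<^esub>" .
  then show ?case
    using e(3) unfolding c_def e_def z_def
    by (intro bexI[OF _ prod(1)] bexI[OF _ y'] exI[of _ n] conjI)
next
  case (sum s t)
  obtain x1 y1 n1 where 1: "x1 \<in> L" "y1 \<in> M"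
      "h (x1 \<otimes> y1) \<otimes>\<^bsub>Q\<^esub> h (x1 \<otimes> y1) = h (x1 \<otimes> y1)"
      "((\<one>\<^bsub>Q\<^esub> \<ominus>\<^bsub>Q\<^esub> h (x1 \<otimes> y1)) \<otimes>\<^bsub>Q\<^esub> h s) [^]\<^bsub>Q\<^esub> (n1::nat) = \<zero>\<^bsub>Q\<^esub>"
    using sum.IH(1) by blast
  obtain x2 y2 n2 where 2: "x2 \<in> L" "y2 \<in> M"
      "h (x2 \<otimes> y2) \<otimes>\<^bsub>Q\<^esub> h (x2 \<otimes> y2) = h (x2 \<otimes> y2)"
      "((\<one>\<^bsub>Q\<^esub> \<ominus>\<^bsub>Q\<^esub> h (x2 \<otimes> y2)) \<otimes>\<^bsub>Q\<^esub> h t) [^]\<^bsub>Q\<^esub> (n2::nat) = \<zero>\<^bsub>Q\<^esub>"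
    using sum.IH(2) by blast
  define a b where ab: "a = x1 \<otimes> y1" "b = x2 \<otimes> y2"
  have abS: "a \<in> S" "b \<in> S" using LM 1 2 by (auto simp: ab)
  define f where "f = \<one> \<ominus> a"
  have fS: "f \<in> S" using S_minus[OF S_one abS(1)] by (simp add: f_def)
  define e d where ed: "e = h a" "d = h b"
  have e: "e \<in> carrier Q" "e \<otimes>\<^bsub>Q\<^esub> e = e" and d: "d \<in> carrier Q" "d \<otimes>\<^bsub>Q\<^esub> d = d"
    using 1 2 h_carr abS by (auto simp: ed ab)
  define u v where uv: "u = \<one>\<^bsub>Q\<^esub> \<ominus>\<^bsub>Q\<^esub> e" "v = \<one>\<^bsub>Q\<^esub> \<ominus>\<^bsub>Q\<^esub> d"
  have hf: "h f = u" using h_complement[OF abS(1)] by (simp add: f_def uv ed)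
  have u: "u \<in> carrier Q" "u \<otimes>\<^bsub>Q\<^esub> e = \<zero>\<^bsub>Q\<^esub>" "e \<otimes>\<^bsub>Q\<^esub> u = \<zero>\<^bsub>Q\<^esub>" "u \<otimes>\<^bsub>Q\<^esub> u = u"
    using Q.idempotent_complement[OF e] e(1) by (auto simp: uv)
  have v: "v \<in> carrier Q" using d by (auto simp: uv)
  define j where "j = e \<oplus>\<^bsub>Q\<^esub> u \<otimes>\<^bsub>Q\<^esub> d"
  have j: "j \<otimes>\<^bsub>Q\<^esub> j = j" "\<one>\<^bsub>Q\<^esub> \<ominus>\<^bsub>Q\<^esub> j = u \<otimes>\<^bsub>Q\<^esub> v"
    using Q.idempotent_join[OF e d] by (auto simp: j_def uv)
  \<comment> \<open>The cross terms of \<open>x \<otimes> y\<close> are multiples of \<open>a \<otimes> f\<close>, which \<open>h\<close> kills since \<open>h a\<close> is idempotent; so \<open>h (x \<otimes> y)\<close> is the join of the idempotents \<open>h a\<close> and \<open>h b\<close>.\<close>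
  define x where "x = a \<otimes> x1 \<oplus> f \<otimes> x2"
  define y where "y = a \<otimes> y1 \<oplus> (f \<otimes> b) \<otimes> y2"
  have x: "x \<in> L" unfolding x_def
    by (intro submodD(3)[OF L] submodD(4)[OF L] abS fS 1 2)
  have y: "y \<in> M" unfolding y_def
    by (intro submodD(3)[OF M] submodD(4)[OF M] abS fS S_mult 1 2)
  define p q where pq: "p = x1 \<otimes> y2" "q = x2 \<otimes> y1"
  have pqS: "p \<in> S" "q \<in> S" using LM 1 2 by (auto simp: pq)
  note carr = S_carr[OF abS(1)] S_carr[OF abS(2)] S_carr[OF fS] L_carr[OF 1(1)] L_carr[OF 2(1)]
    M_carr[OF 1(2)] M_carr[OF 2(2)]
  have "x \<otimes> y = (a \<otimes> a) \<otimes> (x1 \<otimes> y1) \<oplus> (a \<otimes> f) \<otimes> (b \<otimes> (x1 \<otimes> y2)) \<oplus> (a \<otimes> f) \<otimes> (x2 \<otimes> y1)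
      \<oplus> (f \<otimes> f) \<otimes> (b \<otimes> (x2 \<otimes> y2))"
    unfolding x_def y_def using carr by (simp add: l_distr r_distr m_ac a_ac)
  then have xy: "x \<otimes> y = (a \<otimes> a) \<otimes> a \<oplus> (a \<otimes> f) \<otimes> (b \<otimes> p) \<oplus> (a \<otimes> f) \<otimes> q \<oplus> (f \<otimes> f) \<otimes> (b \<otimes> b)"
    by (simp only: ab[symmetric] pq[symmetric])
  have "h (x \<otimes> y) = (e \<otimes>\<^bsub>Q\<^esub> e) \<otimes>\<^bsub>Q\<^esub> e \<oplus>\<^bsub>Q\<^esub> (e \<otimes>\<^bsub>Q\<^esub> u) \<otimes>\<^bsub>Q\<^esub> (d \<otimes>\<^bsub>Q\<^esub> h p)
      \<oplus>\<^bsub>Q\<^esub> (e \<otimes>\<^bsub>Q\<^esub> u) \<otimes>\<^bsub>Q\<^esub> h q \<oplus>\<^bsub>Q\<^esub> (u \<otimes>\<^bsub>Q\<^esub> u) \<otimes>\<^bsub>Q\<^esub> (d \<otimes>\<^bsub>Q\<^esub> d)"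
    unfolding xy using abS fS pqS by (simp add: h_add h_mult S_mult S_add ed hf)
  also have "\<dots> = j"
    unfolding e(2) d(2) u(3,4) j_def using e(1) d(1) u(1) h_carr[OF pqS(1)] h_carr[OF pqS(2)] by simp
  finally have hxy: "h (x \<otimes> y) = j" .
  have st: "s \<in> S" "t \<in> S" using prod_in_S sum by auto
  note hst = h_carr[OF st(1)] h_carr[OF st(2)]
  \<comment> \<open>The complement of the join is \<open>u v\<close>, and \<open>u\<close> makes
    \<open>h s\<close> nilpotent while \<open>v\<close> makes \<open>h t\<close> nilpotent, so both
    summands on the right are nilpotent.\<close>
  have "u \<otimes>\<^bsub>Q\<^esub> v \<otimes>\<^bsub>Q\<^esub> h (s \<oplus> t) = v \<otimes>\<^bsub>Q\<^esub> (u \<otimes>\<^bsub>Q\<^esub> h s) \<oplus>\<^bsub>Q\<^esub> u \<otimes>\<^bsub>Q\<^esub> (v \<otimes>\<^bsub>Q\<^esub> h t)"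
    using u(1) v hst by (simp add: h_add st Q.r_distr Q.m_ac)
  moreover have "(v \<otimes>\<^bsub>Q\<^esub> (u \<otimes>\<^bsub>Q\<^esub> h s)) [^]\<^bsub>Q\<^esub> n1 = \<zero>\<^bsub>Q\<^esub>"
    using Q.nilpotent_mult[OF v _ 1(4)] u(1) hst by (simp add: uv ed ab)
  moreover have "(u \<otimes>\<^bsub>Q\<^esub> (v \<otimes>\<^bsub>Q\<^esub> h t)) [^]\<^bsub>Q\<^esub> n2 = \<zero>\<^bsub>Q\<^esub>"
    using Q.nilpotent_mult[OF u(1) _ 2(4)] v hst by (simp add: uv ed ab)
  ultimately have "(u \<otimes>\<^bsub>Q\<^esub> v \<otimes>\<^bsub>Q\<^esub> h (s \<oplus> t)) [^]\<^bsub>Q\<^esub> (n1 + n2) = \<zero>\<^bsub>Q\<^esub>"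
    using Q.nilpotent_add[of "v \<otimes>\<^bsub>Q\<^esub> (u \<otimes>\<^bsub>Q\<^esub> h s)" "u \<otimes>\<^bsub>Q\<^esub> (v \<otimes>\<^bsub>Q\<^esub> h t)" n1 n2] u(1) v hst by simp
  then show ?case
    using x y hxy j by (intro bexI[of _ x] bexI[of _ y] exI[of _ "n1 + n2"]) auto
qed

text \<open>For \<open>z = 1\<close> the complement of the idempotent is itself nilpotent, and a
  nilpotent idempotent is zero.\<close>

lemma exists_product_eq_one:
  assumes "\<one> \<in> L \<cdot> M"
  shows "\<exists>x\<in>L. \<exists>y\<in>M. h (x \<otimes> y) = \<one>\<^bsub>Q\<^esub>"
proof -
  obtain x y n where x: "x \<in> L" and y: "y \<in> M"
    and e: "h (x \<otimes> y) \<otimes>\<^bsub>Q\<^esub> h (x \<otimes> y) = h (x \<otimes> y)"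
    and n: "((\<one>\<^bsub>Q\<^esub> \<ominus>\<^bsub>Q\<^esub> h (x \<otimes> y)) \<otimes>\<^bsub>Q\<^esub> h \<one>) [^]\<^bsub>Q\<^esub> (n::nat) = \<zero>\<^bsub>Q\<^esub>"
    using exists_idempotent_product[OF assms] by blast
  define c where "c = \<one>\<^bsub>Q\<^esub> \<ominus>\<^bsub>Q\<^esub> h (x \<otimes> y)"
  have hc: "h (x \<otimes> y) \<in> carrier Q" using h_carr LM x y by simp
  then have c: "c \<in> carrier Q" "c \<otimes>\<^bsub>Q\<^esub> c = c"
    using Q.idempotent_complement[OF hc e] by (auto simp: c_def)
  have "c [^]\<^bsub>Q\<^esub> n = \<zero>\<^bsub>Q\<^esub>" using n c(1) by (simp add: c_def[symmetric] h_one)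
  \<comment> \<open>The exponent \<open>n\<close> may be 0, whereas an idempotent equals only its
    positive powers.\<close>
  then have "c [^]\<^bsub>Q\<^esub> Suc n = \<zero>\<^bsub>Q\<^esub>" using c(1) by simp
  then have "c = \<zero>\<^bsub>Q\<^esub>" using Q.idem_pow[OF c, of "Suc n"] by simp
  then have "h (x \<otimes> y) = \<one>\<^bsub>Q\<^esub>" unfolding c_def using hc by (metis Q.one_closed Q.r_right_minus_eq)
  then show ?thesis using x y by blast
qed

end

section \<open>Orders over a complete discrete valuation ring\<close>

text \<open>The base is a subring \<open>A\<close> of the algebra. \<open>one_minus_inv\<close>
  places \<pi> in the Jacobson radical of \<open>A\<close>, and \<open>residues_finite\<close>
  states by representatives that \<open>A\<close> has finitely many residues modulo \<pi>.\<close>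

locale complete_base = cring E for E :: "('e, 'm) ring_scheme" (structure) +
  fixes A :: "'e set" and \<pi> :: 'e
  assumes A: "subring A E"
    and \<pi>_A: "\<pi> \<in> A"
    and \<pi>_Units: "\<pi> \<in> Units E"
    and one_minus_inv: "\<And>a. a \<in> A \<Longrightarrow> \<exists>b\<in>A. (\<one> \<ominus> \<pi> \<otimes> a) \<otimes> b = \<one>"
    and residues_finite: "\<exists>D. finite D \<and> D \<subseteq> A \<and> (\<forall>a\<in>A. \<exists>d\<in>D. \<exists>b\<in>A. a = d \<oplus> \<pi> \<otimes> b)"
begin

declare Span.simps [simp del]

lemma A_carr: "a \<in> A \<Longrightarrow> a \<in> carrier E"
  and A_mult: "a \<in> A \<Longrightarrow> b \<in> A \<Longrightarrow> a \<otimes> b \<in> A"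
  and A_one: "\<one> \<in> A"
  using subringE[OF A] by auto

lemma \<pi>_carr: "\<pi> \<in> carrier E"
  using \<pi>_A A_carr by simp

lemma \<pi>_pow_A: "\<pi> [^] (n::nat) \<in> A"
  by (induction n) (use \<pi>_A A_mult A_one in auto)

lemma \<pi>_pow_carr: "\<pi> [^] (n::nat) \<in> carrier E"
  using \<pi>_carr by simp

lemma \<pi>_pow_Units: "\<pi> [^] (n::nat) \<in> Units E"
  using \<pi>_Units by (rule Units_pow_closed)

text \<open>Elimination instead of the determinant trick: the relation for one generator is solved
  for it and substituted into the others, which then satisfy the hypothesis for the shorter list.
  Here \<open>N\<close> is any submodule of the ambient ring, not one given inside the span.\<close>

lemma nakayama:
  assumes N: "submod A N" and "set ws \<subseteq> carrier E"
    and "\<And>w. w \<in> set ws \<Longrightarrow> \<exists>n\<in>N. \<exists>v\<in>Span A ws. w = n \<oplus> \<pi> \<otimes> v"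
  shows "set ws \<subseteq> N"
  using assms(2,3)
proof (induction ws)
  case (Cons w ws)
  note N' = submodD[OF N]
  have Nc: "x \<in> carrier E" if "x \<in> N" for x using that N'(1) by auto
  have w: "w \<in> carrier E" and ws: "set ws \<subseteq> carrier E" using Cons.prems by auto
  note V = submodD[OF Span_submod[OF A ws]]
  have Vc: "x \<in> carrier E" if "x \<in> Span A ws" for x using that V(1) by auto
  have split: "\<exists>n a v. n \<in> N \<and> a \<in> A \<and> v \<in> Span A ws \<and> u = n \<oplus> \<pi> \<otimes> (a \<otimes> w \<oplus> v)"
    if u: "u \<in> set (w # ws)" for u
  proof -
    obtain n v where "n \<in> N" "v \<in> Span A (w # ws)" "u = n \<oplus> \<pi> \<otimes> v"
      using Cons.prems(2)[OF u] by auto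
    moreover from this(2) obtain a v' where "a \<in> A" "v' \<in> Span A ws" "v = a \<otimes> w \<oplus> v'"
      unfolding Span_Cons_iff by auto
    ultimately show ?thesis by blast
  qed
  obtain n a v where wn: "n \<in> N" "a \<in> A" "v \<in> Span A ws" and w_eq: "w = n \<oplus> \<pi> \<otimes> (a \<otimes> w \<oplus> v)"
    using split[of w] by auto
  \<comment> \<open>As \<open>1 - \<pi>a\<close> is a unit, \<open>w\<close> is redundant modulo \<open>N\<close> and the induction drops it.\<close>
  obtain b where b: "b \<in> A" "(\<one> \<ominus> \<pi> \<otimes> a) \<otimes> b = \<one>" using one_minus_inv[OF wn(2)] by auto
  note c = w \<pi>_carr A_carr[OF wn(2)] A_carr[OF b(1)] Nc[OF wn(1)] Vc[OF wn(3)]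
  have "(\<one> \<ominus> \<pi> \<otimes> a) \<otimes> w = n \<oplus> \<pi> \<otimes> v"
  proof -
    have "(\<one> \<ominus> \<pi> \<otimes> a) \<otimes> w = w \<ominus> \<pi> \<otimes> (a \<otimes> w)"
      using c by (simp add: minus_eq l_distr l_minus m_assoc)
    also have "\<dots> = n \<oplus> \<pi> \<otimes> (a \<otimes> w \<oplus> v) \<ominus> \<pi> \<otimes> (a \<otimes> w)" using w_eq by simp
    also have "\<dots> = n \<oplus> \<pi> \<otimes> v"
      using c by (simp add: minus_eq r_distr a_ac r_neg r_neg1 r_neg2)
    finally show ?thesis .
  qed
  moreover have "w = (\<one> \<ominus> \<pi> \<otimes> a) \<otimes> b \<otimes> w" using b c by simp
  then have "w = b \<otimes> ((\<one> \<ominus> \<pi> \<otimes> a) \<otimes> w)" using c by (simp add: m_ac)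
  ultimately have w_solved: "w = b \<otimes> n \<oplus> \<pi> \<otimes> (b \<otimes> v)"
    using c by (simp add: r_distr m_ac)
  have "set ws \<subseteq> N"
  proof (rule Cons.IH[OF ws])
    fix u assume "u \<in> set ws"
    then obtain n' a' v' where u: "n' \<in> N" "a' \<in> A" "v' \<in> Span A ws" "u = n' \<oplus> \<pi> \<otimes> (a' \<otimes> w \<oplus> v')"
      using split[of u] by auto
    note c' = c A_carr[OF u(2)] Nc[OF u(1)] Vc[OF u(3)]
    \<comment> \<open>After the substitution the part from \<open>n\<close> goes to
      \<open>N\<close>, and what remains under \<pi> involves only the shorter list.\<close>
    have "u = n' \<oplus> \<pi> \<otimes> (a' \<otimes> (b \<otimes> n \<oplus> \<pi> \<otimes> (b \<otimes> v)) \<oplus> v')"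
      using u(4) w_solved by simp
    also have "\<dots> = (n' \<oplus> \<pi> \<otimes> (a' \<otimes> (b \<otimes> n))) \<oplus> \<pi> \<otimes> (a' \<otimes> (\<pi> \<otimes> (b \<otimes> v)) \<oplus> v')"
      using c' by (simp add: r_distr a_ac)
    finally show "\<exists>n\<in>N. \<exists>v\<in>Span A ws. u = n \<oplus> \<pi> \<otimes> v"
      using u(1,2,3) wn b(1) \<pi>_A
      by (intro bexI[of _ "a' \<otimes> (\<pi> \<otimes> (b \<otimes> v)) \<oplus> v'"] bexI[of _ "n' \<oplus> \<pi> \<otimes> (a' \<otimes> (b \<otimes> n))"])
         (auto intro!: N'(3,4) V(3,4))
  qed
  moreover have "b \<otimes> n \<oplus> \<pi> \<otimes> (b \<otimes> v) \<in> N"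
  proof -
    have "Span A ws \<subseteq> N" using calculation by (rule Span_least[OF N])
    then show ?thesis using wn b(1) \<pi>_A by (intro N'(3,4)) auto
  qed
  ultimately show ?case using w_solved by auto
qed auto

text \<open>Nakayama is applied to \<open>N = u S\<close> with \<open>u = 1 - \<pi> s\<close>. Each
  generator satisfies \<open>w = u w + \<pi> (s w)\<close>, so all of \<open>S\<close>, in
  particular 1, lies in \<open>u S\<close>.\<close>

lemma one_minus_inv_order:
  assumes S: "subring S E" "A \<subseteq> S" "set ws \<subseteq> carrier E" "S = Span A ws" and s: "s \<in> S"
  shows "\<exists>t\<in>S. (\<one> \<ominus> \<pi> \<otimes> s) \<otimes> t = \<one>"
proof -
  note S' = subringE[OF S(1)]
  have Sc: "x \<in> carrier E" if "x \<in> S" for x using that S'(1) by auto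
  define u where "u = \<one> \<ominus> \<pi> \<otimes> s"
  have u: "u \<in> carrier E" using \<pi>_carr Sc[OF s] by (simp add: u_def)
  define N where "N = (\<lambda>t. u \<otimes> t) ` S"
  have N: "submod A N"
    unfolding submod_def N_def
  proof (intro conjI ballI subsetI)
    show "\<zero> \<in> (\<lambda>t. u \<otimes> t) ` S" using S'(2) u by (intro image_eqI[of _ _ \<zero>]) auto
  next
    fix x y assume "x \<in> (\<lambda>t. u \<otimes> t) ` S" "y \<in> (\<lambda>t. u \<otimes> t) ` S"
    then obtain t r where "t \<in> S" "r \<in> S" "x = u \<otimes> t" "y = u \<otimes> r" by auto
    then show "x \<oplus> y \<in> (\<lambda>t. u \<otimes> t) ` S"
      using u Sc S'(7) by (intro image_eqI[of _ _ "t \<oplus> r"]) (auto simp: r_distr)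
  next
    fix k x assume "k \<in> A" "x \<in> (\<lambda>t. u \<otimes> t) ` S"
    then obtain t where "t \<in> S" "k \<in> S" "x = u \<otimes> t" using S(2) by auto
    then show "k \<otimes> x \<in> (\<lambda>t. u \<otimes> t) ` S"
      using u Sc S'(6) by (intro image_eqI[of _ _ "k \<otimes> t"]) (auto simp: m_ac)
  qed (use u Sc in auto)
  have "set ws \<subseteq> N"
  proof (rule nakayama[OF N S(3)])
    fix w assume "w \<in> set ws"
    then have w: "w \<in> S" unfolding S(4) by (rule Span_mem[OF A S(3)])
    have "w = u \<otimes> w \<oplus> \<pi> \<otimes> (s \<otimes> w)"
      unfolding u_def using \<pi>_carr Sc[OF s] Sc[OF w]
      by (simp add: minus_eq l_distr l_minus a_assoc l_neg m_assoc)
    moreover have "u \<otimes> w \<in> N" using w by (auto simp: N_def)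
    moreover have "s \<otimes> w \<in> Span A ws" using S'(6)[OF s w] S(4) by simp
    ultimately show "\<exists>n\<in>N. \<exists>v\<in>Span A ws. w = n \<oplus> \<pi> \<otimes> v" by blast
  qed
  then have "S \<subseteq> N" unfolding S(4) by (rule Span_least[OF N])
  then have "\<one> \<in> N" using S'(3) by auto
  then show ?thesis unfolding N_def u_def by (metis imageE)
qed

text \<open>Reduction modulo \<pi> is done coefficient by coefficient. Representatives are allowed
  to repeat modulo \<pi>, so all combinations of those for the new coefficient with those for the
  shorter list can be taken.\<close>

lemma Span_residues_finite:
  assumes "set ws \<subseteq> carrier E"
  shows "\<exists>D. finite D \<and> D \<subseteq> Span A ws \<and> (\<forall>s\<in>Span A ws. \<exists>d\<in>D. \<exists>t\<in>Span A ws. s = d \<oplus> \<pi> \<otimes> t)"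
  using assms
proof (induction ws)
  case Nil
  then show ?case using \<pi>_carr by (intro exI[of _ "{\<zero>}"]) (auto simp: Span.simps)
next
  case (Cons w ws)
  have w: "w \<in> carrier E" and ws: "set ws \<subseteq> carrier E" using Cons.prems by auto
  note V = submodD[OF Span_submod[OF A ws]]
  obtain D where D: "finite D" "D \<subseteq> Span A ws"
    "\<And>s. s \<in> Span A ws \<Longrightarrow> \<exists>d\<in>D. \<exists>t\<in>Span A ws. s = d \<oplus> \<pi> \<otimes> t"
    using Cons.IH[OF ws] by auto
  obtain C where C: "finite C" "C \<subseteq> A" "\<And>a. a \<in> A \<Longrightarrow> \<exists>d\<in>C. \<exists>b\<in>A. a = d \<oplus> \<pi> \<otimes> b"
    using residues_finite by auto
  define W where "W = (\<lambda>(c, d). c \<otimes> w \<oplus> d) ` (C \<times> D)"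
  have "finite W" using C(1) D(1) by (simp add: W_def)
  moreover have "W \<subseteq> Span A (w # ws)"
    unfolding W_def
  proof clarsimp
    fix c d assume "c \<in> C" "d \<in> D"
    then have "c \<in> A" "d \<in> Span A ws" using C(2) D(2) by auto
    then show "c \<otimes> w \<oplus> d \<in> Span A (w # ws)" unfolding Span_Cons_iff by blast
  qed
  moreover have "\<exists>x\<in>W. \<exists>t\<in>Span A (w # ws). s = x \<oplus> \<pi> \<otimes> t" if sV: "s \<in> Span A (w # ws)" for s
  proof -
    obtain a v where s: "a \<in> A" "v \<in> Span A ws" "s = a \<otimes> w \<oplus> v"
      using sV unfolding Span_Cons_iff by auto
    obtain c b where c: "c \<in> C" "b \<in> A" "a = c \<oplus> \<pi> \<otimes> b" using C(3)[OF s(1)] by auto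
    obtain d t where d: "d \<in> D" "t \<in> Span A ws" "v = d \<oplus> \<pi> \<otimes> t" using D(3)[OF s(2)] by auto
    have carr: "c \<in> carrier E" "b \<in> carrier E" "d \<in> carrier E" "t \<in> carrier E"
      using c(1,2) d(1,2) C(2) D(2) V(1) A_carr by auto
    have "s = (c \<otimes> w \<oplus> d) \<oplus> \<pi> \<otimes> (b \<otimes> w \<oplus> t)"
      unfolding s(3) c(3) d(3) using carr w \<pi>_carr by (simp add: l_distr r_distr a_ac m_ac)
    moreover have "c \<otimes> w \<oplus> d \<in> W" unfolding W_def using c(1) d(1) by auto
    moreover have "b \<otimes> w \<oplus> t \<in> Span A (w # ws)" unfolding Span_Cons_iff using c(2) d(2) by auto
    ultimately show ?thesis by blast
  qed
  ultimately show ?case by blast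
qed

text \<open>Expansion in powers of \<pi>: every further digit is chosen from the finite set of
  residues modulo \<pi>.\<close>

lemma Span_residues_finite_pow:
  assumes ws: "set ws \<subseteq> carrier E"
  shows "\<exists>D. finite D \<and> D \<subseteq> Span A ws \<and>
           (\<forall>s\<in>Span A ws. \<exists>d\<in>D. \<exists>t\<in>Span A ws. s = d \<oplus> \<pi> [^] (n::nat) \<otimes> t)"
proof (induction n)
  case 0
  note V = submodD[OF Span_submod[OF A ws]]
  have "\<zero> \<oplus> \<pi> [^] (0::nat) \<otimes> s = s" if "s \<in> Span A ws" for s using that V(1) by auto
  then show ?case using V(2) by (intro exI[of _ "{\<zero>}"]) auto
next
  case (Suc n)
  note V = submodD[OF Span_submod[OF A ws]]
  obtain D where D: "finite D" "D \<subseteq> Span A ws"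
    "\<And>s. s \<in> Span A ws \<Longrightarrow> \<exists>d\<in>D. \<exists>t\<in>Span A ws. s = d \<oplus> \<pi> [^] n \<otimes> t"
    using Suc.IH by auto
  obtain C where C: "finite C" "C \<subseteq> Span A ws" "\<And>a. a \<in> Span A ws \<Longrightarrow> \<exists>d\<in>C. \<exists>b\<in>Span A ws. a = d \<oplus> \<pi> \<otimes> b"
    using Span_residues_finite[OF ws] by auto
  define W where "W = (\<lambda>(c, d). d \<oplus> \<pi> [^] n \<otimes> c) ` (C \<times> D)"
  have "finite W" using C(1) D(1) by (simp add: W_def)
  moreover have "W \<subseteq> Span A ws"
    unfolding W_def using C(2) D(2) \<pi>_pow_A by (auto intro!: V(3,4))
  moreover have "\<exists>x\<in>W. \<exists>t\<in>Span A ws. s = x \<oplus> \<pi> [^] Suc n \<otimes> t" if s: "s \<in> Span A ws" for s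
  proof -
    obtain d t where d: "d \<in> D" "t \<in> Span A ws" "s = d \<oplus> \<pi> [^] n \<otimes> t" using D(3)[OF s] by auto
    obtain c b where c: "c \<in> C" "b \<in> Span A ws" "t = c \<oplus> \<pi> \<otimes> b" using C(3)[OF d(2)] by auto
    have carr: "c \<in> carrier E" "b \<in> carrier E" "d \<in> carrier E"
      using c(1,2) d(1) C(2) D(2) V(1) by auto
    have "s = (d \<oplus> \<pi> [^] n \<otimes> c) \<oplus> \<pi> [^] Suc n \<otimes> b"
      unfolding d(3) c(3) using carr \<pi>_carr by (simp add: r_distr a_ac m_ac)
    moreover have "d \<oplus> \<pi> [^] n \<otimes> c \<in> W" unfolding W_def using c(1) d(1) by auto
    ultimately show ?thesis using c(2) by blast
  qed
  ultimately show ?case by blast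
qed

text \<open>Both inclusions \<open>Span A ws \<subseteq> S \<subseteq> \<pi>\<^sup>-\<^sup>n Span A ws\<close> have finite index, which replaces Noetherianity of \<open>A\<close>.\<close>

lemma Span_overmodule:
  assumes ws: "set ws \<subseteq> carrier E" and S: "submod A S" "Span A ws \<subseteq> S"
    and bound: "\<And>s. s \<in> S \<Longrightarrow> \<pi> [^] (n::nat) \<otimes> s \<in> Span A ws"
  shows "\<exists>us. set us \<subseteq> carrier E \<and> S = Span A us"
proof -
  note V = submodD[OF Span_submod[OF A ws]] and S' = submodD[OF S(1)]
  have Sc: "x \<in> carrier E" if "x \<in> S" for x using that S'(1) by auto
  obtain D where D: "finite D" "\<And>s. s \<in> Span A ws \<Longrightarrow> \<exists>d\<in>D. \<exists>t\<in>Span A ws. s = d \<oplus> \<pi> [^] n \<otimes> t"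
      "D \<subseteq> Span A ws"
    using Span_residues_finite_pow[OF ws, of n] by auto
  \<comment> \<open>Elements \<open>d / \<pi>^n\<close> that happen to lie in \<open>S\<close>;
    there are finitely many because \<pi> is a unit. If \<open>\<pi>^n s = d + \<pi>^n t\<close>,
    then \<open>s - t\<close> is one of them, so adjoining \<open>W\<close> to \<open>ws\<close>
    generates \<open>S\<close>.\<close>
  define W where "W = {x \<in> S. \<pi> [^] n \<otimes> x \<in> D}"
  have "inj_on (\<lambda>x. \<pi> [^] n \<otimes> x) W"
    using Units_l_cancel[OF \<pi>_pow_Units] Sc by (auto simp: inj_on_def W_def)
  moreover have "(\<lambda>x. \<pi> [^] n \<otimes> x) ` W \<subseteq> D" by (auto simp: W_def)
  ultimately have "finite W" using D(1) by (rule inj_on_finite)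
  then obtain xs where xs: "set xs = W" using finite_list by auto
  have us: "set (ws @ xs) \<subseteq> carrier E" using ws xs Sc by (auto simp: W_def)
  note U = submodD[OF Span_submod[OF A us]]
  have "Span A (ws @ xs) \<subseteq> S"
  proof (rule Span_least[OF S(1)])
    have "set ws \<subseteq> S" using Span_mem[OF A ws] S(2) by auto
    then show "set (ws @ xs) \<subseteq> S" using xs by (auto simp: W_def)
  qed
  moreover have "S \<subseteq> Span A (ws @ xs)"
  proof
    fix s assume s: "s \<in> S"
    obtain d t where d: "d \<in> D" "t \<in> Span A ws" "\<pi> [^] n \<otimes> s = d \<oplus> \<pi> [^] n \<otimes> t"
      using D(2)[OF bound[OF s]] by auto
    have t: "t \<in> S" "t \<in> carrier E" using d(2) S(2) Sc by auto
    have x: "s \<ominus> t \<in> S"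
      using S'(3)[OF s submod_neg[OF S(1) A t(1)]] by (simp add: minus_eq)
    have dc: "d \<in> carrier E" using d(1) D(3) V(1) by auto
    have "\<pi> [^] n \<otimes> (s \<ominus> t) = (d \<oplus> \<pi> [^] n \<otimes> t) \<ominus> \<pi> [^] n \<otimes> t"
      using Sc[OF s] t \<pi>_carr by (simp add: minus_eq r_distr r_minus d(3)[symmetric])
    also have "\<dots> = d" using dc t \<pi>_carr by (simp add: minus_eq a_assoc r_neg)
    finally have "s \<ominus> t \<in> W" using x d(1) by (simp add: W_def)
    then have "s \<ominus> t \<in> Span A (ws @ xs)" using Span_mem[OF A us] xs by auto
    moreover have "t \<in> Span A (ws @ xs)"
    proof -
      have "set ws \<subseteq> Span A (ws @ xs)" using Span_mem[OF A us] by auto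
      then show ?thesis using Span_least[OF Span_submod[OF A us]] d(2) by blast
    qed
    ultimately have "(s \<ominus> t) \<oplus> t \<in> Span A (ws @ xs)" by (rule U(3))
    then show "s \<in> Span A (ws @ xs)" using Sc[OF s] t by (simp add: minus_eq a_assoc l_neg)
  qed
  ultimately show ?thesis using us by blast
qed

end

section \<open>Inverse pairs in modules over an order\<close>

context complete_base
begin

text \<open>The finite quotient of \<open>S\<close> by \<pi> supplies a product \<open>x y\<close>
  congruent to 1. Such an element is a unit of \<open>S\<close>, and its inverse is absorbed into
  \<open>y\<close> because \<open>M\<close> is an \<open>S\<close>-module.\<close>

lemma exists_inverse_pair:
  assumes S: "subring S E" "A \<subseteq> S" "set ws \<subseteq> carrier E" "S = Span A ws"
    and L: "submod S L" and M: "submod S M"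
    and LM: "\<And>x y. x \<in> L \<Longrightarrow> y \<in> M \<Longrightarrow> x \<otimes> y \<in> S" and one: "\<one> \<in> L \<cdot> M"
  shows "\<exists>x\<in>L. \<exists>y\<in>M. x \<otimes> y = \<one>"
proof -
  note S' = subringE[OF S(1)]
  have Sc: "x \<in> carrier E" if "x \<in> S" for x using that S'(1) by auto
  have \<pi>S: "\<pi> \<in> S" using S(2) \<pi>_A by auto
  define T where "T = E\<lparr>carrier := S\<rparr>"
  interpret T: cring T unfolding T_def using subcringI'[OF S(1)] subcring_iff[OF S'(1)] by simp
  have T_simps: "carrier T = S" "a \<oplus>\<^bsub>T\<^esub> b = a \<oplus> b" "a \<otimes>\<^bsub>T\<^esub> b = a \<otimes> b" "\<one>\<^bsub>T\<^esub> = \<one>" for a b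
    by (simp_all add: T_def)
  define P where "P = PIdl\<^bsub>T\<^esub> \<pi>"
  interpret P: ideal P T unfolding P_def by (rule T.cgenideal_ideal) (simp add: T_simps \<pi>S)
  have P_eq: "P = {s \<otimes> \<pi> | s. s \<in> S}" by (simp add: P_def cgenideal_def T_simps)
  define Q where "Q = T Quot P"
  interpret Q: cring Q unfolding Q_def by (rule P.quotient_is_cring) (rule T.is_cring)
  define h where "h = (\<lambda>s. P +>\<^bsub>T\<^esub> s)"
  have h: "h \<in> ring_hom (E\<lparr>carrier := S\<rparr>) Q"
    unfolding h_def Q_def T_def[symmetric] by (rule P.rcos_ring_hom)
  have coset_eq: "h (d \<oplus> \<pi> \<otimes> t) = h d" if "d \<in> S" "t \<in> S" for d t
  proof -
    have "d \<oplus> \<pi> \<otimes> t = t \<otimes> \<pi> \<oplus> d" using that Sc \<pi>_carr by (simp add: a_comm m_comm)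
    then have "d \<oplus> \<pi> \<otimes> t \<in> P +>\<^bsub>T\<^esub> d"
      unfolding a_r_coset_def' P_eq T_simps using that by auto
    then show ?thesis
      unfolding h_def by (rule P.a_repr_independence'[symmetric]) (use that in \<open>simp add: T_simps\<close>)
  qed
  obtain D where D: "finite D" "D \<subseteq> S" "\<And>s. s \<in> S \<Longrightarrow> \<exists>d\<in>D. \<exists>t\<in>S. s = d \<oplus> \<pi> \<otimes> t"
    using Span_residues_finite[OF S(3)] unfolding S(4)[symmetric] by auto
  have "carrier Q \<subseteq> h ` D"
  proof
    fix q assume "q \<in> carrier Q"
    then obtain s where s: "s \<in> S" "q = h s"
      by (auto simp: Q_def FactRing_def A_RCOSETS_def' T_simps h_def)
    obtain d t where "d \<in> D" "t \<in> S" "s = d \<oplus> \<pi> \<otimes> t" using D(3)[OF s(1)] by auto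
    then show "q \<in> h ` D" using coset_eq[of d t] D(2) s(2) by auto
  qed
  then have fin: "finite (carrier Q)" using D(1) by (metis finite_imageI finite_subset)
  interpret pair: finite_quotient_pair E Q S L M h
    by (intro finite_quotient_pair.intro finite_quotient_pair_axioms.intro
        cring_axioms Q.cring_axioms S(1) fin h L M LM)
  obtain x y where xy: "x \<in> L" "y \<in> M" "h (x \<otimes> y) = \<one>\<^bsub>Q\<^esub>"
    using pair.exists_product_eq_one[OF one] by auto
  have xyS: "x \<otimes> y \<in> S" using LM xy by simp
  have "x \<otimes> y \<in> h (x \<otimes> y)" unfolding h_def by (rule P.a_rcos_self) (simp add: T_simps xyS)
  also have "\<dots> = P +>\<^bsub>T\<^esub> \<one>" by (simp add: xy(3) Q_def FactRing_def T_simps)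
  finally obtain s where s: "s \<in> S" "x \<otimes> y = s \<otimes> \<pi> \<oplus> \<one>"
    unfolding a_r_coset_def' P_eq T_simps by auto
  \<comment> \<open>The sign is changed because the congruence gives
    \<open>x y = 1 + \<pi> s\<close>, while invertibility is known for
    \<open>1 - \<pi> s\<close>.\<close>
  obtain t where t: "t \<in> S" "(\<one> \<ominus> \<pi> \<otimes> (\<ominus> s)) \<otimes> t = \<one>"
    using one_minus_inv_order[OF S S'(5)[OF s(1)]] by auto
  have "\<one> \<ominus> \<pi> \<otimes> (\<ominus> s) = x \<otimes> y"
    unfolding s(2) using Sc[OF s(1)] \<pi>_carr by (simp add: minus_eq r_minus a_comm m_comm)
  then have "x \<otimes> y \<otimes> t = \<one>" using t(2) by simp
  moreover have "x \<in> carrier E" "y \<in> carrier E" using submodD(1)[OF L] submodD(1)[OF M] xy(1,2) by auto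
  ultimately have "x \<otimes> (t \<otimes> y) = \<one>" using Sc[OF t(1)] by (simp add: m_ac)
  then show ?thesis using xy(1) submodD(4)[OF M t(1) xy(2)] by auto
qed

end

text \<open>\<open>B\<close> and \<open>F\<close> stand for the images of the completed order and of
  the completed fraction field. \<open>F_denominator\<close> says that powers of \<pi> suffice as
  denominators of \<open>F\<close> over \<open>A\<close>.\<close>

locale base_order = complete_base E A \<pi> for E :: "('e, 'm) ring_scheme" (structure) and A \<pi> +
  fixes F B :: "'e set"
  assumes F_carr: "F \<subseteq> carrier E"
    and F_denominator: "\<And>c. c \<in> F \<Longrightarrow> \<exists>n::nat. \<pi> [^] n \<otimes> c \<in> A"
    and B: "subring B E" and A_B: "A \<subseteq> B"
    and B_fg: "\<exists>ws. set ws \<subseteq> carrier E \<and> B = Span A ws"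
    and B_spans: "\<exists>us. set us \<subseteq> B \<and> Span F us = carrier E"
begin

lemmas B_props = subringE[OF B]

text \<open>Thus the algebra is \<open>B\<close> with \<pi> inverted. An element is a combination of
  finitely many members of \<open>B\<close>, so it is enough to clear the denominators of its
  coefficients, adding up the exponents.\<close>

lemma denominator:
  assumes "e \<in> carrier E"
  shows "\<exists>n::nat. \<pi> [^] n \<otimes> e \<in> B"
proof -
  obtain us where us: "set us \<subseteq> B" "Span F us = carrier E" using B_spans by auto
  have "\<exists>n::nat. \<pi> [^] n \<otimes> e \<in> B" if "set us \<subseteq> B" "e \<in> Span F us" for us e
    using that
  proof (induction us arbitrary: e)
    case Nil
    then show ?case using B_props(2) \<pi>_carr by (auto simp: Span.simps)
  next
    case (Cons u us)
    obtain c v where e: "c \<in> F" "v \<in> Span F us" "e = c \<otimes> u \<oplus> v"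
      using Cons.prems(2) unfolding Span_Cons_iff by auto
    have us: "set us \<subseteq> B" and u: "u \<in> B" using Cons.prems(1) by auto
    obtain n :: nat where n: "\<pi> [^] n \<otimes> v \<in> B" using Cons.IH[OF us e(2)] by auto
    obtain m :: nat where m: "\<pi> [^] m \<otimes> c \<in> A" using F_denominator[OF e(1)] by auto
    have B\<pi>: "\<pi> [^] k \<in> B" for k :: nat using \<pi>_pow_A A_B by auto
    have "v \<in> carrier E"
      using e(2) Span_least[of F "carrier E" us] us B_props(1) F_carr by (auto simp: submod_def)
    moreover have "c \<in> carrier E" "u \<in> carrier E" using e(1) F_carr u B_props(1) by auto
    ultimately have "\<pi> [^] (m + n) \<otimes> e = \<pi> [^] n \<otimes> ((\<pi> [^] m \<otimes> c) \<otimes> u) \<oplus> \<pi> [^] m \<otimes> (\<pi> [^] n \<otimes> v)"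
      unfolding e(3) nat_pow_mult[OF \<pi>_carr, symmetric] using \<pi>_pow_carr[of m] \<pi>_pow_carr[of n]
      by (simp add: r_distr m_ac)
    also have "\<dots> \<in> B"
      by (intro B_props(7) B_props(6)[OF B\<pi>] B_props(6)[OF _ u] n subsetD[OF A_B m])
    finally show ?case by blast
  qed
  then show ?thesis using us assms by metis
qed

lemma fractional_ideal_submod:
  assumes "fractional_ideal E B I"
  shows "submod B I"
  using assms Span_submod[OF B] unfolding fractional_ideal_def fg_submodule_def by auto

text \<open>A common denominator exists because there are finitely many generators. The factor
  \<open>w\<close> is carried along for the case of the inverse of a unit in \<open>I\<close>, which
  yields a bound on (I:I).\<close>

lemma fractional_ideal_bounded:
  assumes "fractional_ideal E B I" "w \<in> carrier E"
  shows "\<exists>n::nat. \<forall>x\<in>I. \<pi> [^] n \<otimes> (w \<otimes> x) \<in> B"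
proof -
  obtain vs where vs: "set vs \<subseteq> carrier E" "I = Span B vs"
    using assms unfolding fractional_ideal_def fg_submodule_def by auto
  have "\<exists>n::nat. \<forall>x\<in>Span B vs. \<pi> [^] n \<otimes> (w \<otimes> x) \<in> B"
    using vs(1)
  proof (induction vs)
    case Nil
    then show ?case using B_props(2) \<pi>_carr assms(2) by (auto simp: Span.simps)
  next
    case (Cons v vs)
    have v: "v \<in> carrier E" and vs: "set vs \<subseteq> carrier E" using Cons.prems by auto
    obtain n :: nat where n: "\<And>x. x \<in> Span B vs \<Longrightarrow> \<pi> [^] n \<otimes> (w \<otimes> x) \<in> B" using Cons.IH[OF vs] by auto
    obtain m :: nat where m: "\<pi> [^] m \<otimes> (w \<otimes> v) \<in> B" using denominator[of "w \<otimes> v"] v assms(2) by auto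
    have B\<pi>: "\<pi> [^] k \<in> B" for k :: nat using \<pi>_pow_A A_B by auto
    have "\<pi> [^] (m + n) \<otimes> (w \<otimes> x) \<in> B" if x: "x \<in> Span B (v # vs)" for x
    proof -
      obtain b y where b: "b \<in> B" "y \<in> Span B vs" "x = b \<otimes> v \<oplus> y"
        using x unfolding Span_Cons_iff by auto
      have "b \<in> carrier E" "y \<in> carrier E"
        using b(1,2) B_props(1) submodD(1)[OF Span_submod[OF B vs]] by auto
      then have "\<pi> [^] (m + n) \<otimes> (w \<otimes> x)
          = (\<pi> [^] n \<otimes> b) \<otimes> (\<pi> [^] m \<otimes> (w \<otimes> v)) \<oplus> \<pi> [^] m \<otimes> (\<pi> [^] n \<otimes> (w \<otimes> y))"
        unfolding b(3) nat_pow_mult[OF \<pi>_carr, symmetric]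
        using \<pi>_pow_carr[of m] \<pi>_pow_carr[of n] v assms(2) by (simp add: r_distr m_ac)
      also have "\<dots> \<in> B"
        by (intro B_props(7) B_props(6)[OF _ m] B_props(6)[OF B\<pi>] n[OF b(2)] b(1))
      finally show ?thesis .
    qed
    then show ?case by blast
  qed
  then show ?thesis using vs(2) by simp
qed

section \<open>Colon modules and multiplicator rings\<close>

lemma colonD: "x \<in> colon E I J \<Longrightarrow> x \<in> carrier E" "x \<in> colon E I J \<Longrightarrow> y \<in> J \<Longrightarrow> x \<otimes> y \<in> I"
  by (auto simp: colon_def)

lemma colonI: "x \<in> carrier E \<Longrightarrow> (\<And>y. y \<in> J \<Longrightarrow> x \<otimes> y \<in> I) \<Longrightarrow> x \<in> colon E I J"
  by (auto simp: colon_def)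

lemma colon_self_subring:
  assumes "submod B I"
  shows "subring (colon E I I) E"
proof (rule subringI)
  note I = submodD[OF assms]
  have Ic: "x \<in> carrier E" if "x \<in> I" for x using that I(1) by auto
  show "colon E I I \<subseteq> carrier E" by (auto simp: colon_def)
  show "\<one> \<in> colon E I I" using Ic by (auto intro!: colonI)
  fix h assume h: "h \<in> colon E I I"
  show "\<ominus> h \<in> colon E I I"
    using colonD[OF h] Ic submod_neg[OF assms B] by (auto intro!: colonI simp: l_minus)
  fix k assume k: "k \<in> colon E I I"
  show "h \<otimes> k \<in> colon E I I" "h \<oplus> k \<in> colon E I I"
    using colonD[OF h] colonD[OF k] Ic I(3) by (auto intro!: colonI simp: m_assoc l_distr)
qed

lemma B_subset_colon_self:
  assumes "submod B I"
  shows "B \<subseteq> colon E I I"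
  using submodD[OF assms] B_props(1) by (auto intro!: colonI)

text \<open>The first part makes (I:J) a module over (I:I); the second, with the two ideals
  exchanged, does the same for (J:I). Both factors of the product are thus modules over one
  ring.\<close>

lemma colon_submod:
  assumes "submod B I" "J \<subseteq> carrier E"
  shows "submod (colon E I I) (colon E I J)" "submod (colon E J J) (colon E I J)"
proof -
  note I = submodD[OF assms(1)]
  have Ic: "x \<in> carrier E" if "x \<in> I" for x using that I(1) by auto
  have Jc: "x \<in> carrier E" if "x \<in> J" for x using that assms(2) by auto
  show "submod (colon E I I) (colon E I J)"
    unfolding submod_def using I(2,3) Jc colonD[of _ I J] colonD[of _ I I]
    by (auto intro!: colonI simp: m_assoc l_distr)
  show "submod (colon E J J) (colon E I J)"
    unfolding submod_def using I(2,3) Jc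
  proof (intro conjI ballI)
    fix k x assume k: "k \<in> colon E J J" and x: "x \<in> colon E I J"
    show "k \<otimes> x \<in> colon E I J"
    proof (rule colonI)
      show "k \<otimes> x \<in> carrier E" using colonD(1)[OF k] colonD(1)[OF x] by simp
      fix y assume y: "y \<in> J"
      have "k \<otimes> x \<otimes> y = x \<otimes> (k \<otimes> y)"
        using colonD(1)[OF k] colonD(1)[OF x] Jc[OF y] by (simp add: m_ac)
      then show "k \<otimes> x \<otimes> y \<in> I" using colonD(2)[OF x colonD(2)[OF k y]] by simp
    qed
  qed (use colonD[of _ I J] in \<open>auto intro!: colonI simp: l_distr\<close>)
qed

lemma colon_self_fg:
  assumes "fractional_ideal E B I"
  shows "\<exists>us. set us \<subseteq> carrier E \<and> colon E I I = Span A us"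
proof -
  note I = fractional_ideal_submod[OF assms]
  obtain u where u: "u \<in> I" "u \<in> Units E" using assms by (auto simp: fractional_ideal_def)
  obtain n :: nat where n: "\<And>x. x \<in> I \<Longrightarrow> \<pi> [^] n \<otimes> (inv u \<otimes> x) \<in> B"
    using fractional_ideal_bounded[OF assms, of "inv u"] u(2) by auto
  obtain ws where ws: "set ws \<subseteq> carrier E" "B = Span A ws" using B_fg by auto
  show ?thesis
  proof (rule Span_overmodule[OF ws(1)])
    show "submod A (colon E I I)"
      using submod_subring[OF colon_self_subring[OF I]] B_subset_colon_self[OF I] A_B by auto
    show "Span A ws \<subseteq> colon E I I" using B_subset_colon_self[OF I] ws(2) by simp
    fix s assume s: "s \<in> colon E I I"
    \<comment> \<open>As \<open>s u\<close> lies in \<open>I\<close>, the bound for \<open>I\<close>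
      with \<open>w = inv u\<close> becomes a bound for \<open>s\<close>.\<close>
    have "inv u \<otimes> (s \<otimes> u) = s"
      using u(2) colonD(1)[OF s] by (metis Units_closed Units_inv_closed Units_l_inv m_lcomm r_one)
    then show "\<pi> [^] n \<otimes> s \<in> Span A ws"
      using n[OF colonD(2)[OF s u(1)]] ws(2) by simp
  qed
qed

lemma colon_self_is_order:
  assumes "fractional_ideal E B I"
  shows "is_order E A F (colon E I I)"
proof -
  note I = fractional_ideal_submod[OF assms]
  show ?thesis
    unfolding is_order_def fg_submodule_def
    using colon_self_subring[OF I] colon_self_fg[OF assms] B_spans B_subset_colon_self[OF I] by blast
qed

text \<open>A pair \<open>x\<close> in (I:J), \<open>y\<close> in (J:I) with \<open>x y = 1\<close>
  gives \<open>y I\<close> inside \<open>J\<close>, and conversely \<open>J = y (x J)\<close> lies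
  inside \<open>y I\<close>.\<close>

lemma weakly_equivalent_imp_principal:
  assumes I: "fractional_ideal E B I" and J: "fractional_ideal E B J"
    and one: "\<one> \<in> colon E I J \<cdot> colon E J I"
  shows "\<exists>x\<in>Units E. J = x <# I"
proof -
  note I' = fractional_ideal_submod[OF I] and J' = fractional_ideal_submod[OF J]
  have c: "I \<subseteq> carrier E" "J \<subseteq> carrier E" using submodD(1) I' J' by auto
  obtain ws where ws: "set ws \<subseteq> carrier E" "colon E I I = Span A ws" using colon_self_fg[OF I] by auto
  have "\<exists>x\<in>colon E I J. \<exists>y\<in>colon E J I. x \<otimes> y = \<one>"
  proof (rule exists_inverse_pair[OF colon_self_subring[OF I'] _ ws _ _ _ one])
    show "A \<subseteq> colon E I I" using B_subset_colon_self[OF I'] A_B by auto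
    show "submod (colon E I I) (colon E I J)" "submod (colon E I I) (colon E J I)"
      using colon_submod I' J' c by auto
    fix x y assume x: "x \<in> colon E I J" and y: "y \<in> colon E J I"
    show "x \<otimes> y \<in> colon E I I"
    proof (rule colonI)
      show "x \<otimes> y \<in> carrier E" using colonD(1)[OF x] colonD(1)[OF y] by simp
      fix z assume z: "z \<in> I"
      then show "x \<otimes> y \<otimes> z \<in> I"
        using colonD(2)[OF x colonD(2)[OF y z]] colonD(1)[OF x] colonD(1)[OF y] c by (auto simp: m_assoc)
    qed
  qed
  then obtain x y where x: "x \<in> colon E I J" and y: "y \<in> colon E J I" and xy: "x \<otimes> y = \<one>" by auto
  note xc = colonD(1)[OF x] and yc = colonD(1)[OF y]
  have "y \<in> Units E" using xy xc yc by (auto simp: Units_def m_comm)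
  moreover have "J = y <# I"
  proof
    show "y <# I \<subseteq> J" using colonD(2)[OF y] by (auto simp: l_coset_def)
    show "J \<subseteq> y <# I"
    proof
      fix z assume z: "z \<in> J"
      have "z \<in> carrier E" using z c by auto
      then have "z = y \<otimes> (x \<otimes> z)" using xy xc yc by (metis m_assoc m_comm l_one)
      then show "z \<in> y <# I" using colonD(2)[OF x z] by (auto simp: l_coset_def)
    qed
  qed
  ultimately show ?thesis by auto
qed

lemma principal_imp_weakly_equivalent:
  assumes I: "fractional_ideal E B I" and x: "x \<in> Units E"
  shows "\<one> \<in> colon E I (x <# I) \<cdot> colon E (x <# I) I" "colon E (x <# I) (x <# I) = colon E I I"
proof -
  have c: "y \<in> carrier E" if "y \<in> I" for y using submodD(1)[OF fractional_ideal_submod[OF I]] that by auto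
  have xc: "x \<in> carrier E" "inv x \<in> carrier E" using x by auto
  have cancel: "inv x \<otimes> (x \<otimes> y) = y" if "y \<in> carrier E" for y
    using that xc x by (simp add: m_assoc[symmetric])
  \<comment> \<open>With \<open>x\<close> in (xI:I) this writes 1 as a single product.\<close>
  have "inv x \<in> colon E I (x <# I)"
    using c xc by (auto simp: l_coset_def cancel intro!: colonI)
  moreover have "x \<in> colon E (x <# I) I"
    using c xc by (auto simp: l_coset_def intro!: colonI)
  ultimately have "inv x \<otimes> x \<in> colon E I (x <# I) \<cdot> colon E (x <# I) I" by (rule ideal_prod.prod)
  then show "\<one> \<in> colon E I (x <# I) \<cdot> colon E (x <# I) I" using x by simp
  have "s \<otimes> (x \<otimes> y) \<in> x <# I \<longleftrightarrow> s \<otimes> y \<in> I" if "s \<in> carrier E" "y \<in> I" for s y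
  proof -
    have "s \<otimes> (x \<otimes> y) = x \<otimes> (s \<otimes> y)" using that(1) xc c[OF that(2)] by (simp add: m_ac)
    moreover have "x \<otimes> (s \<otimes> y) \<in> x <# I \<longleftrightarrow> s \<otimes> y \<in> I"
      using cancel c that xc by (auto simp: l_coset_def) (metis m_closed)
    ultimately show ?thesis by simp
  qed
  then show "colon E (x <# I) (x <# I) = colon E I I"
    by (auto simp: colon_def l_coset_def)
qed

text \<open>Both relations carry the condition that the two ideals are fractional, so they agree as
  sets of pairs. Hence the class {I} and the class [I] are the same set, and their identification is
  an equality.\<close>

lemma ideal_class_rel_eq_weak_rel: "ideal_class_rel E B = weak_rel E B"
  unfolding ideal_class_rel_def weak_rel_def
  using weakly_equivalent_imp_principal principal_imp_weakly_equivalent(1) by auto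

text \<open>Once the relations agree, what is left to see is that the multiplicator ring of every
  fractional ideal occurs in the index set.\<close>

lemma ICM_eq_Union_weak_classes:
  "ICM E B = (\<Union>S\<in>{S. is_order E A F S \<and> B \<subseteq> S}. weak_classes E B S)"
proof -
  have "colon E I I \<in> {S. is_order E A F S \<and> B \<subseteq> S}" if "fractional_ideal E B I" for I
    using colon_self_is_order[OF that] B_subset_colon_self[OF fractional_ideal_submod[OF that]] by simp
  then show ?thesis
    unfolding ICM_def weak_classes_def quotient_def ideal_class_rel_eq_weak_rel by auto
qed

text \<open>A class common to two members comes from ideals \<open>I\<close> and
  \<open>J = x I\<close>, and multiplication by a unit does not change the multiplicator
  ring.\<close>

lemma disjoint_weak_classes: "disjoint_family_on (weak_classes E B) \<S>"
  unfolding disjoint_family_on_def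
proof (intro ballI impI)
  fix S T :: "'e set" assume "S \<noteq> T"
  show "weak_classes E B S \<inter> weak_classes E B T = {}"
  proof (rule ccontr)
    assume "weak_classes E B S \<inter> weak_classes E B T \<noteq> {}"
    then obtain I J where I: "fractional_ideal E B I" "colon E I I = S"
      and J: "fractional_ideal E B J" "colon E J J = T"
      and eq: "weak_rel E B `` {I} = weak_rel E B `` {J}"
      by (auto simp: weak_classes_def)
    \<comment> \<open>Reflexivity puts \<open>J\<close> into its own class, hence into that of
      \<open>I\<close>.\<close>
    have "(J, J) \<in> ideal_class_rel E B"
    proof -
      have "J = \<one> <# J"
        using submodD(1)[OF fractional_ideal_submod[OF J(1)]] by (force simp: l_coset_def)
      then show ?thesis unfolding ideal_class_rel_def using J(1) by auto
    qed
    then have "(I, J) \<in> ideal_class_rel E B"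
      using eq unfolding ideal_class_rel_eq_weak_rel by auto
    then obtain x where "x \<in> Units E" "J = x <# I" by (auto simp: ideal_class_rel_def)
    then have "S = T" using principal_imp_weakly_equivalent(2)[OF I(1)] I(2) J(2) by simp
    then show False using \<open>S \<noteq> T\<close> by simp
  qed
qed

end

section \<open>Completions along a filtration\<close>

text \<open>The axioms cover both the powers of the prime in A and their localised versions in F,
  which are not ideals of F. There \<open>G 0\<close> is the localisation, each \<open>G n\<close>
  is stable under it, and \<open>mult_continuous\<close> takes care of factors with a pole, at the
  cost of a larger index.\<close>

locale ring_filtration =
  fixes G :: "nat \<Rightarrow> 'a::comm_ring_1 set"
  assumes zero_mem: "0 \<in> G n"
    and add_mem: "x \<in> G n \<Longrightarrow> y \<in> G n \<Longrightarrow> x + y \<in> G n"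
    and neg_mem: "x \<in> G n \<Longrightarrow> - x \<in> G n"
    and Suc_subset: "G (Suc n) \<subseteq> G n"
    and mult_mem: "x \<in> G 0 \<Longrightarrow> y \<in> G n \<Longrightarrow> x * y \<in> G n"
    and mult_continuous: "\<exists>m. \<forall>y\<in>G m. x * y \<in> G n"
begin

lemma minus_mem: "x \<in> G n \<Longrightarrow> y \<in> G n \<Longrightarrow> x - y \<in> G n"
  using add_mem[OF _ neg_mem] by force

lemma antimono: "m \<le> n \<Longrightarrow> G n \<subseteq> G m"
  by (induction rule: dec_induct) (use Suc_subset in auto)

lemma minus_commute_mem: "x - y \<in> G n \<longleftrightarrow> y - x \<in> G n"
  using neg_mem[of "x - y" n] neg_mem[of "y - x" n] by auto

lemma cauchyD: "s \<in> cauchy_seqs G \<Longrightarrow> \<exists>N. \<forall>i\<ge>N. \<forall>j\<ge>N. s i - s j \<in> G n"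
  and nullD: "s \<in> null_seqs G \<Longrightarrow> \<exists>N. \<forall>i\<ge>N. s i \<in> G n"
  by (auto simp: cauchy_seqs_def null_seqs_def)

lemma cauchyI: "(\<And>n. \<exists>N. \<forall>i\<ge>N. \<forall>j\<ge>N. s i - s j \<in> G n) \<Longrightarrow> s \<in> cauchy_seqs G"
  and nullI: "(\<And>n. \<exists>N. \<forall>i\<ge>N. s i \<in> G n) \<Longrightarrow> s \<in> null_seqs G"
  by (auto simp: cauchy_seqs_def null_seqs_def)

lemma cauchy_const: "(\<lambda>_. a) \<in> cauchy_seqs G"
  by (rule cauchyI) (simp add: zero_mem)

lemma cauchy_add:
  assumes "s \<in> cauchy_seqs G" "t \<in> cauchy_seqs G"
  shows "(\<lambda>i. s i + t i) \<in> cauchy_seqs G"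
proof (rule cauchyI)
  fix n
  obtain M N where M: "\<forall>i\<ge>M. \<forall>j\<ge>M. s i - s j \<in> G n" and N: "\<forall>i\<ge>N. \<forall>j\<ge>N. t i - t j \<in> G n"
    using cauchyD assms by metis
  have "s i + t i - (s j + t j) \<in> G n" if "i \<ge> max M N" "j \<ge> max M N" for i j
    using add_mem[of "s i - s j" n "t i - t j"] M N that by (simp add: algebra_simps)
  then show "\<exists>N. \<forall>i\<ge>N. \<forall>j\<ge>N. s i + t i - (s j + t j) \<in> G n" by blast
qed

lemma cauchy_uminus:
  assumes "s \<in> cauchy_seqs G"
  shows "(\<lambda>i. - s i) \<in> cauchy_seqs G"
proof (rule cauchyI)
  fix n
  obtain M where M: "\<forall>i\<ge>M. \<forall>j\<ge>M. s i - s j \<in> G n" using cauchyD assms by metis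
  then show "\<exists>N. \<forall>i\<ge>N. \<forall>j\<ge>N. - s i - - s j \<in> G n"
    using minus_commute_mem by (intro exI[of _ M]) (simp add: minus_commute_mem)
qed

text \<open>A tail of the sequence stays in \<open>s N + G 0\<close>, so one index serves all its
  terms: continuity at the fixed element \<open>s N\<close> and stability under \<open>G 0\<close>
  are combined in \<open>s i y = s N y + (s i - s N) y\<close>.\<close>

lemma cauchy_mult_bound:
  assumes "s \<in> cauchy_seqs G"
  shows "\<exists>m N. \<forall>i\<ge>N. \<forall>y\<in>G m. s i * y \<in> G n"
proof -
  obtain N where N: "\<forall>i\<ge>N. \<forall>j\<ge>N. s i - s j \<in> G 0" using cauchyD assms by metis
  obtain m where m: "\<forall>y\<in>G m. s N * y \<in> G n" using mult_continuous by metis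
  have "s i * y \<in> G n" if i: "i \<ge> N" and y: "y \<in> G (max m n)" for i y
  proof -
    have y': "y \<in> G m" "y \<in> G n" using y antimono by (metis max.cobounded1 max.cobounded2 subsetD)+
    have "s N * y \<in> G n" using m y' by blast
    moreover have "(s i - s N) * y \<in> G n" using N i y' by (intro mult_mem) auto
    ultimately have "s N * y + (s i - s N) * y \<in> G n" by (rule add_mem)
    then show ?thesis by (simp add: algebra_simps)
  qed
  then show ?thesis by blast
qed

lemma cauchy_mult:
  assumes "s \<in> cauchy_seqs G" "t \<in> cauchy_seqs G"
  shows "(\<lambda>i. s i * t i) \<in> cauchy_seqs G"
proof (rule cauchyI)
  fix n
  obtain m1 N1 where 1: "\<forall>i\<ge>N1. \<forall>y\<in>G m1. s i * y \<in> G n" using cauchy_mult_bound[OF assms(1)] by metis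
  obtain m2 N2 where 2: "\<forall>i\<ge>N2. \<forall>y\<in>G m2. t i * y \<in> G n" using cauchy_mult_bound[OF assms(2)] by metis
  obtain M1 where M1: "\<forall>i\<ge>M1. \<forall>j\<ge>M1. s i - s j \<in> G m2" using cauchyD assms by metis
  obtain M2 where M2: "\<forall>i\<ge>M2. \<forall>j\<ge>M2. t i - t j \<in> G m1" using cauchyD assms by metis
  define N where "N = max (max N1 N2) (max M1 M2)"
  have "s i * t i - s j * t j \<in> G n" if "i \<ge> N" "j \<ge> N" for i j
  proof -
    have "s i * (t i - t j) + t j * (s i - s j) \<in> G n"
      using 1 2 M1 M2 that by (intro add_mem) (auto simp: N_def)
    then show ?thesis by (simp add: algebra_simps)
  qed
  then show "\<exists>N. \<forall>i\<ge>N. \<forall>j\<ge>N. s i * t i - s j * t j \<in> G n" by blast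
qed

lemma null_imp_cauchy:
  assumes "s \<in> null_seqs G"
  shows "s \<in> cauchy_seqs G"
proof (rule cauchyI)
  fix n
  obtain N where "\<forall>i\<ge>N. s i \<in> G n" using nullD assms by metis
  then show "\<exists>N. \<forall>i\<ge>N. \<forall>j\<ge>N. s i - s j \<in> G n" using minus_mem by blast
qed

lemma null_zero: "(\<lambda>_. 0) \<in> null_seqs G"
  by (rule nullI) (simp add: zero_mem)

lemma null_add:
  assumes "s \<in> null_seqs G" "t \<in> null_seqs G"
  shows "(\<lambda>i. s i + t i) \<in> null_seqs G"
proof (rule nullI)
  fix n
  obtain M N where "\<forall>i\<ge>M. s i \<in> G n" "\<forall>i\<ge>N. t i \<in> G n" using nullD assms by metis
  then show "\<exists>N. \<forall>i\<ge>N. s i + t i \<in> G n" using add_mem by (intro exI[of _ "max M N"]) auto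
qed

lemma null_uminus:
  assumes "s \<in> null_seqs G"
  shows "(\<lambda>i. - s i) \<in> null_seqs G"
  using nullD[OF assms] neg_mem by (meson nullI)

lemma null_minus:
  assumes "s \<in> null_seqs G" "t \<in> null_seqs G"
  shows "(\<lambda>i. s i - t i) \<in> null_seqs G"
  using null_add[OF assms(1) null_uminus[OF assms(2)]] by simp

lemma null_mult:
  assumes "s \<in> cauchy_seqs G" "t \<in> null_seqs G"
  shows "(\<lambda>i. s i * t i) \<in> null_seqs G"
proof (rule nullI)
  fix n
  obtain m N where N: "\<forall>i\<ge>N. \<forall>y\<in>G m. s i * y \<in> G n" using cauchy_mult_bound[OF assms(1)] by metis
  obtain M where "\<forall>i\<ge>M. t i \<in> G m" using nullD assms by metis
  then show "\<exists>N. \<forall>i\<ge>N. s i * t i \<in> G n" using N by (intro exI[of _ "max M N"]) auto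
qed

lemma cauchy_ring_simps:
  "carrier (cauchy_ring G) = cauchy_seqs G"
  "s \<otimes>\<^bsub>cauchy_ring G\<^esub> t = (\<lambda>i. s i * t i)"
  "s \<oplus>\<^bsub>cauchy_ring G\<^esub> t = (\<lambda>i. s i + t i)"
  "\<one>\<^bsub>cauchy_ring G\<^esub> = (\<lambda>_. 1)"
  "\<zero>\<^bsub>cauchy_ring G\<^esub> = (\<lambda>_. 0)"
  by (simp_all add: cauchy_ring_def)

lemma cauchy_ring_is_cring: "cring (cauchy_ring G)"
proof (rule cringI)
  show "abelian_group (cauchy_ring G)"
  proof (rule abelian_groupI)
    fix x assume "x \<in> carrier (cauchy_ring G)"
    then show "\<exists>y\<in>carrier (cauchy_ring G). y \<oplus>\<^bsub>cauchy_ring G\<^esub> x = \<zero>\<^bsub>cauchy_ring G\<^esub>"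
      by (intro bexI[of _ "\<lambda>i. - x i"]) (auto simp: cauchy_ring_simps cauchy_uminus)
  qed (auto simp: cauchy_ring_simps cauchy_add cauchy_const algebra_simps)
  show "comm_monoid (cauchy_ring G)"
    by (rule comm_monoidI) (auto simp: cauchy_ring_simps cauchy_mult cauchy_const algebra_simps)
qed (auto simp: cauchy_ring_simps algebra_simps)

lemma null_seqs_ideal: "ideal (null_seqs G) (cauchy_ring G)"
proof -
  interpret cring "cauchy_ring G" by (rule cauchy_ring_is_cring)
  have inv: "\<ominus>\<^bsub>cauchy_ring G\<^esub> x = (\<lambda>i. - x i)" if "x \<in> cauchy_seqs G" for x
    using that by (intro minus_equality) (auto simp: cauchy_ring_simps cauchy_uminus)
  show ?thesis
  proof (rule idealI[OF ring_axioms])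
    show "subgroup (null_seqs G) (add_monoid (cauchy_ring G))"
    proof (rule add.subgroupI)
      fix x assume x: "x \<in> null_seqs G"
      show "\<ominus>\<^bsub>cauchy_ring G\<^esub> x \<in> null_seqs G"
        using null_uminus[OF x] inv[OF null_imp_cauchy[OF x]] by simp
    qed (use null_zero in \<open>auto simp: cauchy_ring_simps null_imp_cauchy null_add\<close>)
  next
    fix a x assume "a \<in> null_seqs G" "x \<in> carrier (cauchy_ring G)"
    then show "x \<otimes>\<^bsub>cauchy_ring G\<^esub> a \<in> null_seqs G" "a \<otimes>\<^bsub>cauchy_ring G\<^esub> x \<in> null_seqs G"
      using null_mult[of x a] by (auto simp: cauchy_ring_simps mult.commute)
  qed
qed

lemma completion_is_cring: "cring (completion G)"
  unfolding completion_def
  by (rule ideal.quotient_is_cring[OF null_seqs_ideal cauchy_ring_is_cring])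

section \<open>Computing in the completion with representatives\<close>

definition lim_class :: "(nat \<Rightarrow> 'a) \<Rightarrow> (nat \<Rightarrow> 'a) set" where
  "lim_class s = null_seqs G +>\<^bsub>cauchy_ring G\<^esub> s"

lemma lim_class_eq: "lim_class s = {t. (\<lambda>i. t i - s i) \<in> null_seqs G}"
proof -
  have "\<exists>h\<in>null_seqs G. t = (\<lambda>i. h i + s i)" if "(\<lambda>i. t i - s i) \<in> null_seqs G" for t
    using that by (intro bexI[OF _ that]) auto
  then show ?thesis
    unfolding lim_class_def a_r_coset_def' by (auto simp: cauchy_ring_simps)
qed

lemma lim_class_cong_null:
  assumes "(\<lambda>i. s i - t i) \<in> null_seqs G"
  shows "lim_class s = lim_class t"
proof -
  have "(\<lambda>i. u i - s i) \<in> null_seqs G \<longleftrightarrow> (\<lambda>i. u i - t i) \<in> null_seqs G" for u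
    using null_add[OF _ assms, of "\<lambda>i. u i - s i"] null_minus[OF _ assms, of "\<lambda>i. u i - t i"]
    by (auto simp: algebra_simps)
  then show ?thesis by (simp add: lim_class_eq)
qed

lemma lim_class_cong_eventually:
  assumes "\<And>i. i \<ge> N \<Longrightarrow> s i = t i"
  shows "lim_class s = lim_class t"
proof (rule lim_class_cong_null, rule nullI)
  fix n
  show "\<exists>N. \<forall>i\<ge>N. s i - t i \<in> G n"
    using assms zero_mem[of n] by (intro exI[of _ N]) simp
qed

lemma to_completion_eq: "to_completion G a = lim_class (\<lambda>_. a)"
  by (simp add: to_completion_def lim_class_def)

lemma carrier_completion: "carrier (completion G) = lim_class ` cauchy_seqs G"
  by (auto simp: completion_def FactRing_def A_RCOSETS_def' lim_class_def cauchy_ring_simps)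

lemma lim_class_hom: "lim_class \<in> ring_hom (cauchy_ring G) (completion G)"
  unfolding lim_class_def completion_def by (rule ideal.rcos_ring_hom[OF null_seqs_ideal])

lemma lim_class_mult: "s \<in> cauchy_seqs G \<Longrightarrow> t \<in> cauchy_seqs G \<Longrightarrow>
    lim_class s \<otimes>\<^bsub>completion G\<^esub> lim_class t = lim_class (\<lambda>i. s i * t i)"
  and lim_class_add: "s \<in> cauchy_seqs G \<Longrightarrow> t \<in> cauchy_seqs G \<Longrightarrow>
    lim_class s \<oplus>\<^bsub>completion G\<^esub> lim_class t = lim_class (\<lambda>i. s i + t i)"
  and lim_class_one: "\<one>\<^bsub>completion G\<^esub> = lim_class (\<lambda>_. 1)"
  and lim_class_carrier: "s \<in> cauchy_seqs G \<Longrightarrow> lim_class s \<in> carrier (completion G)"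
  using ring_hom_memE[OF lim_class_hom] by (auto simp: cauchy_ring_simps)

lemma lim_class_uminus:
  assumes "s \<in> cauchy_seqs G"
  shows "\<ominus>\<^bsub>completion G\<^esub> lim_class s = lim_class (\<lambda>i. - s i)"
proof -
  interpret cring "completion G" by (rule completion_is_cring)
  have "lim_class (\<lambda>i. - s i) \<oplus>\<^bsub>completion G\<^esub> lim_class s = lim_class (\<lambda>_. 0)"
    using assms by (simp add: lim_class_add cauchy_uminus)
  also have "\<dots> = \<zero>\<^bsub>completion G\<^esub>"
  proof -
    have "lim_class (\<lambda>_. 0) \<oplus>\<^bsub>completion G\<^esub> lim_class (\<lambda>_. 0) = lim_class (\<lambda>_. 0)"
      by (simp add: lim_class_add cauchy_const)
    then show ?thesis using lim_class_carrier[OF cauchy_const] by (metis add.r_cancel_one')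
  qed
  finally show ?thesis
    using assms by (intro minus_equality) (auto simp: lim_class_carrier cauchy_uminus)
qed

lemma to_completion_carrier: "to_completion G a \<in> carrier (completion G)"
  by (simp add: to_completion_eq lim_class_carrier cauchy_const)

lemma to_completion_mult: "to_completion G (a * b) = to_completion G a \<otimes>\<^bsub>completion G\<^esub> to_completion G b"
  and to_completion_one: "to_completion G 1 = \<one>\<^bsub>completion G\<^esub>"
  by (simp_all add: to_completion_eq lim_class_mult lim_class_add lim_class_one cauchy_const)

lemma to_completion_power:
  "to_completion G (a ^ n) = to_completion G a [^]\<^bsub>completion G\<^esub> n"
proof -
  interpret cring "completion G" by (rule completion_is_cring)
  show ?thesis
    by (induction n)
      (simp_all add: to_completion_one to_completion_mult m_comm to_completion_carrier)
qed

end

section \<open>Maps of completions induced by continuous homomorphisms\<close>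

locale filtration_hom = G: ring_filtration G + H: ring_filtration H
  for G :: "nat \<Rightarrow> 'a::comm_ring_1 set" and H :: "nat \<Rightarrow> 'b::comm_ring_1 set" +
  fixes h :: "'a \<Rightarrow> 'b"
  assumes h_add: "h (x + y) = h x + h y"
    and h_mult: "h (x * y) = h x * h y"
    and h_one: "h 1 = 1"
    and h_continuous: "\<exists>m. h ` G m \<subseteq> H n"
begin

lemma h_diff: "h (x - y) = h x - h y"
  using h_add[of "x - y" y] by simp

lemma h_null: "s \<in> null_seqs G \<Longrightarrow> (\<lambda>i. h (s i)) \<in> null_seqs H"
proof (rule H.nullI)
  fix n assume s: "s \<in> null_seqs G"
  obtain m where m: "h ` G m \<subseteq> H n" using h_continuous by metis
  obtain N where "\<forall>i\<ge>N. s i \<in> G m" using G.nullD[OF s] by metis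
  then show "\<exists>N. \<forall>i\<ge>N. h (s i) \<in> H n" using m by blast
qed

lemma h_cauchy: "s \<in> cauchy_seqs G \<Longrightarrow> (\<lambda>i. h (s i)) \<in> cauchy_seqs H"
proof (rule H.cauchyI)
  fix n assume s: "s \<in> cauchy_seqs G"
  obtain m where m: "h ` G m \<subseteq> H n" using h_continuous by metis
  obtain N where "\<forall>i\<ge>N. \<forall>j\<ge>N. s i - s j \<in> G m" using G.cauchyD[OF s] by metis
  then show "\<exists>N. \<forall>i\<ge>N. \<forall>j\<ge>N. h (s i) - h (s j) \<in> H n" using m unfolding h_diff[symmetric] by blast
qed

text \<open>Continuity sends null sequences to null sequences, so all representatives give the same
  coset and the set under \<open>the_elem\<close> is a singleton.\<close>

lemma completion_map_lim_class:
  "completion_map H h (G.lim_class s) = H.lim_class (\<lambda>i. h (s i))"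
proof -
  have "(\<lambda>t. H.lim_class (\<lambda>i. h (t i))) ` G.lim_class s = {H.lim_class (\<lambda>i. h (s i))}"
  proof -
    have "H.lim_class (\<lambda>i. h (t i)) = H.lim_class (\<lambda>i. h (s i))" if "t \<in> G.lim_class s" for t
      using h_null[of "\<lambda>i. t i - s i"] that
      by (intro H.lim_class_cong_null) (simp add: G.lim_class_eq h_diff)
    moreover have "s \<in> G.lim_class s" by (simp add: G.lim_class_eq G.null_zero)
    ultimately show ?thesis by blast
  qed
  then show ?thesis unfolding completion_map_def H.lim_class_def[symmetric] by simp
qed

lemma completion_map_hom: "completion_map H h \<in> ring_hom (completion G) (completion H)"
proof (rule ring_hom_memI)
  fix x assume "x \<in> carrier (completion G)"
  then obtain s where s: "s \<in> cauchy_seqs G" "x = G.lim_class s" by (auto simp: G.carrier_completion)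
  then show "completion_map H h x \<in> carrier (completion H)"
    by (simp add: completion_map_lim_class H.lim_class_carrier h_cauchy)
  fix y assume "y \<in> carrier (completion G)"
  then obtain t where t: "t \<in> cauchy_seqs G" "y = G.lim_class t" by (auto simp: G.carrier_completion)
  show "completion_map H h (x \<otimes>\<^bsub>completion G\<^esub> y) =
      completion_map H h x \<otimes>\<^bsub>completion H\<^esub> completion_map H h y"
    using s t
    by (simp add: completion_map_lim_class G.lim_class_mult H.lim_class_mult h_cauchy h_mult)
  show "completion_map H h (x \<oplus>\<^bsub>completion G\<^esub> y) =
      completion_map H h x \<oplus>\<^bsub>completion H\<^esub> completion_map H h y"
    using s t
    by (simp add: completion_map_lim_class G.lim_class_add H.lim_class_add h_cauchy h_add)
qed (simp add: completion_map_lim_class G.lim_class_one H.lim_class_one h_one)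

lemma completion_map_to_completion: "completion_map H h (to_completion G a) = to_completion H (h a)"
  by (simp add: G.to_completion_eq H.to_completion_eq completion_map_lim_class)

end

section \<open>Nonzero primes of the polynomial ring\<close>

text \<open>Division with remainder by a nonzero element of least degree. The plain closure
  conditions let it apply both to ideals of the record ring and to an explicit set of linear
  combinations.\<close>

lemma poly_ideal_principal:
  fixes I :: "'a::field poly set"
  assumes "I \<noteq> {0}" "0 \<in> I" and diff: "\<And>a b. a \<in> I \<Longrightarrow> b \<in> I \<Longrightarrow> a - b \<in> I"
    and mult: "\<And>a b. a \<in> I \<Longrightarrow> a * b \<in> I"
  shows "\<exists>d. d \<noteq> 0 \<and> I = {a. d dvd a}"
proof -
  obtain d where d: "d \<in> I" "d \<noteq> 0" "\<And>b. b \<in> I \<Longrightarrow> b \<noteq> 0 \<Longrightarrow> degree d \<le> degree b"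
    using assms(1,2) ex_has_least_nat[of "\<lambda>b. b \<in> I \<and> b \<noteq> 0" _ degree] by blast
  have "d dvd a" if "a \<in> I" for a
  proof -
    have "a - d * (a div d) \<in> I" using diff mult d(1) that by blast
    then have "a mod d \<in> I" by (simp add: minus_mult_div_eq_mod)
    then have "a mod d = 0" using d(3)[of "a mod d"] degree_mod_less[OF d(2), of a] by force
    then show ?thesis by auto
  qed
  then have "I = {a. d dvd a}" using mult[OF d(1)] by auto
  then show ?thesis using d(2) by blast
qed

lemma type_ring_simps [simp]:
  "carrier (ring_of_type_algebra :: 'a::comm_ring_1 ring) = UNIV"
  "(a :: 'a::comm_ring_1) \<otimes>\<^bsub>ring_of_type_algebra\<^esub> b = a * b"
  "a \<oplus>\<^bsub>ring_of_type_algebra\<^esub> b = a + b"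
  "\<one>\<^bsub>ring_of_type_algebra\<^esub> = (1::'a)"
  "\<zero>\<^bsub>ring_of_type_algebra\<^esub> = (0::'a)"
  by (simp_all add: ring_of_type_algebra_def)

lemma type_ring_uminus [simp]: "\<ominus>\<^bsub>ring_of_type_algebra\<^esub> a = - (a::'a::comm_ring_1)"
proof -
  interpret cring "ring_of_type_algebra :: 'a ring" by (rule cring_from_type_algebra)
  show ?thesis by (rule minus_equality) auto
qed

lemma type_ring_idealD:
  fixes I :: "'a::comm_ring_1 set"
  assumes "ideal I ring_of_type_algebra"
  shows "0 \<in> I" "\<And>a b. a \<in> I \<Longrightarrow> b \<in> I \<Longrightarrow> a - b \<in> I" "\<And>a b. a \<in> I \<Longrightarrow> a * b \<in> I"
proof -
  interpret ideal I "ring_of_type_algebra :: 'a ring" by fact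
  show "0 \<in> I" using additive_subgroup.zero_closed[OF is_additive_subgroup] by simp
  show "a * b \<in> I" if "a \<in> I" for a b using I_r_closed[OF that, of b] by simp
  show "a - b \<in> I" if "a \<in> I" "b \<in> I" for a b
    using additive_subgroup.a_closed[OF is_additive_subgroup that(1) additive_subgroup.a_inv_closed[OF is_additive_subgroup that(2)]] by simp
qed

lemma prime_ideal_generator:
  fixes p :: "'a::field poly set"
  assumes "primeideal p ring_of_type_algebra" "p \<noteq> {0}"
  shows "\<exists>\<pi>. prime_elem \<pi> \<and> p = {a. \<pi> dvd a}"
proof -
  interpret primeideal p "ring_of_type_algebra :: 'a poly ring" by fact
  obtain \<pi> where \<pi>: "\<pi> \<noteq> 0" "p = {a. \<pi> dvd a}"
    using poly_ideal_principal[OF assms(2)] type_ring_idealD[OF is_ideal] by blast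
  have "\<not> \<pi> dvd 1"
  proof
    assume "\<pi> dvd 1"
    then have "p = UNIV" using \<pi>(2) unit_imp_dvd by blast
    then show False using I_notcarr by simp
  qed
  moreover have "\<pi> dvd a \<or> \<pi> dvd b" if "\<pi> dvd a * b" for a b
    using I_prime[of a b] that \<pi>(2) by simp
  ultimately show ?thesis using \<pi> by (auto simp: prime_elem_def)
qed

locale poly_prime =
  fixes \<pi> :: "'q::field poly" and p :: "'q poly set"
  assumes prime: "prime_elem \<pi>" and p_eq: "p = {a. \<pi> dvd a}"
begin

lemma \<pi>_nonzero: "\<pi> \<noteq> 0"
  using prime by (simp add: prime_elem_def)

lemma power_dvd_cancel:
  assumes "\<not> \<pi> dvd d" "\<pi> ^ n dvd a * d"
  shows "\<pi> ^ n dvd a"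
  using assms(2)
proof (induction n)
  case (Suc n)
  then have "\<pi> ^ n dvd a" by (metis dvd_mult_right power_Suc)
  then obtain c where c: "a = \<pi> ^ n * c" by auto
  have "\<pi> ^ n * \<pi> dvd \<pi> ^ n * (c * d)" using Suc.prems c by (simp add: ac_simps)
  then have "\<pi> dvd c * d" using \<pi>_nonzero by simp
  then have "\<pi> dvd c" using prime assms(1) by (simp add: prime_elem_dvd_mult_iff)
  then show ?case using c by (simp add: mult.commute)
qed auto

text \<open>The exponent is the \<pi>-adic valuation. Dividing by the nonconstant polynomial \<pi>
  lowers the degree, so the process ends.\<close>

lemma split_power:
  assumes "b \<noteq> 0"
  shows "\<exists>k c. b = \<pi> ^ k * c \<and> \<not> \<pi> dvd c"
  using assms
proof (induction "degree b" arbitrary: b rule: less_induct)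
  case less
  show ?case
  proof (cases "\<pi> dvd b")
    case False
    then show ?thesis by (intro exI[of _ 0] exI[of _ b]) simp
  next
    case True
    then obtain c where c: "b = \<pi> * c" by auto
    have "degree \<pi> \<noteq> 0"
      using prime \<pi>_nonzero by (auto simp: prime_elem_def is_unit_iff_degree)
    moreover have "c \<noteq> 0" using less.prems c by auto
    ultimately have "degree c < degree b" using c \<pi>_nonzero by (simp add: degree_mult_eq)
    then obtain k d where "c = \<pi> ^ k * d" "\<not> \<pi> dvd d" using less.hyps \<open>c \<noteq> 0\<close> by blast
    then show ?thesis using c by (intro exI[of _ "Suc k"] exI[of _ d]) simp
  qed
qed

text \<open>The ideal generated by \<open>b\<close> and \<pi> has a generator \<open>d\<close>. It
  divides \<pi> but is not divisible by \<pi>, since it also divides \<open>b\<close>; hence it is a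
  unit and yields a Bezout relation.\<close>

lemma inverse_mod:
  assumes "\<not> \<pi> dvd b"
  shows "\<exists>c. \<pi> dvd b * c - 1"
proof -
  define I where "I = {x * b + y * \<pi> | x y. True}"
  have \<pi>I: "\<pi> \<in> I" unfolding I_def by (intro CollectI exI[of _ 0] exI[of _ 1]) simp
  have bI: "b \<in> I" unfolding I_def by (intro CollectI exI[of _ 1] exI[of _ 0]) simp
  obtain d where d: "I = {a. d dvd a}"
  proof -
    have "\<exists>d. d \<noteq> 0 \<and> I = {a. d dvd a}"
    proof (rule poly_ideal_principal)
      show "I \<noteq> {0}" using \<pi>I \<pi>_nonzero by auto
      show "0 \<in> I" unfolding I_def by (intro CollectI exI[of _ 0]) simp
    next
      fix a c assume "a \<in> I" "c \<in> I"
      then obtain x y x' y' where "a = x * b + y * \<pi>" "c = x' * b + y' * \<pi>" unfolding I_def by blast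
      then show "a - c \<in> I" unfolding I_def
        by (intro CollectI exI[of _ "x - x'"] exI[of _ "y - y'"]) (simp add: algebra_simps)
    next
      fix a c assume "a \<in> I"
      then obtain x y where "a = x * b + y * \<pi>" unfolding I_def by blast
      then show "a * c \<in> I" unfolding I_def
        by (intro CollectI exI[of _ "x * c"] exI[of _ "y * c"]) (simp add: algebra_simps)
    qed
    then show thesis using that by blast
  qed
  obtain e where e: "\<pi> = d * e" using d \<pi>I by auto
  have "\<not> \<pi> dvd d" using assms d bI dvd_trans by blast
  then have "\<pi> dvd e" using prime e by (metis dvd_refl prime_elem_dvd_mult_iff)
  then obtain e' where "e = \<pi> * e'" by auto
  then have "\<pi> * 1 = \<pi> * (d * e')" using e by (simp add: ac_simps)
  then have "d * e' = 1" using \<pi>_nonzero mult_left_cancel by metis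
  then have "1 \<in> I" using d by (metis dvdI mem_Collect_eq)
  then obtain x y where "1 = x * b + y * \<pi>" unfolding I_def by blast
  then have "b * x - 1 = \<pi> * (- y)" by (simp add: algebra_simps)
  then show ?thesis by (metis dvdI)
qed

text \<open>The product of \<open>b e - 1\<close>, divisible by \<pi>, and \<open>b c - 1\<close>,
  divisible by \<open>\<pi> ^ n\<close>, gains one power. Its negative is again of the form
  \<open>b c' - 1\<close>, with \<open>c' = c + e - b c e\<close>.\<close>

lemma inverse_mod_power:
  assumes "\<not> \<pi> dvd b"
  shows "\<exists>c. \<pi> ^ n dvd b * c - 1"
proof (induction n)
  case (Suc n)
  then obtain c where "\<pi> ^ n dvd b * c - 1" by auto
  moreover obtain e where "\<pi> dvd b * e - 1" using inverse_mod[OF assms] by auto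
  ultimately have "\<pi> * \<pi> ^ n dvd (b * e - 1) * (b * c - 1)" by (rule mult_dvd_mono[rotated])
  then have "\<pi> ^ Suc n dvd - ((b * e - 1) * (b * c - 1))" by simp
  also have "- ((b * e - 1) * (b * c - 1)) = b * (c + e - b * c * e) - 1"
    by (simp add: algebra_simps)
  finally show ?case by blast
qed auto

lemma adic_eq: "adic p n = {a. \<pi> ^ n dvd a}"
proof (induction n)
  case 0
  show ?case by (simp add: adic_def nat_pow_def ideals_set_def)
next
  case (Suc n)
  have "adic p (Suc n) = adic p n \<cdot>\<^bsub>ring_of_type_algebra\<^esub> p"
    by (simp add: adic_def nat_pow_def ideals_set_def)
  also have "\<dots> = {a. \<pi> ^ Suc n dvd a}"
  proof (intro equalityI subsetI)
    fix a assume "a \<in> adic p n \<cdot>\<^bsub>ring_of_type_algebra\<^esub> p"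
    then show "a \<in> {a. \<pi> ^ Suc n dvd a}"
      unfolding Suc by (induction rule: ideal_prod.induct)
        (auto simp: p_eq mult_dvd_mono power_Suc2 simp del: power_Suc)
  next
    fix a assume "a \<in> {a. \<pi> ^ Suc n dvd a}"
    then have "\<pi> ^ Suc n dvd a" by simp
    then obtain c where "a = \<pi> ^ Suc n * c" by (rule dvdE)
    then have "a = \<pi> ^ n * (\<pi> * c)" by (simp add: ac_simps)
    moreover have "\<pi> ^ n \<otimes>\<^bsub>ring_of_type_algebra\<^esub> (\<pi> * c) \<in> adic p n \<cdot>\<^bsub>ring_of_type_algebra\<^esub> p"
      by (rule ideal_prod.prod) (simp add: Suc, simp add: p_eq)
    ultimately show "a \<in> adic p n \<cdot>\<^bsub>ring_of_type_algebra\<^esub> p" by simp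
  qed
  finally show ?case .
qed

lemma fract_adic_eq: "fract_adic p n = {Fract a b | a b. \<pi> ^ n dvd a \<and> \<not> \<pi> dvd b}"
  by (simp add: fract_adic_def adic_eq) (simp add: p_eq)

lemma fract_adicI: "\<pi> ^ n dvd a \<Longrightarrow> \<not> \<pi> dvd b \<Longrightarrow> Fract a b \<in> fract_adic p n"
  unfolding fract_adic_eq by blast

lemma not_dvd_imp_nonzero: "\<not> \<pi> dvd b \<Longrightarrow> b \<noteq> 0"
  by auto

lemma not_dvd_one: "\<not> \<pi> dvd 1"
  using prime by (simp add: prime_elem_def)

lemma not_dvd_mult: "\<not> \<pi> dvd a \<Longrightarrow> \<not> \<pi> dvd b \<Longrightarrow> \<not> \<pi> dvd a * b"
  using prime by (simp add: prime_elem_dvd_mult_iff)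

text \<open>The topology of A is the one induced from F, so that a sequence of polynomials that is
  Cauchy in F is already Cauchy in A.\<close>

lemma Fract_mem_fract_adic_iff: "Fract a 1 \<in> fract_adic p n \<longleftrightarrow> \<pi> ^ n dvd a"
proof
  assume "Fract a 1 \<in> fract_adic p n"
  then obtain c d where cd: "Fract a 1 = Fract c d" "\<pi> ^ n dvd c" "\<not> \<pi> dvd d"
    unfolding fract_adic_eq by blast
  then have "a * d = c" using not_dvd_imp_nonzero[OF cd(3)] by (simp add: eq_fract)
  then have "\<pi> ^ n dvd a * d" using cd(2) by metis
  then show "\<pi> ^ n dvd a" by (rule power_dvd_cancel[OF cd(3)])
qed (rule fract_adicI[OF _ not_dvd_one])

section \<open>The filtrations of A and F at the prime\<close>

sublocale A: ring_filtration "adic p"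
proof
  show "\<exists>m. \<forall>y\<in>adic p m. x * y \<in> adic p n" for x n
    by (intro exI[of _ n]) (auto simp: adic_eq)
qed (auto simp: adic_eq dvd_mult_right)

sublocale F: ring_filtration "fract_adic p"
proof
  fix n
  show "0 \<in> fract_adic p n"
    using fract_adicI[of n 0 1] not_dvd_one by (simp add: Zero_fract_def)
  show "fract_adic p (Suc n) \<subseteq> fract_adic p n"
    unfolding fract_adic_eq power_Suc using dvd_mult_right by blast
  fix x
  show "- x \<in> fract_adic p n" if "x \<in> fract_adic p n"
    using that unfolding fract_adic_eq by force
  fix y
  show "x + y \<in> fract_adic p n" if xy: "x \<in> fract_adic p n" "y \<in> fract_adic p n"
  proof -
    obtain a b c d where "x = Fract a b" "y = Fract c d" "\<pi> ^ n dvd a" "\<pi> ^ n dvd c"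
      "\<not> \<pi> dvd b" "\<not> \<pi> dvd d" using xy unfolding fract_adic_eq by blast
    then show ?thesis
      using fract_adicI[of n "a * d + c * b" "b * d"] by (simp add: not_dvd_mult not_dvd_imp_nonzero)
  qed
  show "x * y \<in> fract_adic p n" if xy: "x \<in> fract_adic p 0" "y \<in> fract_adic p n"
  proof -
    obtain a b c d where "x = Fract a b" "y = Fract c d" "\<pi> ^ n dvd c"
      "\<not> \<pi> dvd b" "\<not> \<pi> dvd d" using xy unfolding fract_adic_eq by blast
    then show ?thesis
      using fract_adicI[of n "a * c" "b * d"] by (simp add: not_dvd_mult)
  qed
next
  fix x :: "'q poly fract" and n
  obtain a b where x: "x = Fract a b" "b \<noteq> 0" by (cases x) auto
  \<comment> \<open>Multiplication by \<open>x\<close> loses at most the \<pi>-part of its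
    denominator, so the index \<open>n + k\<close> works.\<close>
  obtain k b' where b: "b = \<pi> ^ k * b'" "\<not> \<pi> dvd b'" using split_power[OF x(2)] by blast
  have "x * y \<in> fract_adic p n" if "y \<in> fract_adic p (n + k)" for y
  proof -
    obtain c d where y: "y = Fract (\<pi> ^ (n + k) * c) d" "\<not> \<pi> dvd d"
      using \<open>y \<in> _\<close> unfolding fract_adic_eq by blast
    have "x * y = Fract (\<pi> ^ k * (\<pi> ^ n * (a * c))) (\<pi> ^ k * (b' * d))"
      by (simp add: x y b power_add ac_simps)
    also have "\<dots> = Fract (\<pi> ^ n * (a * c)) (b' * d)"
      using \<pi>_nonzero by (simp add: mult_fract_cancel)
    also have "\<dots> \<in> fract_adic p n" using not_dvd_mult[OF b(2) y(2)] by (intro fract_adicI) auto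
    finally show ?thesis .
  qed
  then show "\<exists>m. \<forall>y\<in>fract_adic p m. x * y \<in> fract_adic p n" by blast
qed

sublocale A_F: filtration_hom "adic p" "fract_adic p" "\<lambda>a. Fract a 1"
proof
  show "\<exists>m. (\<lambda>a. Fract a 1) ` adic p m \<subseteq> fract_adic p n" for n
    by (intro exI[of _ n]) (auto simp: adic_eq Fract_mem_fract_adic_iff)
qed (auto simp: One_fract_def)

text \<open>Every term \<open>1 - \<pi> s i\<close> is prime to \<pi>, hence has an inverse modulo
  any power of \<pi>. Choosing the precision equal to the index makes the products converge to
  1.\<close>

lemma A_at_one_minus_invertible:
  assumes "a \<in> carrier (A_at p)"
  shows "\<exists>b\<in>carrier (A_at p).
    (\<one>\<^bsub>A_at p\<^esub> \<ominus>\<^bsub>A_at p\<^esub> to_completion (adic p) \<pi> \<otimes>\<^bsub>A_at p\<^esub> a) \<otimes>\<^bsub>A_at p\<^esub> b = \<one>\<^bsub>A_at p\<^esub>"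
proof -
  interpret C: cring "completion (adic p)" by (rule A.completion_is_cring)
  obtain s where s: "s \<in> cauchy_seqs (adic p)" "a = A.lim_class s"
    using assms by (auto simp: A_at_def A.carrier_completion)
  define x where "x = (\<lambda>i. 1 + - (\<pi> * s i))"
  have x: "x \<in> cauchy_seqs (adic p)"
    unfolding x_def by (intro A.cauchy_add A.cauchy_uminus A.cauchy_mult A.cauchy_const s)
  have lim_x: "\<one>\<^bsub>A_at p\<^esub> \<ominus>\<^bsub>A_at p\<^esub> to_completion (adic p) \<pi> \<otimes>\<^bsub>A_at p\<^esub> a = A.lim_class x"
    unfolding A_at_def C.minus_eq A.to_completion_eq s(2) A.lim_class_mult[OF A.cauchy_const s(1)]
      A.lim_class_uminus[OF A.cauchy_mult[OF A.cauchy_const s(1)]] A.lim_class_one x_def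
    by (rule A.lim_class_add[OF A.cauchy_const A.cauchy_uminus[OF A.cauchy_mult[OF A.cauchy_const s(1)]]])
  have x_prime: "\<not> \<pi> dvd x i" for i
  proof
    assume "\<pi> dvd x i"
    then have "\<pi> dvd x i + \<pi> * s i" by simp
    then show False using not_dvd_one by (simp add: x_def)
  qed
  have "\<forall>i. \<exists>c. \<pi> ^ i dvd x i * c - 1" using inverse_mod_power[OF x_prime] by blast
  then obtain v where v: "\<And>i. \<pi> ^ i dvd x i * v i - 1" by metis
  have vn: "\<pi> ^ n dvd x i * v i - 1" if "n \<le> i" for n i
    using v[of i] le_imp_power_dvd[OF that] dvd_trans by blast
  \<comment> \<open>Inverses modulo higher and higher powers of \<open>\<pi>\<close> form a Cauchy sequence.\<close>
  have v_cauchy: "v \<in> cauchy_seqs (adic p)"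
  proof (rule A.cauchyI)
    fix n
    obtain N where N: "\<forall>i\<ge>N. \<forall>j\<ge>N. x i - x j \<in> adic p n" using A.cauchyD[OF x] by metis
    have "v i - v j \<in> adic p n" if "i \<ge> max N n" "j \<ge> max N n" for i j
    proof -
      \<comment> \<open>All three terms are divisible by \<open>\<pi> ^ n\<close>, and together they
        equal \<open>(v i - v j) * x i\<close>, from which \<open>x i\<close> can be
        cancelled.\<close>
      have "\<pi> ^ n dvd (x i * v i - 1) - (x j * v j - 1) - (x i - x j) * v j"
        by (rule dvd_diff[OF dvd_diff dvd_mult2]) (use vn[of n i] vn[of n j] N that in \<open>auto simp: adic_eq\<close>)
      also have "(x i * v i - 1) - (x j * v j - 1) - (x i - x j) * v j = (v i - v j) * x i"
        by (simp add: algebra_simps)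
      finally have "\<pi> ^ n dvd (v i - v j) * x i" .
      then show ?thesis unfolding adic_eq mem_Collect_eq by (rule power_dvd_cancel[OF x_prime])
    qed
    then show "\<exists>N. \<forall>i\<ge>N. \<forall>j\<ge>N. v i - v j \<in> adic p n" by blast
  qed
  have "A.lim_class x \<otimes>\<^bsub>A_at p\<^esub> A.lim_class v = \<one>\<^bsub>A_at p\<^esub>"
  proof -
    have "(\<lambda>i. x i * v i - 1) \<in> null_seqs (adic p)"
      by (rule A.nullI) (use vn in \<open>auto simp: adic_eq\<close>)
    then show ?thesis
      unfolding A_at_def A.lim_class_mult[OF x v_cauchy] A.lim_class_one
      by (rule A.lim_class_cong_null)
  qed
  moreover have "A.lim_class v \<in> carrier (A_at p)"
    using A.lim_class_carrier[OF v_cauchy] by (simp add: A_at_def)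
  ultimately show ?thesis unfolding lim_x by blast
qed

text \<open>The terms of a Cauchy sequence eventually agree modulo \<pi>. Their common remainder is
  \<open>r\<close>, and the quotients by \<pi> form the representative of \<open>b\<close>.\<close>

lemma A_at_residue:
  assumes "a \<in> carrier (A_at p)"
  shows "\<exists>r b. degree r < degree \<pi> \<and> b \<in> carrier (A_at p) \<and>
    a = to_completion (adic p) r \<oplus>\<^bsub>A_at p\<^esub> to_completion (adic p) \<pi> \<otimes>\<^bsub>A_at p\<^esub> b"
proof -
  obtain s where s: "s \<in> cauchy_seqs (adic p)" "a = A.lim_class s"
    using assms by (auto simp: A_at_def A.carrier_completion)
  obtain N where N: "\<forall>i\<ge>N. \<forall>j\<ge>N. s i - s j \<in> adic p 1" using A.cauchyD[OF s(1)] by metis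
  define r where "r = s N mod \<pi>"
  have "degree \<pi> \<noteq> 0"
    using prime \<pi>_nonzero by (auto simp: prime_elem_def is_unit_iff_degree)
  then have deg: "degree r < degree \<pi>"
    using degree_mod_less[OF \<pi>_nonzero, of "s N"] by (auto simp: r_def)
  \<comment> \<open>Before \<open>N\<close> the division need not be exact; those terms do not
    affect the class.\<close>
  define t where "t = (\<lambda>i. (s i - r) div \<pi>)"
  have t: "\<pi> * t i = s i - r" if "i \<ge> N" for i
  proof -
    have "\<pi> dvd (s i - s N) + (s N - s N mod \<pi>)"
      using N that by (intro dvd_add) (auto simp: adic_eq)
    then show ?thesis by (simp add: t_def r_def)
  qed
  have t_cauchy: "t \<in> cauchy_seqs (adic p)"
  proof (rule A.cauchyI)
    fix n
    \<comment> \<open>Division by \<pi> costs one power, hence the precision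
      \<open>Suc n\<close>.\<close>
    obtain M where M: "\<forall>i\<ge>M. \<forall>j\<ge>M. s i - s j \<in> adic p (Suc n)" using A.cauchyD[OF s(1)] by metis
    have "t i - t j \<in> adic p n" if "i \<ge> max M N" "j \<ge> max M N" for i j
    proof -
      have "\<pi> * (t i - t j) = (s i - r) - (s j - r)"
        unfolding right_diff_distrib using t[of i] t[of j] that by simp
      also have "\<dots> = s i - s j" by simp
      finally have "\<pi> * (t i - t j) = s i - s j" .
      then have "\<pi> * \<pi> ^ n dvd \<pi> * (t i - t j)" using M that by (auto simp: adic_eq)
      then show ?thesis using \<pi>_nonzero by (simp add: adic_eq)
    qed
    then show "\<exists>N. \<forall>i\<ge>N. \<forall>j\<ge>N. t i - t j \<in> adic p n" by blast
  qed
  have "a = A.lim_class (\<lambda>i. r + \<pi> * t i)"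
    unfolding s(2) by (rule A.lim_class_cong_eventually[of N]) (use t in auto)
  also have "\<dots> = to_completion (adic p) r \<oplus>\<^bsub>A_at p\<^esub> to_completion (adic p) \<pi> \<otimes>\<^bsub>A_at p\<^esub> A.lim_class t"
    unfolding A_at_def A.to_completion_eq A.lim_class_mult[OF A.cauchy_const t_cauchy]
    by (rule A.lim_class_add[symmetric]) (intro A.cauchy_const A.cauchy_mult t_cauchy)+
  finally show ?thesis using deg A.lim_class_carrier[OF t_cauchy] unfolding A_at_def by blast
qed

text \<open>Polynomials are dense in the localisation: a denominator prime to \<pi> is replaced by
  its inverse modulo \<open>\<pi> ^ n\<close>.\<close>

lemma fract_adic_approx:
  assumes "x \<in> fract_adic p 0"
  shows "\<exists>a. x - Fract a 1 \<in> fract_adic p n"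
proof -
  obtain c d where x: "x = Fract c d" "\<not> \<pi> dvd d" using assms unfolding fract_adic_eq by blast
  obtain e where "\<pi> ^ n dvd d * e - 1" using inverse_mod_power[OF x(2)] by blast
  then have "\<pi> ^ n dvd (- c) * (d * e - 1)" by (rule dvd_mult)
  then have "Fract (c - c * e * d) d \<in> fract_adic p n"
    using x(2) by (intro fract_adicI) (auto simp: algebra_simps)
  moreover have "Fract c d - Fract (c * e) 1 = Fract (c - c * e * d) d"
    using not_dvd_imp_nonzero[OF x(2)] by simp
  ultimately show ?thesis using x(1) by metis
qed

text \<open>Past some \<open>N\<close> the terms differ from \<open>s N\<close> by \<pi>-integral
  fractions, so clearing the pole of the single term \<open>s N\<close> makes the whole tail
  integral. That tail can be replaced by polynomials without changing the class.\<close>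

lemma F_at_denominator:
  assumes "c \<in> carrier (F_at p)"
  shows "\<exists>n. \<exists>a\<in>carrier (A_at p).
    to_completion (fract_adic p) (Fract \<pi> 1) [^]\<^bsub>F_at p\<^esub> (n::nat) \<otimes>\<^bsub>F_at p\<^esub> c = A_at_to_F_at p a"
proof -
  obtain s where s: "s \<in> cauchy_seqs (fract_adic p)" "c = F.lim_class s"
    using assms by (auto simp: F_at_def F.carrier_completion)
  obtain N where N: "\<forall>i\<ge>N. \<forall>j\<ge>N. s i - s j \<in> fract_adic p 0" using F.cauchyD[OF s(1)] by metis
  obtain a b where sN: "s N = Fract a b" "b \<noteq> 0" by (cases "s N") auto
  obtain k b' where b: "b = \<pi> ^ k * b'" "\<not> \<pi> dvd b'" using split_power[OF sN(2)] by blast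
  define y where "y = (\<lambda>i. Fract (\<pi> ^ k) 1 * s i)"
  have y_cauchy: "y \<in> cauchy_seqs (fract_adic p)"
    unfolding y_def by (intro F.cauchy_mult F.cauchy_const s)
  have y_integral: "y i \<in> fract_adic p 0" if "i \<ge> N" for i
  proof -
    have "Fract (\<pi> ^ k) 1 * s N = Fract (\<pi> ^ k * a) (\<pi> ^ k * b')" by (simp add: sN b)
    also have "\<dots> = Fract a b'" using \<pi>_nonzero by (simp add: mult_fract_cancel)
    finally have "Fract (\<pi> ^ k) 1 * s N \<in> fract_adic p 0" using b(2) by (auto intro: fract_adicI)
    moreover have "Fract (\<pi> ^ k) 1 * (s i - s N) \<in> fract_adic p 0"
      using N that by (intro F.mult_mem fract_adicI not_dvd_one) auto
    ultimately have "Fract (\<pi> ^ k) 1 * s N + Fract (\<pi> ^ k) 1 * (s i - s N) \<in> fract_adic p 0"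
      by (rule F.add_mem)
    then show ?thesis by (simp add: y_def algebra_simps)
  qed
  \<comment> \<open>Precision \<open>i\<close> at place \<open>i\<close> makes the error a null
    sequence.\<close>
  have "\<forall>i. \<exists>x. i \<ge> N \<longrightarrow> y i - Fract x 1 \<in> fract_adic p i"
    using fract_adic_approx y_integral by blast
  then obtain x where x: "\<And>i. i \<ge> N \<Longrightarrow> y i - Fract (x i) 1 \<in> fract_adic p i" by metis
  have xn: "y i - Fract (x i) 1 \<in> fract_adic p n" if "i \<ge> max N n" for i n
    using x[of i] F.antimono[of n i] that by auto
  have cancel: "(a - b) - (a - c) + (b - d) = c - d" for a b c d :: "'q poly fract" by simp
  have x_cauchy: "x \<in> cauchy_seqs (adic p)"
  proof (rule A.cauchyI)
    fix n
    obtain M where M: "\<forall>i\<ge>M. \<forall>j\<ge>M. y i - y j \<in> fract_adic p n" using F.cauchyD[OF y_cauchy] by metis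
    have "x i - x j \<in> adic p n" if "i \<ge> max M (max N n)" "j \<ge> max M (max N n)" for i j
    proof -
      have "(y i - y j) - (y i - Fract (x i) 1) + (y j - Fract (x j) 1) \<in> fract_adic p n"
        by (rule F.add_mem[OF F.minus_mem]) (use M xn that in auto)
      moreover have "(y i - y j) - (y i - Fract (x i) 1) + (y j - Fract (x j) 1) = Fract (x i - x j) 1"
        unfolding A_F.h_diff by (rule cancel)
      ultimately show ?thesis by (simp add: Fract_mem_fract_adic_iff adic_eq)
    qed
    then show "\<exists>N. \<forall>i\<ge>N. \<forall>j\<ge>N. x i - x j \<in> adic p n" by blast
  qed
  have pow: "Fract \<pi> 1 ^ k = Fract (\<pi> ^ k) 1"
    by (induction k) (simp_all add: One_fract_def)
  have "to_completion (fract_adic p) (Fract \<pi> 1) [^]\<^bsub>F_at p\<^esub> k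
      = to_completion (fract_adic p) (Fract (\<pi> ^ k) 1)"
    by (simp add: F_at_def F.to_completion_power[symmetric] pow)
  then have "to_completion (fract_adic p) (Fract \<pi> 1) [^]\<^bsub>F_at p\<^esub> k \<otimes>\<^bsub>F_at p\<^esub> c = F.lim_class y"
    by (simp add: F_at_def F.to_completion_eq s(2) F.lim_class_mult[OF F.cauchy_const s(1)] y_def)
  also have "\<dots> = F.lim_class (\<lambda>i. Fract (x i) 1)"
    by (rule F.lim_class_cong_null, rule F.nullI) (use xn in blast)
  also have "\<dots> = A_at_to_F_at p (A.lim_class x)"
    by (simp add: A_at_to_F_at_def A_F.completion_map_lim_class)
  finally show ?thesis using A.lim_class_carrier[OF x_cauchy] unfolding A_at_def by blast
qed

end

lemma finite_polys_degree_less: "finite {r :: 'a::{zero,finite} poly. degree r < n}"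
proof -
  have "coeffs ` {r :: 'a poly. degree r < n} \<subseteq> {xs. set xs \<subseteq> UNIV \<and> length xs \<le> n}"
  proof clarsimp
    fix r :: "'a poly" assume "degree r < n"
    then show "length (coeffs r) \<le> n" by (cases "r = 0") (auto simp: length_coeffs)
  qed
  then have "finite (coeffs ` {r :: 'a poly. degree r < n})"
    by (rule finite_subset) (rule finite_lists_length_le[OF finite_UNIV])
  moreover have "inj_on coeffs {r :: 'a poly. degree r < n}" by (rule inj_onI) (metis coeffs_eq_iff)
  ultimately show ?thesis by (rule finite_imageD)
qed

section \<open>Tensor products of commutative algebras\<close>

lemma frag_extend_fun_add:
  "frag_extend (\<lambda>x. f x + g x) u = frag_extend f u + frag_extend g u"
  using subset_UNIV by (induction u rule: frag_induction) (simp_all add: frag_extend_diff)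

lemma frag_extend_fun_diff:
  "frag_extend (\<lambda>x. f x - g x) u = frag_extend f u - frag_extend g u"
  using subset_UNIV by (induction u rule: frag_induction) (simp_all add: frag_extend_diff)

text \<open>The multiplication of \<open>pair_ring\<close> under its own name, so that its
  biadditivity can serve as unconditional rewriting.\<close>

definition pair_mult ::
    "('b, 'm) ring_scheme \<Rightarrow> ('c, 'n) ring_scheme \<Rightarrow> ('b \<times> 'c \<Rightarrow>\<^sub>0 int) \<Rightarrow> ('b \<times> 'c \<Rightarrow>\<^sub>0 int) \<Rightarrow> ('b \<times> 'c \<Rightarrow>\<^sub>0 int)" where
  "pair_mult B C u v = frag_extend (\<lambda>(b, c).
     frag_extend (\<lambda>(b', c'). frag_of (b \<otimes>\<^bsub>B\<^esub> b', c \<otimes>\<^bsub>C\<^esub> c')) v) u"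

lemma pair_mult_simps:
  "pair_mult B C 0 v = 0" "pair_mult B C u 0 = 0"
  "pair_mult B C (u + u') v = pair_mult B C u v + pair_mult B C u' v"
  "pair_mult B C u (v + v') = pair_mult B C u v + pair_mult B C u v'"
  "pair_mult B C (u - u') v = pair_mult B C u v - pair_mult B C u' v"
  "pair_mult B C u (v - v') = pair_mult B C u v - pair_mult B C u v'"
  "pair_mult B C (frag_of (b, c)) (frag_of (b', c')) = frag_of (b \<otimes>\<^bsub>B\<^esub> b', c \<otimes>\<^bsub>C\<^esub> c')"
  unfolding pair_mult_def
  by (simp_all add: frag_extend_add frag_extend_diff frag_extend_fun_add[symmetric]
      frag_extend_fun_diff[symmetric] case_prod_unfold frag_extend_eq_0)

lemma pair_ring_simps:
  "carrier (pair_ring B C) = {u. Poly_Mapping.keys u \<subseteq> carrier B \<times> carrier C}"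
  "u \<otimes>\<^bsub>pair_ring B C\<^esub> v = pair_mult B C u v"
  "u \<oplus>\<^bsub>pair_ring B C\<^esub> v = u + v"
  "\<one>\<^bsub>pair_ring B C\<^esub> = frag_of (\<one>\<^bsub>B\<^esub>, \<one>\<^bsub>C\<^esub>)"
  "\<zero>\<^bsub>pair_ring B C\<^esub> = 0"
  by (simp_all add: pair_ring_def pair_mult_def)

lemma keys_diff_subset:
  "Poly_Mapping.keys u \<subseteq> S \<Longrightarrow> Poly_Mapping.keys v \<subseteq> S \<Longrightarrow> Poly_Mapping.keys (u - v) \<subseteq> S"
  for u v :: "'a \<Rightarrow>\<^sub>0 int"
  using keys_diff[of u v] by blast

lemma keys_add_subset:
  "Poly_Mapping.keys u \<subseteq> S \<Longrightarrow> Poly_Mapping.keys v \<subseteq> S \<Longrightarrow> Poly_Mapping.keys (u + v) \<subseteq> S"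
  for u v :: "'a \<Rightarrow>\<^sub>0 int"
  using Poly_Mapping.keys_add[of u v] by blast

locale tensor_product = B: cring B + C: cring C
  for B :: "('b, 'm) ring_scheme" and C :: "('c, 'n) ring_scheme" +
  fixes \<phi> :: "'a \<Rightarrow> 'b" and \<psi> :: "'a \<Rightarrow> 'c"
  assumes \<phi>_carr: "\<phi> a \<in> carrier B" and \<psi>_carr: "\<psi> a \<in> carrier C"
begin

abbreviation "P \<equiv> pair_ring B C"
abbreviation "J \<equiv> tensor_ideal \<phi> B \<psi> C"
abbreviation "T \<equiv> tensor \<phi> B \<psi> C"
abbreviation "tens \<equiv> tensor_elem \<phi> B \<psi> C"
abbreviation "pairs \<equiv> {u :: 'b \<times> 'c \<Rightarrow>\<^sub>0 int. Poly_Mapping.keys u \<subseteq> carrier B \<times> carrier C}"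

lemma frag_of_pairs: "b \<in> carrier B \<Longrightarrow> c \<in> carrier C \<Longrightarrow> frag_of (b, c) \<in> pairs"
  by simp

lemma pairs_diff: "u \<in> pairs \<Longrightarrow> v \<in> pairs \<Longrightarrow> u - v \<in> pairs"
  by (simp add: keys_diff_subset)

lemma pairs_add: "u \<in> pairs \<Longrightarrow> v \<in> pairs \<Longrightarrow> u + v \<in> pairs"
  by (simp add: keys_add_subset)

lemma pairs_induct [consumes 1, case_names zero one diff]:
  assumes "u \<in> pairs" "Q 0" "\<And>b c. b \<in> carrier B \<Longrightarrow> c \<in> carrier C \<Longrightarrow> Q (frag_of (b, c))"
    "\<And>u v. u \<in> pairs \<Longrightarrow> v \<in> pairs \<Longrightarrow> Q u \<Longrightarrow> Q v \<Longrightarrow> Q (u - v)"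
  shows "Q u"
proof -
  have "u \<in> pairs \<and> Q u"
    by (rule frag_induction[where S = "carrier B \<times> carrier C" and P = "\<lambda>u. u \<in> pairs \<and> Q u"])
      (use assms pairs_diff in auto)
  then show ?thesis ..
qed

lemma pair_mult_closed:
  assumes "u \<in> pairs" "v \<in> pairs"
  shows "pair_mult B C u v \<in> pairs"
  using assms(1)
proof (induction u rule: pairs_induct)
  case (one b c)
  show ?case using assms(2)
    by (induction v rule: pairs_induct) (use one pairs_diff in \<open>auto simp: pair_mult_simps\<close>)
qed (use pairs_diff in \<open>auto simp: pair_mult_simps\<close>)

lemma pair_mult_comm:
  assumes "u \<in> pairs" "v \<in> pairs"
  shows "pair_mult B C u v = pair_mult B C v u"
  using assms(1)
proof (induction u rule: pairs_induct)
  case (one b c)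
  show ?case using assms(2)
    by (induction v rule: pairs_induct) (use one in \<open>auto simp: pair_mult_simps B.m_comm C.m_comm\<close>)
qed (auto simp: pair_mult_simps)

lemma pair_mult_assoc:
  assumes "u \<in> pairs" "v \<in> pairs" "w \<in> pairs"
  shows "pair_mult B C (pair_mult B C u v) w = pair_mult B C u (pair_mult B C v w)"
  using assms(1)
proof (induction u rule: pairs_induct)
  case u: (one b c)
  show ?case using assms(2)
  proof (induction v rule: pairs_induct)
    case v: (one b' c')
    show ?case using assms(3)
      by (induction w rule: pairs_induct)
        (use u v in \<open>auto simp: pair_mult_simps B.m_assoc C.m_assoc\<close>)
  qed (auto simp: pair_mult_simps)
qed (auto simp: pair_mult_simps)

lemma pair_mult_one:
  assumes "u \<in> pairs"
  shows "pair_mult B C (frag_of (\<one>\<^bsub>B\<^esub>, \<one>\<^bsub>C\<^esub>)) u = u"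
  using assms by (induction u rule: pairs_induct) (auto simp: pair_mult_simps)

lemma pair_ring_is_cring: "cring P"
proof (rule cringI)
  show "abelian_group P"
  proof (rule abelian_groupI)
    fix x assume "x \<in> carrier P"
    then show "\<exists>y\<in>carrier P. y \<oplus>\<^bsub>P\<^esub> x = \<zero>\<^bsub>P\<^esub>"
      using pairs_diff[of 0 x] by (intro bexI[of _ "0 - x"]) (auto simp: pair_ring_simps)
  qed (use pairs_add in \<open>auto simp: pair_ring_simps add.assoc add.commute\<close>)
  show "comm_monoid P"
    by (rule comm_monoidI)
      (use pair_mult_closed pair_mult_comm pair_mult_assoc pair_mult_one in \<open>auto simp: pair_ring_simps\<close>)
qed (simp add: pair_ring_simps pair_mult_simps)

sublocale P: cring P by (rule pair_ring_is_cring)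

lemma relations_subset: "tensor_relations \<phi> B \<psi> C \<subseteq> carrier P"
  unfolding tensor_relations_def pair_ring_simps
  by (intro Un_least subsetI; elim CollectE exE conjE; simp only:; intro pairs_diff frag_of_pairs;
      simp add: \<phi>_carr \<psi>_carr)

sublocale J: ideal J P
  unfolding tensor_ideal_def by (rule P.genideal_ideal[OF relations_subset])

lemma relations_in_J: "tensor_relations \<phi> B \<psi> C \<subseteq> J"
  unfolding tensor_ideal_def by (rule P.genideal_self[OF relations_subset])

sublocale T: cring T
  unfolding tensor_def by (rule J.quotient_is_cring[OF pair_ring_is_cring])

definition proj :: "('b \<times> 'c \<Rightarrow>\<^sub>0 int) \<Rightarrow> ('b \<times> 'c \<Rightarrow>\<^sub>0 int) set" where
  "proj u = J +>\<^bsub>P\<^esub> u"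

lemma proj_hom: "proj \<in> ring_hom P T"
  unfolding proj_def tensor_def by (rule J.rcos_ring_hom)

lemma proj_carrier: "u \<in> pairs \<Longrightarrow> proj u \<in> carrier T"
  and proj_mult: "u \<in> pairs \<Longrightarrow> v \<in> pairs \<Longrightarrow> proj (pair_mult B C u v) = proj u \<otimes>\<^bsub>T\<^esub> proj v"
  and proj_add: "u \<in> pairs \<Longrightarrow> v \<in> pairs \<Longrightarrow> proj (u + v) = proj u \<oplus>\<^bsub>T\<^esub> proj v"
  and proj_one: "proj (frag_of (\<one>\<^bsub>B\<^esub>, \<one>\<^bsub>C\<^esub>)) = \<one>\<^bsub>T\<^esub>"
  using ring_hom_memE[OF proj_hom] by (auto simp: pair_ring_simps)

lemma proj_diff: "u \<in> pairs \<Longrightarrow> v \<in> pairs \<Longrightarrow> proj (u - v) = proj u \<ominus>\<^bsub>T\<^esub> proj v"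
proof -
  assume uv: "u \<in> pairs" "v \<in> pairs"
  have "proj u = proj (u - v) \<oplus>\<^bsub>T\<^esub> proj v"
    using proj_add[OF pairs_diff[OF uv] uv(2)] by simp
  then show ?thesis
    using proj_carrier[OF pairs_diff[OF uv]] proj_carrier[OF uv(2)]
    by (simp add: T.minus_eq T.a_assoc T.r_neg)
qed

lemma proj_zero: "proj 0 = \<zero>\<^bsub>T\<^esub>"
  using proj_diff[of 0 0] proj_carrier[of 0] by (simp add: T.minus_eq T.r_neg)

lemma carrier_T: "carrier T = proj ` pairs"
  by (auto simp: tensor_def FactRing_def A_RCOSETS_def' proj_def pair_ring_simps)

lemma proj_eq_zero: "u \<in> J \<Longrightarrow> proj u = \<zero>\<^bsub>T\<^esub>"
  unfolding proj_def tensor_def by (simp add: FactRing_def J.a_rcos_const)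

lemma elem_eq: "tens b c = proj (frag_of (b, c))"
  by (simp add: tensor_elem_def proj_def)

lemma elem_carrier: "b \<in> carrier B \<Longrightarrow> c \<in> carrier C \<Longrightarrow> tens b c \<in> carrier T"
  unfolding elem_eq by (intro proj_carrier frag_of_pairs)

lemma elem_mult:
  assumes "b \<in> carrier B" "c \<in> carrier C" "b' \<in> carrier B" "c' \<in> carrier C"
  shows "tens b c \<otimes>\<^bsub>T\<^esub> tens b' c' = tens (b \<otimes>\<^bsub>B\<^esub> b') (c \<otimes>\<^bsub>C\<^esub> c')"
  using proj_mult[OF frag_of_pairs[OF assms(1,2)] frag_of_pairs[OF assms(3,4)]]
  by (simp add: elem_eq pair_mult_simps)

lemma elem_one: "tens \<one>\<^bsub>B\<^esub> \<one>\<^bsub>C\<^esub> = \<one>\<^bsub>T\<^esub>"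
  by (simp add: elem_eq proj_one)

lemma proj_eqI:
  assumes "u \<in> pairs" "v \<in> pairs" "u - v \<in> J"
  shows "proj u = proj v"
proof -
  have "proj u = proj (u - v) \<oplus>\<^bsub>T\<^esub> proj v"
    using proj_add[OF pairs_diff[OF assms(1,2)] assms(2)] by simp
  then show ?thesis using proj_eq_zero[OF assms(3)] proj_carrier[OF assms(2)] by simp
qed

lemma elem_add_left:
  assumes "b \<in> carrier B" "b' \<in> carrier B" "c \<in> carrier C"
  shows "tens (b \<oplus>\<^bsub>B\<^esub> b') c = tens b c \<oplus>\<^bsub>T\<^esub> tens b' c"
proof -
  have "frag_of (b \<oplus>\<^bsub>B\<^esub> b', c) - frag_of (b, c) - frag_of (b', c) \<in> tensor_relations \<phi> B \<psi> C"
    using assms unfolding tensor_relations_def by blast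
  then have J: "frag_of (b \<oplus>\<^bsub>B\<^esub> b', c) - (frag_of (b, c) + frag_of (b', c)) \<in> J"
    using relations_in_J by (auto simp: diff_diff_eq)
  have "proj (frag_of (b \<oplus>\<^bsub>B\<^esub> b', c)) = proj (frag_of (b, c) + frag_of (b', c))"
    by (rule proj_eqI[OF _ _ J]) (intro pairs_add frag_of_pairs B.a_closed C.a_closed assms)+
  also have "\<dots> = tens b c \<oplus>\<^bsub>T\<^esub> tens b' c"
    unfolding elem_eq by (rule proj_add) (intro frag_of_pairs assms)+
  finally show ?thesis unfolding elem_eq .
qed

lemma elem_add_right:
  assumes "b \<in> carrier B" "c \<in> carrier C" "c' \<in> carrier C"
  shows "tens b (c \<oplus>\<^bsub>C\<^esub> c') = tens b c \<oplus>\<^bsub>T\<^esub> tens b c'"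
proof -
  have "frag_of (b, c \<oplus>\<^bsub>C\<^esub> c') - frag_of (b, c) - frag_of (b, c') \<in> tensor_relations \<phi> B \<psi> C"
    using assms unfolding tensor_relations_def by blast
  then have J: "frag_of (b, c \<oplus>\<^bsub>C\<^esub> c') - (frag_of (b, c) + frag_of (b, c')) \<in> J"
    using relations_in_J by (auto simp: diff_diff_eq)
  have "proj (frag_of (b, c \<oplus>\<^bsub>C\<^esub> c')) = proj (frag_of (b, c) + frag_of (b, c'))"
    by (rule proj_eqI[OF _ _ J]) (intro pairs_add frag_of_pairs B.a_closed C.a_closed assms)+
  also have "\<dots> = tens b c \<oplus>\<^bsub>T\<^esub> tens b c'"
    unfolding elem_eq by (rule proj_add) (intro frag_of_pairs assms)+
  finally show ?thesis unfolding elem_eq .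
qed

lemma elem_balanced:
  assumes "b \<in> carrier B" "c \<in> carrier C"
  shows "tens (\<phi> a \<otimes>\<^bsub>B\<^esub> b) c = tens b (\<psi> a \<otimes>\<^bsub>C\<^esub> c)"
proof -
  have "frag_of (\<phi> a \<otimes>\<^bsub>B\<^esub> b, c) - frag_of (b, \<psi> a \<otimes>\<^bsub>C\<^esub> c) \<in> tensor_relations \<phi> B \<psi> C"
    using assms unfolding tensor_relations_def by blast
  then show ?thesis
    unfolding elem_eq using assms relations_in_J \<phi>_carr \<psi>_carr by (intro proj_eqI) auto
qed

lemma elem_zero_left: "c \<in> carrier C \<Longrightarrow> tens \<zero>\<^bsub>B\<^esub> c = \<zero>\<^bsub>T\<^esub>"
  using elem_add_left[of "\<zero>\<^bsub>B\<^esub>" "\<zero>\<^bsub>B\<^esub>" c] elem_carrier[of "\<zero>\<^bsub>B\<^esub>" c]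
  by (simp add: T.add.l_cancel_one')

text \<open>Pure tensors generate the tensor product as an additive group. The step uses
  differences, which also account for the negative coefficients of formal sums.\<close>

lemma tensor_induct [consumes 1, case_names zero pure minus]:
  assumes "x \<in> carrier T" "Q \<zero>\<^bsub>T\<^esub>" "\<And>b c. b \<in> carrier B \<Longrightarrow> c \<in> carrier C \<Longrightarrow> Q (tens b c)"
    "\<And>x y. x \<in> carrier T \<Longrightarrow> y \<in> carrier T \<Longrightarrow> Q x \<Longrightarrow> Q y \<Longrightarrow> Q (x \<ominus>\<^bsub>T\<^esub> y)"
  shows "Q x"
proof -
  obtain u where u: "u \<in> pairs" "x = proj u" using assms(1) unfolding carrier_T by auto
  have "Q (proj u)" using u(1)
  proof (induction u rule: pairs_induct)
    case zero
    show ?case using assms(2) by (simp add: proj_zero)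
  next
    case (one b c)
    then show ?case using assms(3) by (simp add: elem_eq)
  next
    case (diff u v)
    then show ?case using assms(4) proj_carrier by (simp add: proj_diff del: mem_Collect_eq)
  qed
  then show ?thesis using u(2) by simp
qed

end

text \<open>The two tensor products may be taken over different base rings. Compatibility asks only
  that each scalar of the source correspond to some scalar of the target that acts in the same way
  on both factors.\<close>

locale tensor_hom = S: tensor_product B\<^sub>0 C\<^sub>0 \<phi>\<^sub>0 \<psi>\<^sub>0 + D: tensor_product B C \<phi> \<psi>
  for B\<^sub>0 :: "('b0, 'm0) ring_scheme" and C\<^sub>0 :: "('c0, 'n0) ring_scheme"
    and \<phi>\<^sub>0 :: "'a0 \<Rightarrow> 'b0" and \<psi>\<^sub>0 :: "'a0 \<Rightarrow> 'c0"
    and B :: "('b, 'm) ring_scheme" and C :: "('c, 'n) ring_scheme"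
    and \<phi> :: "'a \<Rightarrow> 'b" and \<psi> :: "'a \<Rightarrow> 'c" +
  fixes g :: "'b0 \<Rightarrow> 'b" and h :: "'c0 \<Rightarrow> 'c"
  assumes g: "g \<in> ring_hom B\<^sub>0 B" and h: "h \<in> ring_hom C\<^sub>0 C"
    and base: "\<exists>a'. g (\<phi>\<^sub>0 a) = \<phi> a' \<and> h (\<psi>\<^sub>0 a) = \<psi> a'"
begin

definition pair_map :: "('b0 \<times> 'c0 \<Rightarrow>\<^sub>0 int) \<Rightarrow> ('b \<times> 'c \<Rightarrow>\<^sub>0 int)" where
  "pair_map u = frag_extend (\<lambda>(b, c). frag_of (g b, h c)) u"

lemma pair_map_simps:
  "pair_map 0 = 0" "pair_map (frag_of (b, c)) = frag_of (g b, h c)"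
  "pair_map (u - v) = pair_map u - pair_map v" "pair_map (u + v) = pair_map u + pair_map v"
  by (simp_all add: pair_map_def frag_extend_diff frag_extend_add)

lemma g_carr: "b \<in> carrier B\<^sub>0 \<Longrightarrow> g b \<in> carrier B" and h_carr: "c \<in> carrier C\<^sub>0 \<Longrightarrow> h c \<in> carrier C"
  using ring_hom_closed g h by metis+

lemma pair_map_pairs: "u \<in> S.pairs \<Longrightarrow> pair_map u \<in> D.pairs"
  by (induction u rule: S.pairs_induct)
    (use g_carr h_carr D.pairs_diff in \<open>auto simp: pair_map_simps\<close>)

lemma pair_map_mult:
  assumes "u \<in> S.pairs" "v \<in> S.pairs"
  shows "pair_map (pair_mult B\<^sub>0 C\<^sub>0 u v) = pair_mult B C (pair_map u) (pair_map v)"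
  using assms(1)
proof (induction u rule: S.pairs_induct)
  case (one b c)
  show ?case using assms(2)
    by (induction v rule: S.pairs_induct)
      (use one in \<open>auto simp: pair_map_simps pair_mult_simps ring_hom_mult[OF g] ring_hom_mult[OF h]\<close>)
qed (auto simp: pair_map_simps pair_mult_simps)

definition lifted :: "('b0 \<times> 'c0 \<Rightarrow>\<^sub>0 int) \<Rightarrow> ('b \<times> 'c \<Rightarrow>\<^sub>0 int) set" where
  "lifted u = D.proj (pair_map u)"

lemma lifted_hom: "lifted \<in> ring_hom S.P D.T"
proof (rule ring_hom_memI)
  fix u assume "u \<in> carrier S.P"
  then have u: "u \<in> S.pairs" by (simp add: pair_ring_simps)
  then show "lifted u \<in> carrier D.T" unfolding lifted_def by (intro D.proj_carrier pair_map_pairs)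
  fix v assume "v \<in> carrier S.P"
  then have v: "v \<in> S.pairs" by (simp add: pair_ring_simps)
  note uv = pair_map_pairs[OF u] pair_map_pairs[OF v]
  show "lifted (u \<otimes>\<^bsub>S.P\<^esub> v) = lifted u \<otimes>\<^bsub>D.T\<^esub> lifted v"
    unfolding lifted_def pair_ring_simps pair_map_mult[OF u v] by (rule D.proj_mult[OF uv])
  show "lifted (u \<oplus>\<^bsub>S.P\<^esub> v) = lifted u \<oplus>\<^bsub>D.T\<^esub> lifted v"
    unfolding lifted_def pair_ring_simps pair_map_simps by (rule D.proj_add[OF uv])
next
  show "lifted \<one>\<^bsub>S.P\<^esub> = \<one>\<^bsub>D.T\<^esub>"
    by (simp add: lifted_def pair_ring_simps pair_map_simps ring_hom_one[OF g] ring_hom_one[OF h] D.proj_one)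
qed

lemma lifted_diff:
  assumes "u \<in> S.pairs" "v \<in> S.pairs"
  shows "lifted (u - v) = lifted u \<ominus>\<^bsub>D.T\<^esub> lifted v"
  unfolding lifted_def pair_map_simps by (rule D.proj_diff[OF pair_map_pairs[OF assms(1)] pair_map_pairs[OF assms(2)]])

lemma lifted_frag_of: "lifted (frag_of (b, c)) = D.tens (g b) (h c)"
  by (simp add: lifted_def pair_map_simps D.elem_eq)

lemma lifted_relation:
  assumes "r \<in> tensor_relations \<phi>\<^sub>0 B\<^sub>0 \<psi>\<^sub>0 C\<^sub>0"
  shows "lifted r = \<zero>\<^bsub>D.T\<^esub>"
proof -
  have cancel: "x \<oplus>\<^bsub>D.T\<^esub> y \<ominus>\<^bsub>D.T\<^esub> x \<ominus>\<^bsub>D.T\<^esub> y = \<zero>\<^bsub>D.T\<^esub>" "x \<ominus>\<^bsub>D.T\<^esub> x = \<zero>\<^bsub>D.T\<^esub>"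
    if "x \<in> carrier D.T" "y \<in> carrier D.T" for x y
  proof -
    have "x \<oplus>\<^bsub>D.T\<^esub> y \<ominus>\<^bsub>D.T\<^esub> x \<ominus>\<^bsub>D.T\<^esub> y = (x \<oplus>\<^bsub>D.T\<^esub> y) \<ominus>\<^bsub>D.T\<^esub> (x \<oplus>\<^bsub>D.T\<^esub> y)"
      using that by (simp add: D.T.minus_eq D.T.minus_add D.T.a_assoc)
    then show "x \<oplus>\<^bsub>D.T\<^esub> y \<ominus>\<^bsub>D.T\<^esub> x \<ominus>\<^bsub>D.T\<^esub> y = \<zero>\<^bsub>D.T\<^esub>" "x \<ominus>\<^bsub>D.T\<^esub> x = \<zero>\<^bsub>D.T\<^esub>"
      using that by (simp_all add: D.T.minus_eq D.T.r_neg)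
  qed
  have lifted_diff2: "lifted (u - v - w) = lifted u \<ominus>\<^bsub>D.T\<^esub> lifted v \<ominus>\<^bsub>D.T\<^esub> lifted w"
    if "u \<in> S.pairs" "v \<in> S.pairs" "w \<in> S.pairs" for u v w
    unfolding lifted_diff[OF S.pairs_diff[OF that(1,2)] that(3)] lifted_diff[OF that(1,2)] ..
  consider b b' c where "r = frag_of (b \<oplus>\<^bsub>B\<^sub>0\<^esub> b', c) - frag_of (b, c) - frag_of (b', c)"
      "b \<in> carrier B\<^sub>0" "b' \<in> carrier B\<^sub>0" "c \<in> carrier C\<^sub>0"
    | b c c' where "r = frag_of (b, c \<oplus>\<^bsub>C\<^sub>0\<^esub> c') - frag_of (b, c) - frag_of (b, c')"
      "b \<in> carrier B\<^sub>0" "c \<in> carrier C\<^sub>0" "c' \<in> carrier C\<^sub>0"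
    | a b c where "r = frag_of (\<phi>\<^sub>0 a \<otimes>\<^bsub>B\<^sub>0\<^esub> b, c) - frag_of (b, \<psi>\<^sub>0 a \<otimes>\<^bsub>C\<^sub>0\<^esub> c)"
      "b \<in> carrier B\<^sub>0" "c \<in> carrier C\<^sub>0"
    using assms unfolding tensor_relations_def by blast
  then show ?thesis
  proof cases
    case 1
    have "lifted r = D.tens (g b \<oplus>\<^bsub>B\<^esub> g b') (h c) \<ominus>\<^bsub>D.T\<^esub> D.tens (g b) (h c) \<ominus>\<^bsub>D.T\<^esub> D.tens (g b') (h c)"
      unfolding 1(1) ring_hom_add[OF g 1(2,3), symmetric] lifted_frag_of[symmetric]
      by (rule lifted_diff2) (intro S.frag_of_pairs S.B.a_closed 1(2-4))+
    also have "\<dots> = \<zero>\<^bsub>D.T\<^esub>"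
      unfolding D.elem_add_left[OF g_carr[OF 1(2)] g_carr[OF 1(3)] h_carr[OF 1(4)]]
      by (rule cancel) (intro D.elem_carrier g_carr h_carr 1(2-4))+
    finally show ?thesis .
  next
    case 2
    have "lifted r = D.tens (g b) (h c \<oplus>\<^bsub>C\<^esub> h c') \<ominus>\<^bsub>D.T\<^esub> D.tens (g b) (h c) \<ominus>\<^bsub>D.T\<^esub> D.tens (g b) (h c')"
      unfolding 2(1) ring_hom_add[OF h 2(3,4), symmetric] lifted_frag_of[symmetric]
      by (rule lifted_diff2) (intro S.frag_of_pairs S.C.a_closed 2(2-4))+
    also have "\<dots> = \<zero>\<^bsub>D.T\<^esub>"
      unfolding D.elem_add_right[OF g_carr[OF 2(2)] h_carr[OF 2(3)] h_carr[OF 2(4)]]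
      by (rule cancel) (intro D.elem_carrier g_carr h_carr 2(2-4))+
    finally show ?thesis .
  next
    case 3
    obtain a' where a': "g (\<phi>\<^sub>0 a) = \<phi> a'" "h (\<psi>\<^sub>0 a) = \<psi> a'" using base by blast
    have "lifted r = D.tens (g (\<phi>\<^sub>0 a \<otimes>\<^bsub>B\<^sub>0\<^esub> b)) (h c) \<ominus>\<^bsub>D.T\<^esub> D.tens (g b) (h (\<psi>\<^sub>0 a \<otimes>\<^bsub>C\<^sub>0\<^esub> c))"
      unfolding 3(1) lifted_frag_of[symmetric]
      by (rule lifted_diff) (intro S.frag_of_pairs S.B.m_closed S.C.m_closed S.\<phi>_carr S.\<psi>_carr 3(2,3))+
    also have "\<dots> = D.tens (\<phi> a' \<otimes>\<^bsub>B\<^esub> g b) (h c) \<ominus>\<^bsub>D.T\<^esub> D.tens (g b) (\<psi> a' \<otimes>\<^bsub>C\<^esub> h c)"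
      using 3(2,3) S.\<phi>_carr S.\<psi>_carr by (simp add: ring_hom_mult[OF g] ring_hom_mult[OF h] a')
    also have "\<dots> = \<zero>\<^bsub>D.T\<^esub>"
      unfolding D.elem_balanced[OF g_carr[OF 3(2)] h_carr[OF 3(3)]]
      by (rule cancel(2)[OF _ D.T.zero_closed]) (intro D.elem_carrier D.C.m_closed g_carr h_carr D.\<psi>_carr 3(2,3))+
    finally show ?thesis .
  qed
qed

text \<open>The kernel is an ideal that contains the relations, hence also the ideal generated by
  them.\<close>

lemma lifted_J:
  assumes "u \<in> S.J"
  shows "lifted u = \<zero>\<^bsub>D.T\<^esub>"
proof -
  interpret ring_hom_ring S.P D.T lifted
    by (rule ring_hom_ringI2[OF S.P.ring_axioms D.T.ring_axioms lifted_hom])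
  have "S.J \<subseteq> a_kernel S.P D.T lifted"
    unfolding tensor_ideal_def
  proof (rule S.P.genideal_minimal[OF kernel_is_ideal], rule subsetI)
    fix r assume r: "r \<in> tensor_relations \<phi>\<^sub>0 B\<^sub>0 \<psi>\<^sub>0 C\<^sub>0"
    then show "r \<in> a_kernel S.P D.T lifted"
      unfolding a_kernel_def' using lifted_relation[OF r] S.relations_subset by blast
  qed
  then have "u \<in> a_kernel S.P D.T lifted" using assms by blast
  then show ?thesis unfolding a_kernel_def' by blast
qed

text \<open>The map on formal sums is constant on cosets of the tensor ideal, so the set under
  \<open>the_elem\<close> is a singleton.\<close>

lemma tensor_map_proj:
  assumes u: "u \<in> S.pairs"
  shows "tensor_map \<phi> B \<psi> C g h (S.proj u) = lifted u"
proof -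
  have "lifted v = lifted u" if "v \<in> S.proj u" for v
  proof -
    obtain j where j: "j \<in> S.J" "v = j + u"
      using \<open>v \<in> _\<close> by (auto simp: S.proj_def a_r_coset_def' pair_ring_simps)
    have "j \<in> S.pairs" using S.J.Icarr[OF j(1)] by (simp add: pair_ring_simps)
    then have "lifted v = lifted j \<oplus>\<^bsub>D.T\<^esub> lifted u"
      using ring_hom_add[OF lifted_hom, of j u] u by (simp add: pair_ring_simps j(2))
    moreover have "lifted u \<in> carrier D.T"
      unfolding lifted_def by (intro D.proj_carrier pair_map_pairs u)
    ultimately show ?thesis using lifted_J[OF j(1)] by simp
  qed
  moreover have "u \<in> S.proj u"
    unfolding S.proj_def by (rule S.J.a_rcos_self) (use u in \<open>simp add: pair_ring_simps\<close>)
  ultimately have "lifted ` S.proj u = {lifted u}" by blast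
  then show ?thesis
    unfolding tensor_map_def lifted_def[abs_def] D.proj_def pair_map_def by simp
qed

lemma tensor_map_elem:
  assumes "b \<in> carrier B\<^sub>0" "c \<in> carrier C\<^sub>0"
  shows "tensor_map \<phi> B \<psi> C g h (S.tens b c) = D.tens (g b) (h c)"
  unfolding S.elem_eq tensor_map_proj[OF S.frag_of_pairs[OF assms]] by (rule lifted_frag_of)

lemma tensor_map_hom: "tensor_map \<phi> B \<psi> C g h \<in> ring_hom S.T D.T"
proof (rule ring_hom_memI)
  fix x assume "x \<in> carrier S.T"
  then obtain u where u: "u \<in> S.pairs" "x = S.proj u" unfolding S.carrier_T by auto
  then show "tensor_map \<phi> B \<psi> C g h x \<in> carrier D.T"
    by (simp only: tensor_map_proj lifted_def) (intro D.proj_carrier pair_map_pairs)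
  fix y assume "y \<in> carrier S.T"
  then obtain v where v: "v \<in> S.pairs" "y = S.proj v" unfolding S.carrier_T by auto
  have uv: "u \<in> carrier S.P" "v \<in> carrier S.P" using u v by (simp_all add: pair_ring_simps)
  show "tensor_map \<phi> B \<psi> C g h (x \<otimes>\<^bsub>S.T\<^esub> y) =
      tensor_map \<phi> B \<psi> C g h x \<otimes>\<^bsub>D.T\<^esub> tensor_map \<phi> B \<psi> C g h y"
    unfolding u(2) v(2) S.proj_mult[OF u(1) v(1), symmetric] tensor_map_proj[OF u(1)]
      tensor_map_proj[OF v(1)] tensor_map_proj[OF S.pair_mult_closed[OF u(1) v(1)]]
    using ring_hom_mult[OF lifted_hom uv] by (simp add: pair_ring_simps)
  show "tensor_map \<phi> B \<psi> C g h (x \<oplus>\<^bsub>S.T\<^esub> y) =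
      tensor_map \<phi> B \<psi> C g h x \<oplus>\<^bsub>D.T\<^esub> tensor_map \<phi> B \<psi> C g h y"
    unfolding u(2) v(2) S.proj_add[OF u(1) v(1), symmetric] tensor_map_proj[OF u(1)]
      tensor_map_proj[OF v(1)] tensor_map_proj[OF S.pairs_add[OF u(1) v(1)]]
    using ring_hom_add[OF lifted_hom uv] by (simp add: pair_ring_simps)
next
  show "tensor_map \<phi> B \<psi> C g h \<one>\<^bsub>S.T\<^esub> = \<one>\<^bsub>D.T\<^esub>"
    unfolding S.elem_one[symmetric] using tensor_map_elem[of "\<one>\<^bsub>B\<^sub>0\<^esub>" "\<one>\<^bsub>C\<^sub>0\<^esub>"]
    by (simp add: ring_hom_one[OF g] ring_hom_one[OF h] D.elem_one)
qed

end

section \<open>The completed order\<close>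

context tensor_product
begin

lemma elem_one_hom: "tens \<one>\<^bsub>B\<^esub> \<in> ring_hom C T"
  by (rule ring_hom_memI) (simp_all add: elem_carrier elem_mult elem_add_right elem_one)

lemma elem_factor:
  assumes "b \<in> carrier B" "c \<in> carrier C" "d \<in> carrier C"
  shows "tens b (c \<otimes>\<^bsub>C\<^esub> d) = tens \<one>\<^bsub>B\<^esub> c \<otimes>\<^bsub>T\<^esub> tens b d"
  using assms by (simp add: elem_mult)

end

locale completed_order = poly_prime \<pi> p + K: field K
  for \<pi> :: "'q::{field,finite} poly" and p and K :: "('k, 'm) ring_scheme" +
  fixes f :: "'q poly poly" and \<iota> :: "'q poly poly set \<Rightarrow> 'k" and R :: "'k set"
  assumes degree_f: "degree f > 0"
    and frac: "is_fraction_field (quotient_by f) K \<iota>"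
    and order: "is_order K (range (A_to_K f \<iota>)) (range (F_to_K f K \<iota>)) R"
begin

abbreviation "\<alpha> \<equiv> A_to_K f \<iota>"
abbreviation "\<phi> \<equiv> F_to_K f K \<iota>"
abbreviation "to_A \<equiv> to_completion (adic p)"
abbreviation "to_F \<equiv> to_completion (fract_adic p)"
abbreviation "A_F_map \<equiv> A_at_to_F_at p"

sublocale A_at: cring "A_at p" unfolding A_at_def by (rule A.completion_is_cring)
sublocale F_at: cring "F_at p" unfolding F_at_def by (rule F.completion_is_cring)

lemma A_F_map_hom: "A_F_map \<in> ring_hom (A_at p) (F_at p)"
  unfolding A_at_to_F_at_def A_at_def F_at_def by (rule A_F.completion_map_hom)

lemma A_F_map_to_A: "A_F_map (to_A a) = to_F (Fract a 1)"
  unfolding A_at_to_F_at_def by (rule A_F.completion_map_to_completion)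

lemma to_A_carrier: "to_A a \<in> carrier (A_at p)"
  and to_F_carrier: "to_F z \<in> carrier (F_at p)"
  by (simp_all add: A_at_def F_at_def A.to_completion_carrier F.to_completion_carrier)

lemma PIdl_f_ideal: "ideal (PIdl\<^bsub>ring_of_type_algebra\<^esub> f) ring_of_type_algebra"
  by (rule cring.cgenideal_ideal[OF cring_from_type_algebra]) simp

lemma \<alpha>_hom: "\<alpha> \<in> ring_hom ring_of_type_algebra K"
proof -
  have \<iota>: "\<iota> \<in> ring_hom (quotient_by f) K" using frac by (simp add: is_fraction_field_def)
  have "(\<lambda>a. [:a:]) \<in> ring_hom ring_of_type_algebra (ring_of_type_algebra :: 'q poly poly ring)"
    by (rule ring_hom_memI) (simp_all add: one_pCons)
  moreover have "(\<lambda>x. PIdl\<^bsub>ring_of_type_algebra\<^esub> f +>\<^bsub>ring_of_type_algebra\<^esub> x)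
      \<in> ring_hom ring_of_type_algebra (quotient_by f)"
    unfolding quotient_by_def by (rule ideal.rcos_ring_hom[OF PIdl_f_ideal])
  ultimately have "\<iota> \<circ> ((\<lambda>x. PIdl\<^bsub>ring_of_type_algebra\<^esub> f +>\<^bsub>ring_of_type_algebra\<^esub> x) \<circ> (\<lambda>a. [:a:]))
      \<in> ring_hom ring_of_type_algebra K"
    by (rule ring_hom_trans[OF ring_hom_trans \<iota>])
  then show ?thesis by (simp add: A_to_K_def[abs_def] comp_def)
qed

lemma \<alpha>_carr: "\<alpha> a \<in> carrier K" and \<alpha>_mult: "\<alpha> (a * b) = \<alpha> a \<otimes>\<^bsub>K\<^esub> \<alpha> b" and \<alpha>_one: "\<alpha> 1 = \<one>\<^bsub>K\<^esub>"
  and \<alpha>_add: "\<alpha> (a + b) = \<alpha> a \<oplus>\<^bsub>K\<^esub> \<alpha> b"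
  using ring_hom_memE[OF \<alpha>_hom] by simp_all

text \<open>Constants that agree modulo \<open>f\<close> differ by a multiple of \<open>f\<close> of
  degree 0; since \<open>f\<close> has positive degree, only 0 is possible.\<close>

lemma \<alpha>_inj: "inj \<alpha>"
proof (rule injI)
  fix a b assume eq: "\<alpha> a = \<alpha> b"
  let ?T = "ring_of_type_algebra :: 'q poly poly ring"
  interpret T: cring ?T by (rule cring_from_type_algebra)
  interpret I: ideal "PIdl\<^bsub>?T\<^esub> f" ?T by (rule PIdl_f_ideal)
  have "PIdl\<^bsub>?T\<^esub> f +>\<^bsub>?T\<^esub> x \<in> carrier (quotient_by f)" for x
    by (auto simp: quotient_by_def FactRing_def A_RCOSETS_def')
  moreover have "inj_on \<iota> (carrier (quotient_by f))" using frac by (simp add: is_fraction_field_def)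
  ultimately have "PIdl\<^bsub>?T\<^esub> f +>\<^bsub>?T\<^esub> [:a:] = PIdl\<^bsub>?T\<^esub> f +>\<^bsub>?T\<^esub> [:b:]"
    using eq by (simp add: A_to_K_def inj_on_eq_iff)
  moreover have "[:a:] \<in> PIdl\<^bsub>?T\<^esub> f +>\<^bsub>?T\<^esub> [:a:]" by (rule I.a_rcos_self) simp
  ultimately obtain x where "[:a:] = x * f + [:b:]"
    by (auto simp: a_r_coset_def' cgenideal_def)
  then have "f dvd [:a - b:]" by (metis add_diff_cancel_right' diff_pCons diff_zero dvd_triv_right)
  then have "[:a - b:] = 0" using degree_f dvd_imp_degree_le[of f "[:a - b:]"] by auto
  then show "a = b" by simp
qed

lemma \<alpha>_zero: "\<alpha> 0 = \<zero>\<^bsub>K\<^esub>"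
  using \<alpha>_add[of 0 0] \<alpha>_carr[of 0] by (simp add: K.add.l_cancel_one')

lemma \<alpha>_nonzero: "b \<noteq> 0 \<Longrightarrow> \<alpha> b \<in> Units K"
  using injD[OF \<alpha>_inj, of b 0] \<alpha>_zero \<alpha>_carr[of b] K.field_Units by auto

text \<open>By cross-multiplication the quotient does not depend on the chosen fraction, so
  \<open>the_elem\<close> is applied to a singleton.\<close>

lemma \<phi>_Fract:
  assumes "b \<noteq> 0"
  shows "\<phi> (Fract a b) = \<alpha> a \<otimes>\<^bsub>K\<^esub> inv\<^bsub>K\<^esub> (\<alpha> b)"
proof -
  have "\<alpha> a' \<otimes>\<^bsub>K\<^esub> inv\<^bsub>K\<^esub> (\<alpha> b') = \<alpha> a \<otimes>\<^bsub>K\<^esub> inv\<^bsub>K\<^esub> (\<alpha> b)"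
    if "b' \<noteq> 0" "Fract a b = Fract a' b'" for a' b'
  proof -
    have "a * b' = a' * b" using that assms by (simp add: eq_fract)
    then have eq: "\<alpha> a \<otimes>\<^bsub>K\<^esub> \<alpha> b' = \<alpha> a' \<otimes>\<^bsub>K\<^esub> \<alpha> b" by (metis \<alpha>_mult)
    define u v where "u = inv\<^bsub>K\<^esub> (\<alpha> b)" and "v = inv\<^bsub>K\<^esub> (\<alpha> b')"
    have u: "u \<in> carrier K" "\<alpha> b \<otimes>\<^bsub>K\<^esub> u = \<one>\<^bsub>K\<^esub>" and v: "v \<in> carrier K" "\<alpha> b' \<otimes>\<^bsub>K\<^esub> v = \<one>\<^bsub>K\<^esub>"
      using \<alpha>_nonzero that(1) assms by (auto simp: u_def v_def)
    have "\<alpha> a' \<otimes>\<^bsub>K\<^esub> v = (\<alpha> a' \<otimes>\<^bsub>K\<^esub> v) \<otimes>\<^bsub>K\<^esub> (\<alpha> b \<otimes>\<^bsub>K\<^esub> u)" using u v \<alpha>_carr by simp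
    also have "\<dots> = (\<alpha> a' \<otimes>\<^bsub>K\<^esub> \<alpha> b) \<otimes>\<^bsub>K\<^esub> (u \<otimes>\<^bsub>K\<^esub> v)" using u(1) v(1) \<alpha>_carr by (simp add: K.m_ac)
    also have "\<dots> = (\<alpha> a \<otimes>\<^bsub>K\<^esub> u) \<otimes>\<^bsub>K\<^esub> (\<alpha> b' \<otimes>\<^bsub>K\<^esub> v)"
      unfolding eq[symmetric] using u(1) v(1) \<alpha>_carr by (simp add: K.m_ac)
    also have "\<dots> = \<alpha> a \<otimes>\<^bsub>K\<^esub> u" using u v \<alpha>_carr by simp
    finally show ?thesis by (simp add: u_def v_def)
  qed
  then have "{\<alpha> a' \<otimes>\<^bsub>K\<^esub> inv\<^bsub>K\<^esub> (\<alpha> b') | a' b'. b' \<noteq> 0 \<and> Fract a b = Fract a' b'}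
      = {\<alpha> a \<otimes>\<^bsub>K\<^esub> inv\<^bsub>K\<^esub> (\<alpha> b)}"
    using assms by blast
  then show ?thesis by (simp add: F_to_K_def fract_map_def)
qed

lemma \<phi>_carr: "\<phi> z \<in> carrier K"
proof -
  obtain a b where "z = Fract a b" "b \<noteq> 0" by (cases z) auto
  then show ?thesis using \<phi>_Fract[of b a] \<alpha>_nonzero[of b] \<alpha>_carr by simp
qed

lemma \<phi>_of_poly: "\<phi> (Fract a 1) = \<alpha> a"
  using \<phi>_Fract[of 1 a] \<alpha>_carr[of a] by (simp add: \<alpha>_one)

lemma R_subring: "subring R K"
  using order unfolding is_order_def by (rule conjunct1)

lemma range_\<alpha>_subring: "subring (range \<alpha>) K"
proof -
  interpret ring_hom_ring ring_of_type_algebra K \<alpha>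
    by (rule ring_hom_ringI2[OF ring_from_type_algebra K.ring_axioms \<alpha>_hom])
  have "subring (\<alpha> ` carrier ring_of_type_algebra) K"
    by (rule img_is_subring[OF ring.carrier_is_subring[OF ring_from_type_algebra]])
  then show ?thesis by simp
qed

lemma R_span: "\<exists>us. set us \<subseteq> carrier K \<and> R = K.Span (range \<alpha>) us"
  using order unfolding is_order_def fg_submodule_def by (elim conjE)

lemma \<alpha>_in_R: "\<alpha> a \<in> R"
proof -
  obtain us where us: "set us \<subseteq> carrier K" "R = K.Span (range \<alpha>) us" using R_span by auto
  have one: "\<one>\<^bsub>K\<^esub> \<in> R" using R_subring by (rule subringE(3))
  have "\<alpha> a \<otimes>\<^bsub>K\<^esub> \<one>\<^bsub>K\<^esub> \<in> R"
    unfolding us(2)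
    by (rule K.submodD(4)[OF K.Span_submod[OF range_\<alpha>_subring us(1)] rangeI one[unfolded us(2)]])
  then show ?thesis using \<alpha>_carr by simp
qed

lemma R_ring_cring: "cring (K\<lparr>carrier := R\<rparr>)"
  using K.subcringI'[OF R_subring] K.subcring_iff[OF subringE(1)[OF R_subring]] by simp

text \<open>The canonical map from the completed order to the completed algebra: inclusion of
  \<open>R\<close> on the left, the map of completions on the right, and the passage from A to F by
  \<open>a\<close> to \<open>Fract a 1\<close> on scalars.\<close>

sublocale tensor_hom "K\<lparr>carrier := R\<rparr>" "A_at p" \<alpha> to_A K "F_at p" \<phi> to_F id A_F_map
proof (intro tensor_hom.intro tensor_product.intro tensor_product_axioms.intro tensor_hom_axioms.intro)
  show "cring (K\<lparr>carrier := R\<rparr>)" by (rule R_ring_cring)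
  show "cring (A_at p)" "cring (F_at p)" "cring K" by unfold_locales
  show "\<alpha> a \<in> carrier (K\<lparr>carrier := R\<rparr>)" for a using \<alpha>_in_R by simp
  show "to_A a \<in> carrier (A_at p)" for a by (rule to_A_carrier)
  show "\<phi> z \<in> carrier K" for z by (rule \<phi>_carr)
  show "to_F z \<in> carrier (F_at p)" for z by (rule to_F_carrier)
  show "id \<in> ring_hom (K\<lparr>carrier := R\<rparr>) K"
    by (rule ring_hom_memI) (use subringE(1)[OF R_subring] in auto)
  show "A_F_map \<in> ring_hom (A_at p) (F_at p)" by (rule A_F_map_hom)
  show "\<exists>z. id (\<alpha> a) = \<phi> z \<and> A_F_map (to_A a) = to_F z" for a
    by (intro exI[of _ "Fract a 1"]) (simp add: \<phi>_of_poly A_F_map_to_A)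
qed

section \<open>The images of the completed rings in the completed algebra\<close>

abbreviation "E \<equiv> K_at f K \<iota> p"
abbreviation "A\<^sub>p \<equiv> A_at_in_K_at f K \<iota> p"
abbreviation "F\<^sub>p \<equiv> F_at_in_K_at f K \<iota> p"
abbreviation "R\<^sub>p \<equiv> R_at_in_K_at f K \<iota> R p"

lemma E_eq: "E = D.T"
  by (simp add: K_at_def)

lemma K_hom_F: "D.tens \<one>\<^bsub>K\<^esub> \<in> ring_hom (F_at p) E"
  unfolding E_eq by (rule D.elem_one_hom)

lemma K_hom_A: "(\<lambda>c. D.tens \<one>\<^bsub>K\<^esub> (A_F_map c)) \<in> ring_hom (A_at p) E"
  using ring_hom_trans[OF A_F_map_hom K_hom_F] by (simp add: comp_def)

sublocale E: cring E
  unfolding E_eq by (rule D.T.is_cring)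

sublocale hom_A: ring_hom_ring "A_at p" E "\<lambda>c. D.tens \<one>\<^bsub>K\<^esub> (A_F_map c)"
  by (rule ring_hom_ringI2[OF A_at.ring_axioms E.ring_axioms K_hom_A])

sublocale hom_F: ring_hom_ring "F_at p" E "D.tens \<one>\<^bsub>K\<^esub>"
  by (rule ring_hom_ringI2[OF F_at.ring_axioms E.ring_axioms K_hom_F])

lemma A\<^sub>p_subring: "subring A\<^sub>p E"
  unfolding A_at_in_K_at_def using hom_A.img_is_subring[OF A_at.carrier_is_subring] .

lemma F\<^sub>p_subring: "subring F\<^sub>p E"
  unfolding F_at_in_K_at_def using hom_F.img_is_subring[OF F_at.carrier_is_subring] .

sublocale hom_R: ring_hom_ring S.T E "tensor_map \<phi> K to_F (F_at p) id A_F_map"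
  unfolding E_eq by (rule ring_hom_ringI2[OF S.T.ring_axioms D.T.ring_axioms tensor_map_hom])

lemma R\<^sub>p_subring: "subring R\<^sub>p E"
  unfolding R_at_in_K_at_def R_at_def using hom_R.img_is_subring[OF S.T.carrier_is_subring] .

lemma A\<^sub>pI: "c \<in> carrier (A_at p) \<Longrightarrow> D.tens \<one>\<^bsub>K\<^esub> (A_F_map c) \<in> A\<^sub>p"
  unfolding A_at_in_K_at_def by blast

lemma F\<^sub>pI: "c \<in> carrier (F_at p) \<Longrightarrow> D.tens \<one>\<^bsub>K\<^esub> c \<in> F\<^sub>p"
  unfolding F_at_in_K_at_def by blast

lemma R\<^sub>pI:
  assumes "r \<in> R" and c: "c \<in> carrier (A_at p)"
  shows "D.tens r (A_F_map c) \<in> R\<^sub>p"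
proof -
  have r: "r \<in> carrier (K\<lparr>carrier := R\<rparr>)" using assms(1) by simp
  have "tensor_map \<phi> K to_F (F_at p) id A_F_map (S.tens r c) \<in> R\<^sub>p"
    unfolding R_at_in_K_at_def R_at_def by (rule imageI[OF S.elem_carrier[OF r c]])
  then show ?thesis by (simp only: tensor_map_elem[OF r c] id_apply)
qed

lemma A_F_map_carr: "c \<in> carrier (A_at p) \<Longrightarrow> A_F_map c \<in> carrier (F_at p)"
  using A_F_map_hom by (rule ring_hom_closed)

lemma A_F_map_one: "A_F_map \<one>\<^bsub>A_at p\<^esub> = \<one>\<^bsub>F_at p\<^esub>"
  using A_F_map_hom by (rule ring_hom_one)

lemma R_carr: "r \<in> R \<Longrightarrow> r \<in> carrier K"
  using subringE(1)[OF R_subring] by auto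

text \<open>Turns generators of \<open>R\<close> over A into generators \<open>u \<otimes> 1\<close>
  over the completed base. For fixed \<open>c\<close>, scalars from A can be moved across the tensor
  sign and pulled out, and on a generator \<open>u \<otimes> c\<close> is
  \<open>1 \<otimes> c\<close> times \<open>u \<otimes> 1\<close>.\<close>

lemma Span_A\<^sub>p:
  assumes us: "set us \<subseteq> carrier K" and r: "r \<in> K.Span (range \<alpha>) us" and c: "c \<in> carrier (A_at p)"
  shows "D.tens r (A_F_map c) \<in> E.Span A\<^sub>p (map (\<lambda>u. D.tens u \<one>\<^bsub>F_at p\<^esub>) us)"
proof -
  let ?ws = "map (\<lambda>u. D.tens u \<one>\<^bsub>F_at p\<^esub>) us"
  have ws: "set ?ws \<subseteq> carrier E" using us D.elem_carrier by (auto simp: E_eq)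
  note W = E.submodD[OF E.Span_submod[OF A\<^sub>p_subring ws]]
  note jc = A_F_map_carr[OF c]
  define N where "N = {r \<in> carrier K. D.tens r (A_F_map c) \<in> E.Span A\<^sub>p ?ws}"
  have "K.submod (range \<alpha>) N"
    unfolding K.submod_def
  proof (intro conjI ballI)
    show "N \<subseteq> carrier K" by (auto simp: N_def)
    show "\<zero>\<^bsub>K\<^esub> \<in> N" using W(2) D.elem_zero_left[OF jc] by (simp add: N_def E_eq)
    show "x \<oplus>\<^bsub>K\<^esub> y \<in> N" if "x \<in> N" "y \<in> N" for x y
      using that W(3) D.elem_add_left[OF _ _ jc] by (simp add: N_def E_eq)
    show "k \<otimes>\<^bsub>K\<^esub> x \<in> N" if k: "k \<in> range \<alpha>" and x: "x \<in> N" for k x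
    proof -
      obtain a where a: "k = \<phi> (Fract a 1)" using k \<phi>_of_poly by auto
      have xc: "x \<in> carrier K" using x by (simp add: N_def)
      have "D.tens (k \<otimes>\<^bsub>K\<^esub> x) (A_F_map c)
          = D.tens \<one>\<^bsub>K\<^esub> (A_F_map (to_A a)) \<otimes>\<^bsub>E\<^esub> D.tens x (A_F_map c)"
        unfolding a D.elem_balanced[OF xc jc] A_F_map_to_A E_eq by (rule D.elem_factor[OF xc to_F_carrier jc])
      also have "\<dots> \<in> E.Span A\<^sub>p ?ws" using x by (intro W(4) A\<^sub>pI to_A_carrier) (simp add: N_def)
      finally show ?thesis using \<phi>_carr xc a by (simp add: N_def)
    qed
  qed
  moreover have "set us \<subseteq> N"
  proof
    fix u assume u: "u \<in> set us"
    have uc: "u \<in> carrier K" using u us by auto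
    have "D.tens u (A_F_map c) = D.tens \<one>\<^bsub>K\<^esub> (A_F_map c) \<otimes>\<^bsub>E\<^esub> D.tens u \<one>\<^bsub>F_at p\<^esub>"
      using D.elem_factor[OF uc jc F_at.one_closed] jc by (simp add: E_eq)
    also have "\<dots> \<in> E.Span A\<^sub>p ?ws"
      using u by (intro W(4) A\<^sub>pI c E.Span_mem[OF A\<^sub>p_subring ws]) simp
    finally show "u \<in> N" using uc by (simp add: N_def)
  qed
  ultimately have "K.Span (range \<alpha>) us \<subseteq> N" by (rule K.Span_least)
  then show ?thesis using r by (auto simp: N_def)
qed

lemma Span_F\<^sub>p:
  assumes us: "set us \<subseteq> carrier K" and k: "k \<in> K.Span (range \<phi>) us" and c: "c \<in> carrier (F_at p)"
  shows "D.tens k c \<in> E.Span F\<^sub>p (map (\<lambda>u. D.tens u \<one>\<^bsub>F_at p\<^esub>) us)"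
proof -
  let ?ws = "map (\<lambda>u. D.tens u \<one>\<^bsub>F_at p\<^esub>) us"
  have ws: "set ?ws \<subseteq> carrier E" using us D.elem_carrier by (auto simp: E_eq)
  note W = E.submodD[OF E.Span_submod[OF F\<^sub>p_subring ws]]
  \<comment> \<open>The quantifier over \<open>c\<close> is inside the set because moving a scalar
    \<open>z\<close> across the tensor sign replaces \<open>c\<close> by \<open>z c\<close>.\<close>
  define N where "N = {k \<in> carrier K. \<forall>c\<in>carrier (F_at p). D.tens k c \<in> E.Span F\<^sub>p ?ws}"
  have "K.submod (range \<phi>) N"
    unfolding K.submod_def
  proof (intro conjI ballI)
    show "N \<subseteq> carrier K" by (auto simp: N_def)
    show "\<zero>\<^bsub>K\<^esub> \<in> N" using W(2) D.elem_zero_left by (simp add: N_def E_eq)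
    show "x \<oplus>\<^bsub>K\<^esub> y \<in> N" if "x \<in> N" "y \<in> N" for x y
      using that W(3) D.elem_add_left by (simp add: N_def E_eq)
    show "l \<otimes>\<^bsub>K\<^esub> x \<in> N" if l: "l \<in> range \<phi>" and x: "x \<in> N" for l x
    proof -
      obtain z where z: "l = \<phi> z" using l by auto
      have xc: "x \<in> carrier K" using x by (simp add: N_def)
      have "D.tens (l \<otimes>\<^bsub>K\<^esub> x) d \<in> E.Span F\<^sub>p ?ws" if d: "d \<in> carrier (F_at p)" for d
        unfolding z D.elem_balanced[OF xc d] using x to_F_carrier d by (simp add: N_def)
      then show ?thesis using \<phi>_carr xc z by (simp add: N_def)
    qed
  qed
  moreover have "set us \<subseteq> N"
  proof
    fix u assume u: "u \<in> set us"
    have uc: "u \<in> carrier K" using u us by auto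
    have "D.tens u d \<in> E.Span F\<^sub>p ?ws" if d: "d \<in> carrier (F_at p)" for d
    proof -
      have "D.tens u d = D.tens \<one>\<^bsub>K\<^esub> d \<otimes>\<^bsub>E\<^esub> D.tens u \<one>\<^bsub>F_at p\<^esub>"
        using D.elem_factor[OF uc d F_at.one_closed] d by (simp add: E_eq)
      also have "\<dots> \<in> E.Span F\<^sub>p ?ws"
        using u by (intro W(4) F\<^sub>pI d E.Span_mem[OF F\<^sub>p_subring ws]) simp
      finally show ?thesis .
    qed
    then show "u \<in> N" using uc by (simp add: N_def)
  qed
  ultimately have "K.Span (range \<phi>) us \<subseteq> N" by (rule K.Span_least)
  then show ?thesis using k c by (auto simp: N_def)
qed

lemma A\<^sub>p_subset_R\<^sub>p: "A\<^sub>p \<subseteq> R\<^sub>p"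
proof -
  have "\<one>\<^bsub>K\<^esub> \<in> R" using R_subring by (rule subringE(3))
  then show ?thesis unfolding A_at_in_K_at_def by (intro image_subsetI R\<^sub>pI)
qed

lemma tens_in_R\<^sub>p: "u \<in> R \<Longrightarrow> D.tens u \<one>\<^bsub>F_at p\<^esub> \<in> R\<^sub>p"
  using R\<^sub>pI[OF _ A_at.one_closed] unfolding A_F_map_one .

text \<open>Elements of the tensor product are differences built from pure tensors, and each pure
  tensor has its image in the span of the generators \<open>u \<otimes> 1\<close>.\<close>

lemma R\<^sub>p_fg: "\<exists>ws. set ws \<subseteq> carrier E \<and> R\<^sub>p = E.Span A\<^sub>p ws"
proof -
  obtain us where us: "set us \<subseteq> carrier K" "R = K.Span (range \<alpha>) us" using R_span by auto
  let ?ws = "map (\<lambda>u. D.tens u \<one>\<^bsub>F_at p\<^esub>) us"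
  have ws: "set ?ws \<subseteq> carrier E" using us D.elem_carrier by (auto simp: E_eq)
  note WS = E.Span_submod[OF A\<^sub>p_subring ws]
  note W = E.submodD[OF WS]
  have usR: "u \<in> R" if "u \<in> set us" for u
    unfolding us(2) by (rule K.Span_mem[OF range_\<alpha>_subring us(1) that])
  have 1: "E.Span A\<^sub>p ?ws \<subseteq> R\<^sub>p"
    by (rule E.Span_least[OF E.submod_subring[OF R\<^sub>p_subring A\<^sub>p_subset_R\<^sub>p]])
      (use usR tens_in_R\<^sub>p in auto)
  let ?\<theta> = "tensor_map \<phi> K to_F (F_at p) id A_F_map"
  have "?\<theta> x \<in> E.Span A\<^sub>p ?ws" if "x \<in> carrier S.T" for x
    using that
  proof (induction x rule: S.tensor_induct)
    case zero
    have "tensor_map \<phi> K to_F (F_at p) id A_F_map \<zero>\<^bsub>S.T\<^esub> = \<zero>\<^bsub>E\<^esub>"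
      unfolding E_eq by (rule ring_hom_zero[OF tensor_map_hom S.T.ring_axioms D.T.ring_axioms])
    then show ?case using W(2) by metis
  next
    case (pure r c)
    then have r: "r \<in> R" by simp
    show ?case
      by (subst tensor_map_elem[OF pure]) (use Span_A\<^sub>p[OF us(1) r[unfolded us(2)] pure(2)] in \<open>simp only: id_apply\<close>)
  next
    case (minus x y)
    have "?\<theta> (x \<ominus>\<^bsub>S.T\<^esub> y) = ?\<theta> x \<oplus>\<^bsub>E\<^esub> \<ominus>\<^bsub>E\<^esub> ?\<theta> y"
      unfolding S.T.minus_eq hom_R.hom_add[OF minus(1) S.T.a_inv_closed[OF minus(2)]]
        hom_R.hom_a_inv[OF minus(2)] ..
    moreover have "?\<theta> x \<oplus>\<^bsub>E\<^esub> \<ominus>\<^bsub>E\<^esub> ?\<theta> y \<in> E.Span A\<^sub>p ?ws"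
      by (rule W(3)[OF minus(3) E.submod_neg[OF WS A\<^sub>p_subring minus(4)]])
    ultimately show ?case by metis
  qed
  then have "R\<^sub>p \<subseteq> E.Span A\<^sub>p ?ws" unfolding R_at_in_K_at_def R_at_def by (rule image_subsetI)
  with 1 ws show ?thesis by (intro exI[of _ ?ws]) (rule conjI, assumption, rule equalityI)
qed

lemma R\<^sub>p_spans: "\<exists>us. set us \<subseteq> R\<^sub>p \<and> E.Span F\<^sub>p us = carrier E"
proof -
  obtain us where us: "set us \<subseteq> R" "K.Span (range \<phi>) us = carrier K"
    using order unfolding is_order_def by blast
  have usK: "set us \<subseteq> carrier K" using us(1) R_carr by auto
  let ?ws = "map (\<lambda>u. D.tens u \<one>\<^bsub>F_at p\<^esub>) us"
  have ws: "set ?ws \<subseteq> carrier E" using usK D.elem_carrier by (auto simp: E_eq)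
  note WS = E.Span_submod[OF F\<^sub>p_subring ws]
  note W = E.submodD[OF WS]
  have "x \<in> E.Span F\<^sub>p ?ws" if "x \<in> carrier D.T" for x
    using that
  proof (induction x rule: D.tensor_induct)
    case zero
    show ?case using W(2) by (simp add: E_eq)
  next
    case (pure k c)
    then show ?case using Span_F\<^sub>p[OF usK _ pure(2)] us(2) by simp
  next
    case (minus x y)
    show ?case
      using W(3)[OF minus(3) E.submod_neg[OF WS F\<^sub>p_subring minus(4)]]
      by (simp add: E_eq D.T.minus_eq)
  qed
  then have "E.Span F\<^sub>p ?ws = carrier E" using W(1) by (auto simp: E_eq)
  moreover have "set ?ws \<subseteq> R\<^sub>p" using us(1) tens_in_R\<^sub>p by auto
  ultimately show ?thesis by blast
qed

section \<open>The uniformizer and the axioms of the abstract setting\<close>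

definition uniformizer :: "('k \<times> (nat \<Rightarrow> 'q poly fract) set \<Rightarrow>\<^sub>0 int) set" where
  "uniformizer = D.tens \<one>\<^bsub>K\<^esub> (to_F (Fract \<pi> 1))"

lemma uniformizer_eq: "uniformizer = D.tens \<one>\<^bsub>K\<^esub> (A_F_map (to_A \<pi>))"
  by (simp add: uniformizer_def A_F_map_to_A)

lemma uniformizer_Units: "uniformizer \<in> Units E"
proof -
  let ?v = "D.tens \<one>\<^bsub>K\<^esub> (to_F (Fract 1 \<pi>))"
  have "Fract \<pi> 1 * Fract 1 \<pi> = 1" using \<pi>_nonzero by (simp add: One_fract_def eq_fract)
  then have "to_F (Fract \<pi> 1) \<otimes>\<^bsub>F_at p\<^esub> to_F (Fract 1 \<pi>) = \<one>\<^bsub>F_at p\<^esub>"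
    unfolding F_at_def F.to_completion_mult[symmetric] F.to_completion_one[symmetric] by simp
  then have "uniformizer \<otimes>\<^bsub>E\<^esub> ?v = \<one>\<^bsub>E\<^esub>"
    unfolding uniformizer_def using hom_F.hom_mult[OF to_F_carrier to_F_carrier, symmetric] by simp
  moreover have "uniformizer \<in> carrier E" "?v \<in> carrier E"
    unfolding uniformizer_def by (intro hom_F.hom_closed to_F_carrier)+
  ultimately show ?thesis unfolding Units_def using E.m_comm[of uniformizer ?v] by auto
qed

text \<open>The properties of the completed base rings are pushed forward along the homomorphisms
  into the algebra given by \<open>1 \<otimes> c\<close>; being equations with existential
  witnesses, they pass to images.\<close>

lemma base_order: "base_order E A\<^sub>p uniformizer F\<^sub>p R\<^sub>p"
proof (intro base_order.intro complete_base.intro complete_base_axioms.intro base_order_axioms.intro)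
  let ?\<theta> = "\<lambda>c. D.tens \<one>\<^bsub>K\<^esub> (A_F_map c)"
  show "cring E" by unfold_locales
  show "subring A\<^sub>p E" by (rule A\<^sub>p_subring)
  show "uniformizer \<in> A\<^sub>p" unfolding uniformizer_eq by (intro A\<^sub>pI to_A_carrier)
  show "uniformizer \<in> Units E" by (rule uniformizer_Units)
  show "\<exists>b\<in>A\<^sub>p. (\<one>\<^bsub>E\<^esub> \<ominus>\<^bsub>E\<^esub> uniformizer \<otimes>\<^bsub>E\<^esub> a) \<otimes>\<^bsub>E\<^esub> b = \<one>\<^bsub>E\<^esub>" if a: "a \<in> A\<^sub>p" for a
  proof -
    obtain c where c: "c \<in> carrier (A_at p)" "a = ?\<theta> c"
      using a unfolding A_at_in_K_at_def by blast
    obtain b where b: "b \<in> carrier (A_at p)"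
      "(\<one>\<^bsub>A_at p\<^esub> \<ominus>\<^bsub>A_at p\<^esub> to_A \<pi> \<otimes>\<^bsub>A_at p\<^esub> c) \<otimes>\<^bsub>A_at p\<^esub> b = \<one>\<^bsub>A_at p\<^esub>"
      using A_at_one_minus_invertible[OF c(1)] by blast
    have "?\<theta> ((\<one>\<^bsub>A_at p\<^esub> \<ominus>\<^bsub>A_at p\<^esub> to_A \<pi> \<otimes>\<^bsub>A_at p\<^esub> c) \<otimes>\<^bsub>A_at p\<^esub> b)
        = (\<one>\<^bsub>E\<^esub> \<ominus>\<^bsub>E\<^esub> uniformizer \<otimes>\<^bsub>E\<^esub> a) \<otimes>\<^bsub>E\<^esub> ?\<theta> b"
      using b(1) c(1) to_A_carrier[of \<pi>] by (simp add: A_at.minus_eq E.minus_eq uniformizer_eq c(2))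
    then have "(\<one>\<^bsub>E\<^esub> \<ominus>\<^bsub>E\<^esub> uniformizer \<otimes>\<^bsub>E\<^esub> a) \<otimes>\<^bsub>E\<^esub> ?\<theta> b = \<one>\<^bsub>E\<^esub>"
      unfolding b(2) by simp
    then show ?thesis using A\<^sub>pI[OF b(1)] by blast
  qed
  show "\<exists>D. finite D \<and> D \<subseteq> A\<^sub>p \<and> (\<forall>a\<in>A\<^sub>p. \<exists>d\<in>D. \<exists>b\<in>A\<^sub>p. a = d \<oplus>\<^bsub>E\<^esub> uniformizer \<otimes>\<^bsub>E\<^esub> b)"
  proof (intro exI conjI ballI)
    \<comment> \<open>Remainders on division by \<pi>, finite in number because the coefficient
      field is finite.\<close>
    let ?D = "(\<lambda>r. ?\<theta> (to_A r)) ` {r. degree r < degree \<pi>}"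
    show "finite ?D" by (intro finite_imageI finite_polys_degree_less)
    show "?D \<subseteq> A\<^sub>p" using A\<^sub>pI to_A_carrier by blast
    fix a assume "a \<in> A\<^sub>p"
    then obtain c where c: "c \<in> carrier (A_at p)" "a = ?\<theta> c" unfolding A_at_in_K_at_def by blast
    obtain r b where r: "degree r < degree \<pi>" "b \<in> carrier (A_at p)"
      "c = to_A r \<oplus>\<^bsub>A_at p\<^esub> to_A \<pi> \<otimes>\<^bsub>A_at p\<^esub> b"
      using A_at_residue[OF c(1)] by blast
    have "a = ?\<theta> (to_A r) \<oplus>\<^bsub>E\<^esub> uniformizer \<otimes>\<^bsub>E\<^esub> ?\<theta> b"
      unfolding c(2) r(3) uniformizer_eq using r(2) to_A_carrier by simp
    then show "\<exists>d\<in>?D. \<exists>b\<in>A\<^sub>p. a = d \<oplus>\<^bsub>E\<^esub> uniformizer \<otimes>\<^bsub>E\<^esub> b"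
      using r(1) A\<^sub>pI[OF r(2)] by blast
  qed
  show "F\<^sub>p \<subseteq> carrier E" by (rule subringE(1)[OF F\<^sub>p_subring])
  show "\<exists>n::nat. uniformizer [^]\<^bsub>E\<^esub> n \<otimes>\<^bsub>E\<^esub> c \<in> A\<^sub>p" if cF: "c \<in> F\<^sub>p" for c
  proof -
    obtain x where x: "x \<in> carrier (F_at p)" "c = D.tens \<one>\<^bsub>K\<^esub> x"
      using cF unfolding F_at_in_K_at_def by blast
    obtain n :: nat and a where a: "a \<in> carrier (A_at p)"
      "to_F (Fract \<pi> 1) [^]\<^bsub>F_at p\<^esub> n \<otimes>\<^bsub>F_at p\<^esub> x = A_F_map a"
      using F_at_denominator[OF x(1)] by blast
    have "uniformizer [^]\<^bsub>E\<^esub> n = D.tens \<one>\<^bsub>K\<^esub> (to_F (Fract \<pi> 1) [^]\<^bsub>F_at p\<^esub> n)"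
      unfolding uniformizer_def using to_F_carrier by (induction n) simp_all
    then have "uniformizer [^]\<^bsub>E\<^esub> n \<otimes>\<^bsub>E\<^esub> c = D.tens \<one>\<^bsub>K\<^esub> (to_F (Fract \<pi> 1) [^]\<^bsub>F_at p\<^esub> n \<otimes>\<^bsub>F_at p\<^esub> x)"
      using x to_F_carrier by simp
    then have "uniformizer [^]\<^bsub>E\<^esub> n \<otimes>\<^bsub>E\<^esub> c \<in> A\<^sub>p"
      unfolding a(2) using A\<^sub>pI[OF a(1)] by metis
    then show ?thesis by (rule exI)
  qed
  show "subring R\<^sub>p E" by (rule R\<^sub>p_subring)
  show "A\<^sub>p \<subseteq> R\<^sub>p" by (rule A\<^sub>p_subset_R\<^sub>p)
  show "\<exists>ws. set ws \<subseteq> carrier E \<and> R\<^sub>p = E.Span A\<^sub>p ws" by (rule R\<^sub>p_fg)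
  show "\<exists>us. set us \<subseteq> R\<^sub>p \<and> E.Span F\<^sub>p us = carrier E" by (rule R\<^sub>p_spans)
qed

end

theorem proposition4p24:
  fixes f :: "'q::{field,finite} poly poly"
    and K :: "('k, 'm) ring_scheme"
    and \<iota> :: "'q poly poly set \<Rightarrow> 'k"
    and R :: "'k set"
    and p :: "'q poly set"
  assumes "Factorial_Ring.irreducible f"
    and "Polynomial.degree f > 0"
    and "is_fraction_field (quotient_by f) K \<iota>"
    and "is_order K (range (A_to_K f \<iota>)) (range (F_to_K f K \<iota>)) R"
    and "primeideal p ring_of_type_algebra"
    and "p \<noteq> {0}"
  shows "let E = K_at f K \<iota> p; B = R_at_in_K_at f K \<iota> R p; Over = overorders_at f K \<iota> R p in
           (\<forall>I. fractional_ideal E B I \<longrightarrow> ideal_class_rel E B `` {I} = weak_rel E B `` {I}) \<and>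
           ICM E B = (\<Union>S\<in>Over. weak_classes E B S) \<and>
           disjoint_family_on (weak_classes E B) Over"
proof -
  obtain \<pi> where "prime_elem \<pi>" "p = {a. \<pi> dvd a}"
    using prime_ideal_generator[OF assms(5,6)] by auto
  moreover have "field K" using assms(3) unfolding is_fraction_field_def by (rule conjunct1)
  ultimately interpret O: completed_order \<pi> p K f \<iota> R
    using assms(2-4) by (intro completed_order.intro completed_order_axioms.intro poly_prime.intro)
  interpret base_order "K_at f K \<iota> p" "A_at_in_K_at f K \<iota> p" O.uniformizer
    "F_at_in_K_at f K \<iota> p" "R_at_in_K_at f K \<iota> R p"
    by (rule O.base_order)
  show ?thesis
    unfolding Let_def overorders_at_def
    by (intro conjI allI impI ICM_eq_Union_weak_classes disjoint_weak_classes)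
      (simp only: ideal_class_rel_eq_weak_rel)
qed

end
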